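(* Let $z^0\in H^1_0(\Omega)$ with $\|z^0\|_{L^2(\Omega)}=1$, let $\tau_{\max}$ be as in the energy reduction lemma (i.e. a $\tau_{\max}\in(0,2)$, depending on $\beta$ and $E(z^0)$, such that step sizes in $(0,\tau_{\max}]$ guarantee $E(z^{n+1})\le E(\hat z^{n+1})\le E(z^n)$ for all $n$), and let the step sizes satisfy $0<\tau_{\min}\le\tau_n\le\tau_{\max}$ for all $n$. Then the limit $E^\ast=\lim_{n\to\infty}E(z^n)$ exists, and there is a subsequence $(z^{n_i})_i$ and $z^\ast\in H^1_0(\Omega)$ with $\|z^\ast\|_{L^2(\Omega)}=1$ and $E(z^\ast)=E^\ast$ such that $z^{n_i}\to z^\ast$ strongly in $H^1(\Omega)$. Moreover, $\lambda^\ast:=\lim_{i\to\infty}\gamma^{n_i}$ exists, equals $(z^\ast,\mathcal G_{z^\ast}z^\ast)_{L^2(\Omega)}^{-1}=\|\mathcal G_{z^\ast}z^\ast\|_{L^2(\Omega)}^{-1}$, and $$a_{z^\ast}(z^\ast,v)=\lambda^\ast(z^\ast,v)_{L^2(\Omega)}\quad\text{for all }v\in H^1_0(\Omega),$$ i.e. $z^\ast$ is an eigenfunction of the GPE. Furthermore, every convergent subsequence of $(z^n)$ converges strongly in $H^1(\Omega)$ to an $L^2$-normalized eigenfunction of the GPE with energy $E^\ast$ (its eigenvalue possibly differing from $\lambda^\ast$).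
   Context: Standing assumptions: Let $d\in\{1,2,3\}$ and let $\Omega\subset\mathbb{R}^d$ be a bounded domain which is either a convex Lipschitz domain or has a smooth boundary. All functions are real-valued. Let $\beta\ge 0$ and $V\in L^\infty(\Omega)$ with $V\ge 1$ a.e. For $v\in H^1_0(\Omega)$ define the energy $E(v)=\frac12\int_\Omega |\nabla v|^2+V v^2+\frac{\beta}{2}v^4\,dx$. For $z\in H^1_0(\Omega)$ define the bilinear form $a_z(v,w)=\int_\Omega \nabla v\cdot\nabla w+Vvw+\beta z^2vw\,dx$ on $H^1_0(\Omega)$. For $f\in L^2(\Omega)$ let $\mathcal G_z f\in H^1_0(\Omega)$ denote the unique solution of $a_z(\mathcal G_z f,v)=(f,v)_{L^2(\Omega)}$ for all $v\in H^1_0(\Omega)$. An eigenfunction of the Gross–Pitaevskii eigenvalue problem (GPE) is a $z^\ast\in H^1_0(\Omega)$ with $\|z^\ast\|_{L^2(\Omega)}=1$ for which there is $\lambda^\ast\in\mathbb R$ with $a_{z^\ast}(z^\ast,v)=\lambda^\ast(z^\ast,v)_{L^2(\Omega)}$ for all $v\in H^1_0(\Omega)$. GF$a_z$ iteration: given $z^0\in H^1_0(\Omega)$ with $\|z^0\|_{L^2(\Omega)}=1$ and step sizes $\tau_n>0$, define for $n\ge0$: $\gamma^n=(z^n,z^n)_{L^2(\Omega)}/a_{z^n}(\mathcal G_{z^n}z^n,\mathcal G_{z^n}z^n)$, $\hat z^{n+1}=(1-\tau_n)z^n+\tau_n\gamma^n\mathcal G_{z^n}z^n$ and $z^{n+1}=\hat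 z^{n+1}/\|\hat z^{n+1}\|_{L^2(\Omega)}$. *)

theory Defs
  imports "HOL-Analysis.Analysis"
begin

definition dderiv :: "'a::euclidean_space \<Rightarrow> ('a \<Rightarrow> real) \<Rightarrow> 'a \<Rightarrow> real" where
  "dderiv v f x = frechet_derivative f (at x) v"

definition Cinf_on :: "'a::euclidean_space set \<Rightarrow> ('a \<Rightarrow> real) \<Rightarrow> bool" where
  "Cinf_on U f \<longleftrightarrow>
     (\<forall>vs. set vs \<subseteq> Basis \<longrightarrow> (\<forall>x\<in>U. (foldr dderiv vs f) differentiable (at x)))"

definition test_fun :: "'a::euclidean_space set \<Rightarrow> ('a \<Rightarrow> real) \<Rightarrow> bool" where
  "test_fun \<Omega> \<phi> \<longleftrightarrow> Cinf_on UNIV \<phi> \<and> compact (closure {x. \<phi> x \<noteq> 0})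
      \<and> closure {x. \<phi> x \<noteq> 0} \<subseteq> \<Omega>"

definition bounded_domain :: "'a::euclidean_space set \<Rightarrow> bool" where
  "bounded_domain \<Omega> \<longleftrightarrow> open \<Omega> \<and> connected \<Omega> \<and> \<Omega> \<noteq> {} \<and> bounded \<Omega>"

text \<open>Lipschitz boundary: near every boundary point, after choosing a unit direction e,
  the domain is the region below the graph of a Lipschitz function defined on the
  hyperplane orthogonal to e.\<close>
definition lipschitz_boundary :: "'a::euclidean_space set \<Rightarrow> bool" where
  "lipschitz_boundary \<Omega> \<longleftrightarrow>
     (\<forall>p\<in>frontier \<Omega>. \<exists>r>0. \<exists>e C h. norm e = 1 \<and>
        lipschitz_on C {y. y \<bullet> e = 0} (h :: 'a \<Rightarrow> real) \<and>
        \<Omega> \<inter> ball p r = {x \<in> ball p r. x \<bullet> e < h (x - (x \<bullet> e) *\<^sub>R e)})"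

definition smooth_boundary :: "'a::euclidean_space set \<Rightarrow> bool" where
  "smooth_boundary \<Omega> \<longleftrightarrow>
     (\<forall>p\<in>frontier \<Omega>. \<exists>U \<phi>. open U \<and> p \<in> U \<and> Cinf_on U \<phi> \<and>
        (\<forall>x\<in>U. frechet_derivative \<phi> (at x) \<noteq> (\<lambda>_. 0)) \<and>
        \<Omega> \<inter> U = {x \<in> U. \<phi> x < 0})"

section \<open>L2, weak gradient, H1, H1_0 (functions modulo a.e. equality)\<close>

definition L2 :: "'a::euclidean_space set \<Rightarrow> ('a \<Rightarrow> real) \<Rightarrow> bool" where
  "L2 \<Omega> f \<longleftrightarrow> f \<in> borel_measurable (lebesgue_on \<Omega>)
      \<and> integrable (lebesgue_on \<Omega>) (\<lambda>x. (f x)\<^sup>2)"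

definition L2inner :: "'a::euclidean_space set \<Rightarrow> ('a \<Rightarrow> real) \<Rightarrow> ('a \<Rightarrow> real) \<Rightarrow> real" where
  "L2inner \<Omega> f g = (\<integral>x. f x * g x \<partial>lebesgue_on \<Omega>)"

definition L2norm :: "'a::euclidean_space set \<Rightarrow> ('a \<Rightarrow> real) \<Rightarrow> real" where
  "L2norm \<Omega> f = sqrt (\<integral>x. (f x)\<^sup>2 \<partial>lebesgue_on \<Omega>)"

definition weak_grad :: "'a::euclidean_space set \<Rightarrow> ('a \<Rightarrow> real) \<Rightarrow> ('a \<Rightarrow> 'a) \<Rightarrow> bool" where
  "weak_grad \<Omega> u g \<longleftrightarrow>
     (\<forall>i\<in>Basis. L2 \<Omega> (\<lambda>x. g x \<bullet> i) \<and>
        (\<forall>\<phi>. test_fun \<Omega> \<phi> \<longrightarrow>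
           (\<integral>x. u x * dderiv i \<phi> x \<partial>lebesgue_on \<Omega>) = - (\<integral>x. (g x \<bullet> i) * \<phi> x \<partial>lebesgue_on \<Omega>)))"

definition H1 :: "'a::euclidean_space set \<Rightarrow> ('a \<Rightarrow> real) \<Rightarrow> bool" where
  "H1 \<Omega> u \<longleftrightarrow> L2 \<Omega> u \<and> (\<exists>g. weak_grad \<Omega> u g)"

definition grad :: "'a::euclidean_space set \<Rightarrow> ('a \<Rightarrow> real) \<Rightarrow> 'a \<Rightarrow> 'a" where
  "grad \<Omega> u = (SOME g. weak_grad \<Omega> u g)"

definition H1norm :: "'a::euclidean_space set \<Rightarrow> ('a \<Rightarrow> real) \<Rightarrow> real" where
  "H1norm \<Omega> u = sqrt ((\<integral>x. (u x)\<^sup>2 \<partial>lebesgue_on \<Omega>) + (\<integral>x. (norm (grad \<Omega> u x))\<^sup>2 \<partial>lebesgue_on \<Omega>))"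

definition H10 :: "'a::euclidean_space set \<Rightarrow> ('a \<Rightarrow> real) set" where
  "H10 \<Omega> = {u. H1 \<Omega> u \<and> (\<exists>\<phi>. (\<forall>k. test_fun \<Omega> (\<phi> k)) \<and>
                 (\<lambda>k. H1norm \<Omega> (\<lambda>x. \<phi> k x - u x)) \<longlonglongrightarrow> 0)}"

definition energy :: "'a::euclidean_space set \<Rightarrow> ('a \<Rightarrow> real) \<Rightarrow> real \<Rightarrow> ('a \<Rightarrow> real) \<Rightarrow> real" where
  "energy \<Omega> V \<beta> v = (1/2) * (\<integral>x. (norm (grad \<Omega> v x))\<^sup>2 + V x * (v x)\<^sup>2 + (\<beta>/2) * (v x)^4 \<partial>lebesgue_on \<Omega>)"

definition aform :: "'a::euclidean_space set \<Rightarrow> ('a \<Rightarrow> real) \<Rightarrow> real \<Rightarrow> ('a \<Rightarrow> real)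
    \<Rightarrow> ('a \<Rightarrow> real) \<Rightarrow> ('a \<Rightarrow> real) \<Rightarrow> real" where
  "aform \<Omega> V \<beta> z v w = (\<integral>x. grad \<Omega> v x \<bullet> grad \<Omega> w x + V x * v x * w x
                             + \<beta> * (z x)\<^sup>2 * v x * w x \<partial>lebesgue_on \<Omega>)"

text \<open>Solution operator G_z f (unique up to a.e. equality).\<close>
definition Gop :: "'a::euclidean_space set \<Rightarrow> ('a \<Rightarrow> real) \<Rightarrow> real \<Rightarrow> ('a \<Rightarrow> real)
    \<Rightarrow> ('a \<Rightarrow> real) \<Rightarrow> ('a \<Rightarrow> real)" where
  "Gop \<Omega> V \<beta> z f = (SOME u. u \<in> H10 \<Omega> \<and> (\<forall>v\<in>H10 \<Omega>. aform \<Omega> V \<beta> z u v = L2inner \<Omega> f v))"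

definition is_GPE_eigenfunction :: "'a::euclidean_space set \<Rightarrow> ('a \<Rightarrow> real) \<Rightarrow> real
    \<Rightarrow> ('a \<Rightarrow> real) \<Rightarrow> real \<Rightarrow> bool" where
  "is_GPE_eigenfunction \<Omega> V \<beta> z lam \<longleftrightarrow> z \<in> H10 \<Omega> \<and> L2norm \<Omega> z = 1 \<and>
     (\<forall>v\<in>H10 \<Omega>. aform \<Omega> V \<beta> z z v = lam * L2inner \<Omega> z v)"

definition gf_gamma :: "'a::euclidean_space set \<Rightarrow> ('a \<Rightarrow> real) \<Rightarrow> real \<Rightarrow> ('a \<Rightarrow> real) \<Rightarrow> real" where
  "gf_gamma \<Omega> V \<beta> z = L2inner \<Omega> z z / aform \<Omega> V \<beta> z (Gop \<Omega> V \<beta> z z) (Gop \<Omega> V \<beta> z z)"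

definition gf_hat :: "'a::euclidean_space set \<Rightarrow> ('a \<Rightarrow> real) \<Rightarrow> real \<Rightarrow> real
    \<Rightarrow> ('a \<Rightarrow> real) \<Rightarrow> ('a \<Rightarrow> real)" where
  "gf_hat \<Omega> V \<beta> t z = (\<lambda>x. (1 - t) * z x + t * gf_gamma \<Omega> V \<beta> z * Gop \<Omega> V \<beta> z z x)"

definition gf_step :: "'a::euclidean_space set \<Rightarrow> ('a \<Rightarrow> real) \<Rightarrow> real \<Rightarrow> real
    \<Rightarrow> ('a \<Rightarrow> real) \<Rightarrow> ('a \<Rightarrow> real)" where
  "gf_step \<Omega> V \<beta> t z = (\<lambda>x. gf_hat \<Omega> V \<beta> t z x / L2norm \<Omega> (gf_hat \<Omega> V \<beta> t z))"

primrec gf_seq :: "'a::euclidean_space set \<Rightarrow> ('a \<Rightarrow> real) \<Rightarrow> real \<Rightarrow> (nat \<Rightarrow> real)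
    \<Rightarrow> ('a \<Rightarrow> real) \<Rightarrow> nat \<Rightarrow> ('a \<Rightarrow> real)" where
  "gf_seq \<Omega> V \<beta> \<tau> z0 0 = z0"
| "gf_seq \<Omega> V \<beta> \<tau> z0 (Suc n) = gf_step \<Omega> V \<beta> (\<tau> n) (gf_seq \<Omega> V \<beta> \<tau> z0 n)"

end

theory Submission
  imports Defs "HOL-Complex_Analysis.Great_Picard" "HOL-Real_Asymp.Real_Asymp"
begin

text \<open>
  Let \<open>d\<^sub>n = \<gamma>\<^sup>n G z\<^sup>n - z\<^sup>n\<close> be the search direction. It is \<open>L\<^sup>2\<close>-orthogonal to \<open>z\<^sup>n\<close>, so the norm of the
  intermediate iterate is at least \<open>1\<close>, and rescaling it to norm \<open>1\<close> alone lowers the energy by at least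
  \<open>\<tau>\<^sub>n\<^sup>2 \<parallel>d\<^sub>n\<parallel>\<^sup>2 / 2\<close>, because \<open>V \<ge> 1\<close>. Since the energies converge, \<open>d\<^sub>n\<close> tends to \<open>0\<close> in \<open>L\<^sup>2\<close>, and
  by the Gagliardo--Nirenberg inequality also in \<open>L\<^sup>4\<close>. With \<open>a = a\<^bsub>z\<^esub>\<close>, \<open>z = z\<^sup>n\<close>, \<open>d = d\<^sub>n\<close>, the identity
  \<open>E (z + t d) = E z - t (1 - t / 2) a d d + \<beta> t\<^sup>2 \<integral> d\<^sup>2 (z + t d / 2)\<^sup>2\<close> then forces \<open>a d d \<rightarrow> 0\<close>, i.e.
  \<open>d\<^sub>n \<rightarrow> 0\<close> in \<open>H\<^sup>1\<close>. Consequently the iterates solve the eigenvalue equation up to an error that vanishes in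
  \<open>H\<^sup>1\<close>. Testing this equation with differences of iterates shows that any subsequence that is Cauchy in
  \<open>L\<^sup>2\<close>, in particular the one provided by Rellich's theorem, is Cauchy in \<open>H\<^sup>1\<close>, and the equation passes to
  the limit.
\<close>

section \<open>Smoothness via iterated directional derivatives, and its closure properties\<close>

section \<open>Smooth functions\<close>

text \<open>The energy hypothesis supplies monotonicity without a rate, and the quartic remainder in
  the energy identity is of second order in d, just like the gain, while the steps need not be
  small. The gain cannot absorb the remainder directly. This dictates the order L2, L4, H1: the
  first smallness comes from the normalisation alone and makes the remainder vanish in the limit;
  \<open>\<tau>max < 2\<close> then keeps 1 - t/2 away from 0. The forms a_z change with the
  iterate, so two approximate equations cannot be subtracted as they stand. Moving the density term
  to the right leaves the fixed form with weight \<open>V\<close> on the left, and the right-hand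
  side only needs a test function that is small in L2 and bounded in H1. Strong limits then come
  from completeness; weak compactness never enters. \<open>grad\<close> and \<open>Gop\<close> are
  arbitrary choices, determined only almost everywhere, which is why smooth cutoffs and the
  uniqueness of weak gradients come early. The L4 inequality and Rellich's theorem are proved for
  test functions on the whole space and reach \<open>H10\<close> by density.\<close>

primrec Cn :: "nat \<Rightarrow> ('a::euclidean_space \<Rightarrow> real) \<Rightarrow> bool" where
  "Cn 0 f = True"
| "Cn (Suc n) f = ((\<forall>x. f differentiable at x) \<and> (\<forall>b\<in>Basis. Cn n (dderiv b f)))"

text \<open>Lists of directions are awkward for induction on products; \<open>Cn\<close> counts
  derivatives instead, so that the product rule becomes an induction step. It peels off the
  innermost derivative, which is the last entry of the list.\<close>

lemma Cinf_on_UNIV_iff_Cn: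
  fixes f :: "'a::euclidean_space \<Rightarrow> real"
  shows "Cinf_on UNIV f \<longleftrightarrow> (\<forall>n. Cn n f)"
proof
  assume c: "Cinf_on UNIV f"
  have "Cn n f" if "Cinf_on UNIV f" for n and f :: "'a \<Rightarrow> real"
    using that
  proof (induction n arbitrary: f)
    case (Suc n)
    have "f differentiable at x" for x
      using Suc.prems[unfolded Cinf_on_def, rule_format, of "[]" x] by simp
    moreover have "Cn n (dderiv b f)" if b: "b \<in> Basis" for b
    proof (rule Suc.IH)
      show "Cinf_on UNIV (dderiv b f)"
        unfolding Cinf_on_def
      proof (intro allI impI ballI)
        fix vs :: "'a list" and x :: 'a assume "set vs \<subseteq> Basis"
        then have "foldr dderiv (vs @ [b]) f differentiable at x"
          using Suc.prems[unfolded Cinf_on_def, rule_format, of "vs @ [b]" x] b by simp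
        then show "foldr dderiv vs (dderiv b f) differentiable at x" by simp
      qed
    qed
    ultimately show ?case by simp
  qed simp
  with c show "\<forall>n. Cn n f" by blast
next
  assume c: "\<forall>n. Cn n f"
  have "\<forall>n. Cn n (foldr dderiv vs f)" if "set vs \<subseteq> Basis" for vs
    using that
  proof (induction vs)
    case (Cons v vs)
    then show ?case by (metis Cn.simps(2) foldr.simps(2) list.set_intros(1) o_apply set_subset_Cons subset_iff)
  qed (use c in simp)
  then show "Cinf_on UNIV f"
    unfolding Cinf_on_def by (meson Cn.simps(2))
qed

lemma Cn_SucD: "Cn (Suc n) f \<Longrightarrow> Cn n f"
  by (induction n arbitrary: f) auto

lemma dderiv_eqI: "(f has_derivative f') (at x) \<Longrightarrow> dderiv b f x = f' b"
  unfolding dderiv_def using frechet_derivative_at by metis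

lemma dderiv_const: "dderiv b (\<lambda>x. c) = (\<lambda>x. 0)"
  by (rule ext) (rule dderiv_eqI[OF has_derivative_const])

lemma dderiv_mult:
  assumes "\<And>x. f differentiable at x" "\<And>x. g differentiable at x"
  shows "dderiv b (\<lambda>x. f x * g x) = (\<lambda>x. f x * dderiv b g x + dderiv b f x * g x)"
proof
  fix x
  have "((\<lambda>x. f x * g x) has_derivative
      (\<lambda>h. f x * frechet_derivative g (at x) h + frechet_derivative f (at x) h * g x)) (at x)"
    using assms frechet_derivative_works by (intro has_derivative_mult) blast+
  then show "dderiv b (\<lambda>x. f x * g x) x = f x * dderiv b g x + dderiv b f x * g x"
    using dderiv_eqI by (fastforce simp: dderiv_def[of _ f] dderiv_def[of _ g])
qed

lemma dderiv_add:
  assumes "\<And>x. f differentiable at x" "\<And>x. g differentiable at x"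
  shows "dderiv b (\<lambda>x. f x + g x) = (\<lambda>x. dderiv b f x + dderiv b g x)"
proof
  fix x
  have "((\<lambda>x. f x + g x) has_derivative
      (\<lambda>h. frechet_derivative f (at x) h + frechet_derivative g (at x) h)) (at x)"
    using assms frechet_derivative_works by (intro has_derivative_add) blast+
  then show "dderiv b (\<lambda>x. f x + g x) x = dderiv b f x + dderiv b g x"
    using dderiv_eqI by (fastforce simp: dderiv_def[of _ f] dderiv_def[of _ g])
qed

lemma Cn_const: "Cn n (\<lambda>x. c)"
proof (induction n arbitrary: c)
  case (Suc n)
  show ?case using Suc[of 0] by (simp add: dderiv_const)
qed simp

lemma Cn_add: "Cn n f \<Longrightarrow> Cn n g \<Longrightarrow> Cn n (\<lambda>x. f x + g x)"
  by (induction n arbitrary: f g) (auto simp: dderiv_add)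

lemma Cn_mult: "Cn n f \<Longrightarrow> Cn n g \<Longrightarrow> Cn n (\<lambda>x. f x * g x)"
proof (induction n arbitrary: f g)
  case (Suc n)
  then have "Cn n f" "Cn n g" using Cn_SucD by blast+
  then show ?case using Suc by (auto simp: dderiv_mult intro!: Cn_add)
qed simp

lemma Cn_diff: "Cn n f \<Longrightarrow> Cn n g \<Longrightarrow> Cn n (\<lambda>x. f x - g x)"
  using Cn_add[of n f "\<lambda>x. -1 * g x"] Cn_mult[OF Cn_const[of n "-1"], of g] by simp

lemma Cn_prod: "finite S \<Longrightarrow> (\<And>i. i \<in> S \<Longrightarrow> Cn n (f i)) \<Longrightarrow> Cn n (\<lambda>x. \<Prod>i\<in>S. f i x)"
  by (induction S rule: finite_induct) (auto intro: Cn_const Cn_mult)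

section \<open>Smooth bumps on boxes and a smooth exhaustion of an open set\<close>

section \<open>Bump functions\<close>

text \<open>The classical flat function exp(-1/t), with a polynomial factor in 1/t that makes the
  family closed under differentiation.\<close>

definition flat :: "real poly \<Rightarrow> real \<Rightarrow> real" where
  "flat p t = (if t > 0 then poly p (inverse t) * exp (- inverse t) else 0)"

lemma poly_exp_decay: "((\<lambda>s. poly p s * exp (- s)) \<longlongrightarrow> (0::real)) at_top"
proof -
  have "((\<lambda>s. \<Sum>i\<le>degree p. coeff p i * (s ^ i / exp s)) \<longlongrightarrow> (\<Sum>i\<le>degree p. coeff p i * 0)) at_top"
    by (intro tendsto_sum tendsto_mult tendsto_const tendsto_power_div_exp_0)
  then show ?thesis
    by (simp add: poly_altdef sum_distrib_right exp_minus divide_inverse mult.assoc)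
qed

text \<open>With s = 1/t the chain rule turns p(s) exp(-s) into s^2 (p - p')(s) exp(-s), and
  \<open>[:0,0,1:]\<close> is s^2. At 0 the right-hand difference quotient is s p(s) exp(-s), which
  decays as s grows.\<close>

lemma flat_deriv:
  "(flat p has_real_derivative flat ([:0,0,1:] * (p - pderiv p)) t) (at t)"
proof -
  consider "t > 0" | "t < 0" | "t = 0" by linarith
  then show ?thesis
  proof cases
    case 1
    have d: "((\<lambda>t. poly p (inverse t) * exp (- inverse t)) has_real_derivative
        flat ([:0,0,1:] * (p - pderiv p)) t) (at t)"
      using 1 by (auto intro!: derivative_eq_intros poly_DERIV
        simp: flat_def algebra_simps power2_eq_square inverse_eq_divide)
    show ?thesis
      by (rule has_field_derivative_transform_within_open[OF d, of "{0<..}"])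
         (use 1 in \<open>auto simp: flat_def\<close>)
  next
    case 2
    show ?thesis
      by (rule has_field_derivative_transform_within_open[of "\<lambda>t. 0" _ _ "{..<0}"])
         (use 2 in \<open>auto simp: flat_def\<close>)
  next
    case 3
    have "((\<lambda>h. poly (pCons 0 p) (inverse h) * exp (- inverse h)) \<longlongrightarrow> 0) (at_right 0)"
      using poly_exp_decay[of "pCons 0 p"] filterlim_inverse_at_top_right
      by (rule filterlim_compose)
    then have r: "((\<lambda>h. flat p h / h) \<longlongrightarrow> 0) (at_right 0)"
      by (rule Lim_transform_eventually)
         (auto simp: eventually_at_filter flat_def field_simps)
    have l: "((\<lambda>h. flat p h / h) \<longlongrightarrow> 0) (at_left 0)"
      by (rule Lim_transform_eventually[OF tendsto_const])
         (auto simp: eventually_at_filter flat_def)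
    have "((\<lambda>h. flat p h / h) \<longlongrightarrow> 0) (at 0)"
      using l r filterlim_split_at by blast
    then show ?thesis
      using 3 by (simp add: has_field_derivative_iff flat_def)
  qed
qed

lemma Cn_flat: "Cn n (\<lambda>x. flat p (x \<bullet> v + c))"
proof (induction n arbitrary: p)
  case (Suc n)
  define q where "q = [:0,0,1:] * (p - pderiv p)"
  have d: "((\<lambda>x. flat p (x \<bullet> v + c)) has_derivative (\<lambda>h. flat q (x \<bullet> v + c) * (h \<bullet> v))) (at x)" for x
  proof -
    have "((\<lambda>x. x \<bullet> v + c) has_derivative (\<lambda>h. h \<bullet> v)) (at x)"
      by (auto intro!: derivative_eq_intros)
    moreover have "(flat p has_derivative (*) (flat q (x \<bullet> v + c))) (at (x \<bullet> v + c))"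
      using flat_deriv[of p "x \<bullet> v + c"] unfolding q_def has_field_derivative_def .
    ultimately show ?thesis
      using has_derivative_compose by blast
  qed
  then have "dderiv b (\<lambda>x. flat p (x \<bullet> v + c)) = (\<lambda>x. flat q (x \<bullet> v + c) * (b \<bullet> v))" for b
    using dderiv_eqI[OF d] by auto
  then show ?case
    using d Suc[of q] by (auto simp: differentiable_def intro!: Cn_mult Cn_const)
qed simp

lemma flat_1_bounds: "0 \<le> flat 1 t" "flat 1 t \<le> 1"
  by (auto simp: flat_def)

lemma flat_1_tendsto:
  assumes "0 < a"
  shows "(\<lambda>n. flat 1 (real n * a - 1)) \<longlonglongrightarrow> 1"
proof -
  have f: "filterlim (\<lambda>n. real n * a - 1) at_top sequentially"
    using assms by real_asymp
  have "(\<lambda>n. exp (- inverse (real n * a - 1))) \<longlonglongrightarrow> 1"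
    using assms by real_asymp
  moreover have "\<forall>\<^sub>F n in sequentially. exp (- inverse (real n * a - 1)) = flat 1 (real n * a - 1)"
    using f[unfolded filterlim_at_top_dense, rule_format, of 0] by eventually_elim (auto simp: flat_def)
  ultimately show ?thesis
    by (rule Lim_transform_eventually)
qed

text \<open>The offset -1 makes a factor vanish within distance 1/n of its face, so the support is
  compact inside the open box. For a fixed interior point the arguments of all factors tend to
  infinity with n.\<close>

definition bump :: "'a::euclidean_space \<Rightarrow> 'a \<Rightarrow> nat \<Rightarrow> 'a \<Rightarrow> real" where
  "bump a b n x = (\<Prod>i\<in>Basis. flat 1 (real n * (x \<bullet> i - a \<bullet> i) - 1) * flat 1 (real n * (b \<bullet> i - x \<bullet> i) - 1))"

lemma Cn_bump: "Cn m (bump a b n)"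
proof -
  have "Cn m (\<lambda>x. flat 1 (real n * (x \<bullet> i - a \<bullet> i) - 1))" for i
    using Cn_flat[of m 1 "real n *\<^sub>R i" "- real n * (a \<bullet> i) - 1"] by (simp add: algebra_simps)
  moreover have "Cn m (\<lambda>x. flat 1 (real n * (b \<bullet> i - x \<bullet> i) - 1))" for i
    using Cn_flat[of m 1 "- real n *\<^sub>R i" "real n * (b \<bullet> i) - 1"] by (simp add: algebra_simps)
  ultimately show ?thesis
    unfolding bump_def by (intro Cn_prod Cn_mult) auto
qed

lemma bump_bounds: "0 \<le> bump a b n x" "bump a b n x \<le> 1"
  unfolding bump_def by (auto intro!: prod_nonneg prod_le_1 mult_nonneg_nonneg mult_le_one flat_1_bounds)

lemma bump_tendsto: "x \<in> box a b \<Longrightarrow> (\<lambda>n. bump a b n x) \<longlonglongrightarrow> 1"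
  unfolding bump_def
  by (rule tendsto_eq_rhs, rule tendsto_prod, rule tendsto_mult)
     (auto intro!: flat_1_tendsto simp: mem_box)

lemma bump_support:
  assumes "bump a b n x \<noteq> 0"
  shows "x \<in> cbox (a + (1 / real n) *\<^sub>R One) (b - (1 / real n) *\<^sub>R One)"
    and "cbox (a + (1 / real n) *\<^sub>R One) (b - (1 / real n) *\<^sub>R One) \<subseteq> box a b"
proof -
  have *: "real n * (x \<bullet> i - a \<bullet> i) > 1" "real n * (b \<bullet> i - x \<bullet> i) > 1" if "i \<in> Basis" for i
    using assms that by (force simp: bump_def flat_def split: if_splits)+
  have n: "n > 0"
    using *(1)[OF SOME_Basis] by (cases n) auto
  show "x \<in> cbox (a + (1 / real n) *\<^sub>R One) (b - (1 / real n) *\<^sub>R One)"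
    using * n by (auto simp: mem_box inner_add_left inner_diff_left field_simps dest!: less_imp_le)
  show "cbox (a + (1 / real n) *\<^sub>R One) (b - (1 / real n) *\<^sub>R One) \<subseteq> box a b"
    using n by (auto simp: subset_box mem_box inner_add_left inner_diff_left
        intro: less_le_trans[rotated] le_less_trans)
qed

lemma box_empty: "{} = box 0 (0::'a::euclidean_space)"
  using nonempty_Basis by (auto simp: box_def)

text \<open>An open set is a countable union of boxes, and 1 minus the product of the terms 1 - bump
  is a smooth substitute for the indicator of the union of the first n boxes. All factors lie in
  [0, 1], so a single one tending to 0 sends the product to 0.\<close>

lemma test_fun_exhaustion:
  fixes U :: "'a::euclidean_space set"
  assumes "open U"
  obtains F :: "nat \<Rightarrow> 'a \<Rightarrow> real" where
    "\<And>n. test_fun U (F n)" "\<And>n x. 0 \<le> F n x" "\<And>n x. F n x \<le> 1"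
    "\<And>n x. x \<notin> U \<Longrightarrow> F n x = 0" "\<And>x. x \<in> U \<Longrightarrow> (\<lambda>n. F n x) \<longlonglongrightarrow> 1"
proof -
  obtain D where D: "countable D" "D \<subseteq> Pow U" "\<And>X. X \<in> D \<Longrightarrow> \<exists>a b. X = box a b" "\<Union>D = U"
    using open_countable_Union_open_box[OF assms] by metis
  \<comment> \<open>The empty box is added because \<open>from_nat_into\<close> enumerates nonempty
    sets only.\<close>
  have "\<forall>X. \<exists>a b. X \<in> insert {} D \<longrightarrow> X = box a b"
    using D(3) box_empty by (metis insertE)
  then obtain f g where fg: "\<And>X. X \<in> insert {} D \<Longrightarrow> X = box (f X) (g X)"
    by metis
  define a b where "a i = f (from_nat_into (insert {} D) i)" and "b i = g (from_nat_into (insert {} D) i)" for i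
  have ab: "from_nat_into (insert {} D) i = box (a i) (b i)" for i
    unfolding a_def b_def by (rule fg) (rule from_nat_into, simp)
  have cover: "(\<Union>i. box (a i) (b i)) = U"
  proof -
    have "(\<Union>i. box (a i) (b i)) = \<Union>(range (from_nat_into (insert {} D)))"
      by (simp add: ab)
    also have "\<dots> = U"
      using D(1,4) by (subst range_from_nat_into) auto
    finally show ?thesis .
  qed
  define F where "F n x = 1 - (\<Prod>i<n. 1 - bump (a i) (b i) n x)" for n x
  have p: "0 \<le> (\<Prod>i\<in>S. 1 - bump (a i) (b i) n x)" "(\<Prod>i\<in>S. 1 - bump (a i) (b i) n x) \<le> 1" for S n x
    using bump_bounds[of "a _" "b _" n x] by (auto intro!: prod_nonneg prod_le_1)
  \<comment> \<open>If the shrunken box is not contained in the open box, the bump vanishes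
    identically, so the empty set serves as its support.\<close>
  define K where "K n i = (let C = cbox (a i + (1 / real n) *\<^sub>R One) (b i - (1 / real n) *\<^sub>R One) in
      if C \<subseteq> box (a i) (b i) then C else {})" for n i
  have K: "compact (K n i)" "K n i \<subseteq> U" for n i
    using cover by (auto simp: K_def Let_def)
  have supp: "{x. F n x \<noteq> 0} \<subseteq> (\<Union>i<n. K n i)" for n
  proof
    fix x assume "x \<in> {x. F n x \<noteq> 0}"
    then have "(\<Prod>i<n. 1 - bump (a i) (b i) n x) \<noteq> 1" by (simp add: F_def)
    moreover have "(\<Prod>i<n. 1 - bump (a i) (b i) n x) = 1" if "\<forall>i<n. bump (a i) (b i) n x = 0"
      using that by (intro prod.neutral) auto
    ultimately obtain i where "i < n" "bump (a i) (b i) n x \<noteq> 0"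
      by blast
    then show "x \<in> (\<Union>i<n. K n i)"
      using bump_support[of "a i" "b i" n x] by (auto simp: K_def Let_def)
  qed
  have cK: "compact (\<Union>i<n. K n i)" for n using K by auto
  have cl: "closure {x. F n x \<noteq> 0} \<subseteq> (\<Union>i<n. K n i)" for n
    by (rule closure_minimal[OF supp compact_imp_closed[OF cK]])
  have "Cn m (F n)" for m n
    unfolding F_def by (intro Cn_diff Cn_const Cn_prod finite_lessThan Cn_bump)
  then have test: "test_fun U (F n)" for n
    unfolding test_fun_def Cinf_on_UNIV_iff_Cn
    using cl[of n] K(2) compact_closure[of "{x. F n x \<noteq> 0}"] bounded_subset[OF compact_imp_bounded[OF cK] supp]
    by blast
  have zero: "F n x = 0" if "x \<notin> U" for n x
    using supp[of n] K(2) that by blast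
  have lim: "(\<lambda>n. F n x) \<longlonglongrightarrow> 1" if "x \<in> U" for x
  proof -
    have "x \<in> (\<Union>i. box (a i) (b i))" using cover that by simp
    then obtain j where j: "x \<in> box (a j) (b j)" by blast
    have "(\<lambda>n. 1 - bump (a j) (b j) n x) \<longlonglongrightarrow> 1 - 1"
      by (intro tendsto_diff tendsto_const bump_tendsto j)
    moreover have "(\<Prod>i<n. 1 - bump (a i) (b i) n x) \<le> 1 - bump (a j) (b j) n x" if "n > j" for n
    proof -
      have "(\<Prod>i<n. 1 - bump (a i) (b i) n x) =
          (1 - bump (a j) (b j) n x) * (\<Prod>i\<in>{..<n} - {j}. 1 - bump (a i) (b i) n x)"
        using that by (subst prod.remove[of _ j]) auto
      also have "\<dots> \<le> 1 - bump (a j) (b j) n x"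
        using p[of n x "{..<n} - {j}"] bump_bounds[of "a j" "b j" n x] by (intro mult_left_le) auto
      finally show ?thesis .
    qed
    ultimately have "(\<lambda>n. \<Prod>i<n. 1 - bump (a i) (b i) n x) \<longlonglongrightarrow> 0"
      by (intro tendsto_sandwich[of "\<lambda>_. 0" "\<lambda>n. \<Prod>i<n. 1 - bump (a i) (b i) n x" sequentially
           "\<lambda>n. 1 - bump (a j) (b j) n x" 0])
         (auto intro!: always_eventually p eventually_sequentiallyI[of "Suc j"])
    then have "(\<lambda>n. 1 - (\<Prod>i<n. 1 - bump (a i) (b i) n x)) \<longlonglongrightarrow> 1 - 0"
      by (intro tendsto_diff tendsto_const)
    then show ?thesis by (simp add: F_def)
  qed
  show ?thesis
    using that[of F] test zero lim p by (simp add: F_def)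
qed

section \<open>L2 and L4 over a general measure: Cauchy-Schwarz, completeness, limits of
  products\<close>

section \<open>Square and fourth-power integrable functions\<close>

definition sqint :: "'b measure \<Rightarrow> ('b \<Rightarrow> real) \<Rightarrow> bool" where
  "sqint M f \<longleftrightarrow> f \<in> borel_measurable M \<and> integrable M (\<lambda>x. (f x)\<^sup>2)"

definition qint :: "'b measure \<Rightarrow> ('b \<Rightarrow> real) \<Rightarrow> bool" where
  "qint M f \<longleftrightarrow> f \<in> borel_measurable M \<and> integrable M (\<lambda>x. (f x)^4)"

lemma sqint_meas: "sqint M f \<Longrightarrow> f \<in> borel_measurable M"
  and sqint_int: "sqint M f \<Longrightarrow> integrable M (\<lambda>x. (f x)\<^sup>2)"
  by (auto simp: sqint_def)

lemma qint_int: "qint M f \<Longrightarrow> integrable M (\<lambda>x. (f x)^4)"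
  by (simp add: qint_def)

lemma two_mult_le_squares: "2 * \<bar>a * b\<bar> \<le> a\<^sup>2 + (b::real)\<^sup>2"
  using sum_squares_bound[of "\<bar>a\<bar>" "\<bar>b\<bar>"] by (simp add: abs_mult)

lemma sqint_mult_integrable:
  assumes "sqint M f" "sqint M g"
  shows "integrable M (\<lambda>x. f x * g x)"
proof (rule Bochner_Integration.integrable_bound)
  show "integrable M (\<lambda>x. (f x)\<^sup>2 + (g x)\<^sup>2)"
    using assms by (auto simp: sqint_def)
  show "(\<lambda>x. f x * g x) \<in> borel_measurable M"
    using assms by (auto simp: sqint_def)
  show "AE x in M. norm (f x * g x) \<le> norm ((f x)\<^sup>2 + (g x)\<^sup>2)"
  proof (rule AE_I2)
    fix x show "norm (f x * g x) \<le> norm ((f x)\<^sup>2 + (g x)\<^sup>2)"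
      using two_mult_le_squares[of "f x" "g x"] abs_ge_zero[of "f x * g x"]
      unfolding real_norm_def by linarith
  qed
qed

lemma sqint_cmult: "sqint M f \<Longrightarrow> sqint M (\<lambda>x. c * f x)"
  by (auto simp: sqint_def power_mult_distrib)

lemma sqint_add:
  assumes "sqint M f" "sqint M g"
  shows "sqint M (\<lambda>x. f x + g x)"
proof -
  have "integrable M (\<lambda>x. (f x)\<^sup>2 + (g x)\<^sup>2 + 2 * (f x * g x))"
    using sqint_mult_integrable[OF assms] assms by (auto simp: sqint_def)
  then show ?thesis
    using assms by (auto simp: sqint_def power2_sum mult.assoc)
qed

lemma sqint_diff: "sqint M f \<Longrightarrow> sqint M g \<Longrightarrow> sqint M (\<lambda>x. f x - g x)"
  using sqint_add[of M f "\<lambda>x. -1 * g x"] sqint_cmult[of M g "-1"] by simp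

lemma sqint_lincomb: "sqint M f \<Longrightarrow> sqint M g \<Longrightarrow> sqint M (\<lambda>x. a * f x + b * g x)"
  by (intro sqint_add sqint_cmult)

lemma sqint_abs: "sqint M f \<Longrightarrow> sqint M (\<lambda>x. \<bar>f x\<bar>)"
  by (auto simp: sqint_def)

lemma sqint_bound:
  assumes "sqint M g" "f \<in> borel_measurable M" "AE x in M. \<bar>f x\<bar> \<le> \<bar>g x\<bar>"
  shows "sqint M f"
  unfolding sqint_def
proof
  show "integrable M (\<lambda>x. (f x)\<^sup>2)"
    by (rule Bochner_Integration.integrable_bound[OF sqint_int[OF assms(1)]])
       (use assms in \<open>auto simp: abs_le_square_iff\<close>)
qed (use assms in auto)

lemma integral_square_lincomb:
  assumes "sqint M f" "sqint M g"
  shows "(\<integral>x. (a * f x + b * g x)\<^sup>2 \<partial>M)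
    = a\<^sup>2 * (\<integral>x. (f x)\<^sup>2 \<partial>M) + 2 * a * b * (\<integral>x. f x * g x \<partial>M) + b\<^sup>2 * (\<integral>x. (g x)\<^sup>2 \<partial>M)"
proof -
  have "(\<integral>x. (a * f x + b * g x)\<^sup>2 \<partial>M)
      = (\<integral>x. a\<^sup>2 * (f x)\<^sup>2 + (2 * a * b) * (f x * g x) + b\<^sup>2 * (g x)\<^sup>2 \<partial>M)"
    by (intro Bochner_Integration.integral_cong) (auto simp: power2_eq_square algebra_simps)
  also have "\<dots> = a\<^sup>2 * (\<integral>x. (f x)\<^sup>2 \<partial>M) + (2 * a * b) * (\<integral>x. f x * g x \<partial>M) + b\<^sup>2 * (\<integral>x. (g x)\<^sup>2 \<partial>M)"
    using sqint_mult_integrable[OF assms] assms[THEN sqint_int] by simp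
  finally show ?thesis .
qed

text \<open>The choice (s, t) = (C, -B) gives C (A C - B^2) >= 0. If C = 0 the form is linear in t,
  and nonnegativity forces B = 0. Cauchy-Schwarz for integrals and for the weighted forms both rest
  on this.\<close>

lemma nonneg_quadratic_discriminant:
  fixes A B C :: real
  assumes "\<And>s t. 0 \<le> s\<^sup>2 * A + 2 * s * t * B + t\<^sup>2 * C"
  shows "B\<^sup>2 \<le> A * C"
proof (cases "C = 0")
  case False
  have C: "C > 0" using assms[of 0 1] False by simp
  have "0 \<le> C * (A * C - B\<^sup>2)"
    using assms[of C "-B"] by (simp add: power2_eq_square algebra_simps)
  then show ?thesis using C by (simp add: zero_le_mult_iff)
next
  case True
  have "B = 0"
  proof (rule ccontr)
    assume "B \<noteq> 0"
    then show False using assms[of 1 "- (A + 1) / (2 * B)"] True by (simp add: field_simps)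
  qed
  then show ?thesis using True by simp
qed

lemma integral_Cauchy_Schwarz:
  assumes "sqint M f" "sqint M g"
  shows "(\<integral>x. f x * g x \<partial>M)\<^sup>2 \<le> (\<integral>x. (f x)\<^sup>2 \<partial>M) * (\<integral>x. (g x)\<^sup>2 \<partial>M)"
proof (rule nonneg_quadratic_discriminant)
  fix s t :: real
  have "0 \<le> (\<integral>x. (s * f x + t * g x)\<^sup>2 \<partial>M)" by simp
  then show "0 \<le> s\<^sup>2 * (\<integral>x. (f x)\<^sup>2 \<partial>M) + 2 * s * t * (\<integral>x. f x * g x \<partial>M) + t\<^sup>2 * (\<integral>x. (g x)\<^sup>2 \<partial>M)"
    unfolding integral_square_lincomb[OF assms] .
qed

lemma integral_Cauchy_Schwarz_sqrt:
  assumes "sqint M f" "sqint M g"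
  shows "\<bar>\<integral>x. f x * g x \<partial>M\<bar> \<le> sqrt (\<integral>x. (f x)\<^sup>2 \<partial>M) * sqrt (\<integral>x. (g x)\<^sup>2 \<partial>M)"
  using real_sqrt_le_mono[OF integral_Cauchy_Schwarz[OF assms]] by (simp add: real_sqrt_mult)

lemma integral_square_add_le:
  assumes "sqint M f" "sqint M g"
  shows "(\<integral>x. (f x + g x)\<^sup>2 \<partial>M) \<le> 2 * (\<integral>x. (f x)\<^sup>2 \<partial>M) + 2 * (\<integral>x. (g x)\<^sup>2 \<partial>M)"
proof -
  have "0 \<le> (\<integral>x. (1 * f x + (-1) * g x)\<^sup>2 \<partial>M)"
    by (intro Bochner_Integration.integral_nonneg) simp
  moreover have "(\<integral>x. (1 * f x + 1 * g x)\<^sup>2 \<partial>M) = (\<integral>x. (f x + g x)\<^sup>2 \<partial>M)" by simp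
  ultimately show ?thesis
    unfolding integral_square_lincomb[OF assms] by simp
qed

lemma integral_mult_tendsto_0:
  assumes "\<And>n. sqint M (f n)" "\<And>n. sqint M (g n)"
    and "(\<lambda>n. \<integral>x. (f n x)\<^sup>2 \<partial>M) \<longlonglongrightarrow> 0" "\<And>n. (\<integral>x. (g n x)\<^sup>2 \<partial>M) \<le> K"
  shows "(\<lambda>n. \<integral>x. f n x * g n x \<partial>M) \<longlonglongrightarrow> 0"
proof (rule Lim_null_comparison)
  have "(\<lambda>n. sqrt (\<integral>x. (f n x)\<^sup>2 \<partial>M) * sqrt K) \<longlonglongrightarrow> sqrt 0 * sqrt K"
    by (intro tendsto_mult tendsto_const tendsto_real_sqrt assms)
  then show "(\<lambda>n. sqrt (\<integral>x. (f n x)\<^sup>2 \<partial>M) * sqrt K) \<longlonglongrightarrow> 0" by simp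
  have "norm (\<integral>x. f n x * g n x \<partial>M) \<le> sqrt (\<integral>x. (f n x)\<^sup>2 \<partial>M) * sqrt K" for n
    unfolding real_norm_def
    by (rule order_trans[OF integral_Cauchy_Schwarz_sqrt[OF assms(1,2)]])
       (intro mult_left_mono real_sqrt_le_mono assms real_sqrt_ge_zero Bochner_Integration.integral_nonneg, simp)
  then show "\<forall>\<^sub>F n in sequentially. norm (\<integral>x. f n x * g n x \<partial>M) \<le> sqrt (\<integral>x. (f n x)\<^sup>2 \<partial>M) * sqrt K"
    by simp
qed

lemma integral_mult_tendsto:
  assumes f: "\<And>n. sqint M (f n)" "sqint M f0" "(\<lambda>n. \<integral>x. (f n x - f0 x)\<^sup>2 \<partial>M) \<longlonglongrightarrow> 0"
    and g: "\<And>n. sqint M (g n)" "sqint M g0" "(\<lambda>n. \<integral>x. (g n x - g0 x)\<^sup>2 \<partial>M) \<longlonglongrightarrow> 0"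
  shows "(\<lambda>n. \<integral>x. f n x * g n x \<partial>M) \<longlonglongrightarrow> (\<integral>x. f0 x * g0 x \<partial>M)"
proof -
  note d = sqint_diff[OF f(1,2)] sqint_diff[OF g(1,2)]
  obtain K where "\<forall>n. norm (\<integral>x. (g n x - g0 x)\<^sup>2 \<partial>M) \<le> K"
    using convergent_imp_Bseq[OF convergentI[OF g(3)]] by (rule BseqE)
  then have K': "(\<integral>x. (g n x - g0 x)\<^sup>2 \<partial>M) \<le> K" for n
    using norm_ge_zero order_trans by fastforce
  have "(\<lambda>n. (\<integral>x. (f n x - f0 x) * (g n x - g0 x) \<partial>M) + (\<integral>x. (f n x - f0 x) * g0 x \<partial>M)
      + (\<integral>x. (g n x - g0 x) * f0 x \<partial>M) + (\<integral>x. f0 x * g0 x \<partial>M)) \<longlonglongrightarrow> 0 + 0 + 0 + (\<integral>x. f0 x * g0 x \<partial>M)"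
    by (intro tendsto_add tendsto_const integral_mult_tendsto_0[OF d f(3) K']
        integral_mult_tendsto_0[OF d(1) g(2) f(3) order_refl]
        integral_mult_tendsto_0[OF d(2) f(2) g(3) order_refl])
  moreover have "(\<integral>x. (f n x - f0 x) * (g n x - g0 x) \<partial>M) + (\<integral>x. (f n x - f0 x) * g0 x \<partial>M)
      + (\<integral>x. (g n x - g0 x) * f0 x \<partial>M) + (\<integral>x. f0 x * g0 x \<partial>M) = (\<integral>x. f n x * g n x \<partial>M)" for n
  proof -
    have i: "integrable M (\<lambda>x. (f n x - f0 x) * (g n x - g0 x))" "integrable M (\<lambda>x. (f n x - f0 x) * g0 x)"
      "integrable M (\<lambda>x. (g n x - g0 x) * f0 x)" "integrable M (\<lambda>x. f0 x * g0 x)"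
      by (intro sqint_mult_integrable d f g)+
    have "(\<integral>x. f n x * g n x \<partial>M) = (\<integral>x. (f n x - f0 x) * (g n x - g0 x) + (f n x - f0 x) * g0 x
        + (g n x - g0 x) * f0 x + f0 x * g0 x \<partial>M)"
      by (intro Bochner_Integration.integral_cong) (auto simp: algebra_simps)
    then show ?thesis using i by simp
  qed
  ultimately show ?thesis by simp
qed

text \<open>Fatou's lemma in the shape in which it is applied: integrability of the limit is a
  conclusion, and the bounds may vary with k as long as they converge.\<close>

lemma integral_Fatou_bound:
  fixes g :: "nat \<Rightarrow> 'b \<Rightarrow> real"
  assumes "\<And>k. integrable M (g k)" "\<And>k x. 0 \<le> g k x" "\<And>x. 0 \<le> h x" "h \<in> borel_measurable M"
    and lim: "AE x in M. (\<lambda>k. g k x) \<longlonglongrightarrow> h x" and le: "\<And>k. (\<integral>x. g k x \<partial>M) \<le> c k" and c: "c \<longlonglongrightarrow> K"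
  shows "integrable M h" "(\<integral>x. h x \<partial>M) \<le> K"
proof -
  have [measurable]: "g k \<in> borel_measurable M" for k using assms(1) by auto
  have c0: "0 \<le> c k" for k
    using le[of k] Bochner_Integration.integral_nonneg[of M "g k"] assms(2) by (meson order_trans)
  then have K0: "0 \<le> K" using c by (meson LIMSEQ_le_const)
  have "(\<integral>\<^sup>+x. ennreal (h x) \<partial>M) = (\<integral>\<^sup>+x. liminf (\<lambda>k. ennreal (g k x)) \<partial>M)"
  proof (intro nn_integral_cong_AE eventually_mono[OF lim])
    fix x assume "(\<lambda>k. g k x) \<longlonglongrightarrow> h x"
    then have "(\<lambda>k. ennreal (g k x)) \<longlonglongrightarrow> ennreal (h x)" by (rule tendsto_ennrealI)
    then show "ennreal (h x) = liminf (\<lambda>k. ennreal (g k x))"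
      using lim_imp_Liminf[of sequentially] by (metis trivial_limit_sequentially)
  qed
  also have "\<dots> \<le> liminf (\<lambda>k. \<integral>\<^sup>+x. ennreal (g k x) \<partial>M)"
    by (rule nn_integral_liminf) simp
  also have "\<dots> \<le> liminf (\<lambda>k. ennreal (c k))"
    using assms(1,2) le by (intro Liminf_mono always_eventually allI) (simp add: nn_integral_eq_integral ennreal_leI)
  also have "\<dots> = ennreal K"
    using lim_imp_Liminf[OF trivial_limit_sequentially tendsto_ennrealI[OF c]] .
  finally have *: "(\<integral>\<^sup>+x. ennreal (h x) \<partial>M) \<le> ennreal K" .
  then have "(\<integral>\<^sup>+x. ennreal (h x) \<partial>M) < \<infinity>" using le_less_trans by fastforce
  then show i: "integrable M h"
    using assms(3,4) by (intro integrableI_nonneg) auto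
  show "(\<integral>x. h x \<partial>M) \<le> K"
    using * nn_integral_eq_integral[OF i] assms(3) K0 by simp
qed

lemma L2_tendsto_AE_subseq:
  assumes "\<And>n. sqint M (f n)" "sqint M g" "(\<lambda>n. \<integral>x. (f n x - g x)\<^sup>2 \<partial>M) \<longlonglongrightarrow> 0"
  obtains r where "strict_mono (r :: nat \<Rightarrow> nat)" "AE x in M. (\<lambda>n. f (r n) x) \<longlonglongrightarrow> g x"
proof -
  have "integrable M (\<lambda>x. (f n x - g x)\<^sup>2)" for n
    by (intro sqint_int sqint_diff assms)
  then obtain r where r: "strict_mono (r :: nat \<Rightarrow> nat)" "AE x in M. (\<lambda>n. (f (r n) x - g x)\<^sup>2) \<longlonglongrightarrow> 0"
    using tendsto_L1_AE_subseq[of M "\<lambda>n x. (f n x - g x)\<^sup>2"] assms(3) by auto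
  have "AE x in M. (\<lambda>n. f (r n) x) \<longlonglongrightarrow> g x"
    using r(2)
  proof eventually_elim
    case (elim x)
    have "(\<lambda>n. sqrt ((f (r n) x - g x)\<^sup>2)) \<longlonglongrightarrow> sqrt 0"
      by (intro tendsto_real_sqrt elim)
    then have "(\<lambda>n. \<bar>f (r n) x - g x\<bar>) \<longlonglongrightarrow> 0"
      by (simp only: real_sqrt_abs real_sqrt_zero)
    then show ?case
      using LIM_zero_iff tendsto_rabs_zero_cancel by blast
  qed
  with r(1) that show ?thesis by blast
qed

text \<open>Riesz-Fischer. Finiteness of the measure turns L2-Cauchy into L1-Cauchy, which provides
  a subsequence that is Cauchy almost everywhere. Fatou along it, with the other index fixed,
  recovers L2 convergence of the whole sequence.\<close>

lemma L2_complete: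
  assumes M: "finite_measure M" and f: "\<And>n. sqint M (f n)"
    and cauchy: "\<And>e. e > 0 \<Longrightarrow> \<exists>N. \<forall>m\<ge>N. \<forall>n\<ge>N. (\<integral>x. (f m x - f n x)\<^sup>2 \<partial>M) < e"
  obtains g where "sqint M g" "(\<lambda>n. \<integral>x. (f n x - g x)\<^sup>2 \<partial>M) \<longlonglongrightarrow> 0"
proof -
  interpret finite_measure M by fact
  have one: "sqint M (\<lambda>x. 1)" by (auto simp: sqint_def)
  note d = sqint_diff[OF f f]
  have L1: "(\<integral>x. \<bar>h x\<bar> \<partial>M)\<^sup>2 \<le> (\<integral>x. (h x)\<^sup>2 \<partial>M) * measure M (space M)" if "sqint M h" for h
    using integral_Cauchy_Schwarz[OF sqint_abs[OF that] one] by simp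
  have [measurable]: "f n \<in> borel_measurable M" for n using f by (rule sqint_meas)
  obtain r where r: "strict_mono (r :: nat \<Rightarrow> nat)" "AE x in M. Cauchy (\<lambda>i. f (r i) x)"
  proof (rule cauchy_L1_AE_cauchy_subseq[of M f])
    show "integrable M (f n)" for n
      using sqint_mult_integrable[OF f one] by simp
    fix e :: real assume e: "e > 0"
    \<comment> \<open>The added 1 avoids division by zero when the space has measure 0.\<close>
    define m where "m = measure M (space M) + 1"
    have m: "m > 0" "measure M (space M) \<le> m" by (auto simp: m_def intro: add_nonneg_pos)
    obtain N where N: "\<And>i j. i \<ge> N \<Longrightarrow> j \<ge> N \<Longrightarrow> (\<integral>x. (f i x - f j x)\<^sup>2 \<partial>M) < e\<^sup>2 / m"
      using cauchy[of "e\<^sup>2 / m"] e m by auto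
    have "(\<integral>x. norm (f i x - f j x) \<partial>M) < e" if "i \<ge> N" "j \<ge> N" for i j
    proof (rule power_less_imp_less_base)
      have "(\<integral>x. \<bar>f i x - f j x\<bar> \<partial>M)\<^sup>2 \<le> (\<integral>x. (f i x - f j x)\<^sup>2 \<partial>M) * m"
        by (rule order_trans[OF L1[OF d, of i j]]) (intro mult_left_mono m Bochner_Integration.integral_nonneg, simp)
      also have "\<dots> < e\<^sup>2 / m * m"
        using N[OF that] m by (intro mult_strict_right_mono)
      finally show "(\<integral>x. norm (f i x - f j x) \<partial>M)\<^sup>2 < e\<^sup>2" using m by simp
    qed (use e in simp)
    then show "\<exists>N. \<forall>i\<ge>N. \<forall>j\<ge>N. (\<integral>x. norm (f i x - f j x) \<partial>M) < e" by blast
  qed blast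
  define g where "g x = lim (\<lambda>i. f (r i) x)" for x
  have [measurable]: "g \<in> borel_measurable M"
    unfolding g_def by (intro borel_measurable_lim_metric) simp
  have lim: "AE x in M. (\<lambda>i. f (r i) x) \<longlonglongrightarrow> g x"
    using r(2) by eventually_elim (auto simp: g_def Cauchy_convergent_iff convergent_LIMSEQ_iff)
  have key: "integrable M (\<lambda>x. (f n x - g x)\<^sup>2) \<and> (\<integral>x. (f n x - g x)\<^sup>2 \<partial>M) \<le> e"
    if N: "\<And>m n. m \<ge> N \<Longrightarrow> n \<ge> N \<Longrightarrow> (\<integral>x. (f m x - f n x)\<^sup>2 \<partial>M) < e" and n: "n \<ge> N" for N n e
  proof -
    \<comment> \<open>The shift by \<open>N\<close> puts every index \<open>r (k + N)\<close> beyond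
      \<open>N\<close>, so the Cauchy bound holds for all k.\<close>
    have *: "AE x in M. (\<lambda>k. (f n x - f (r (k + N)) x)\<^sup>2) \<longlonglongrightarrow> (f n x - g x)\<^sup>2"
      using lim by eventually_elim (auto intro!: tendsto_intros LIMSEQ_ignore_initial_segment)
    have "(\<integral>x. (f n x - f (r (k + N)) x)\<^sup>2 \<partial>M) \<le> e" for k
      using N[OF n, of "r (k + N)"] seq_suble[OF r(1), of "k + N"] by simp
    note F = integral_Fatou_bound[OF sqint_int[OF d] _ _ _ * this tendsto_const]
    show ?thesis by (intro conjI F) auto
  qed
  have "sqint M g"
  proof -
    obtain N where N: "\<forall>m\<ge>N. \<forall>n\<ge>N. (\<integral>x. (f m x - f n x)\<^sup>2 \<partial>M) < 1"
      using cauchy[of 1] by auto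
    have "sqint M (\<lambda>x. f N x - g x)"
      using key[of N 1 N] N by (auto simp: sqint_def)
    then show ?thesis using sqint_diff[OF f, of "\<lambda>x. f N x - g x" N] by simp
  qed
  moreover have "(\<lambda>n. \<integral>x. (f n x - g x)\<^sup>2 \<partial>M) \<longlonglongrightarrow> 0"
  proof (rule LIMSEQ_I)
    fix e :: real assume e: "e > 0"
    obtain N where "\<forall>m\<ge>N. \<forall>n\<ge>N. (\<integral>x. (f m x - f n x)\<^sup>2 \<partial>M) < e / 2"
      using cauchy[of "e/2"] e by auto
    then have "\<forall>n\<ge>N. (\<integral>x. (f n x - g x)\<^sup>2 \<partial>M) \<le> e / 2"
      using key[of N "e/2"] by blast
    then show "\<exists>N. \<forall>n\<ge>N. norm ((\<integral>x. (f n x - g x)\<^sup>2 \<partial>M) - 0) < e"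
      using e by (intro exI[of _ N]) fastforce
  qed
  ultimately show ?thesis using that by blast
qed

lemma qint_sqint_square: "qint M f \<Longrightarrow> sqint M (\<lambda>x. (f x)\<^sup>2)"
  by (auto simp: qint_def sqint_def)

lemma qint_mult_sqint:
  assumes "qint M f" "qint M g"
  shows "sqint M (\<lambda>x. f x * g x)"
  using sqint_mult_integrable[OF assms[THEN qint_sqint_square]] assms
  by (auto simp: sqint_def qint_def power_mult_distrib)

lemma qint_mult_bound:
  assumes "qint M f" "qint M g"
  shows "(\<integral>x. (f x * g x)\<^sup>2 \<partial>M) \<le> sqrt (\<integral>x. (f x)^4 \<partial>M) * sqrt (\<integral>x. (g x)^4 \<partial>M)"
  using integral_Cauchy_Schwarz_sqrt[OF assms[THEN qint_sqint_square]]
  by (simp add: power_mult_distrib flip: power_mult)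

lemma qint_cmult: "qint M f \<Longrightarrow> qint M (\<lambda>x. c * f x)"
  by (auto simp: qint_def power_mult_distrib)

lemma power4_add_le: "(a + b)^4 \<le> 8 * a^4 + 8 * (b::real)^4"
proof -
  have "(a + b)\<^sup>2 \<le> 2 * a\<^sup>2 + 2 * b\<^sup>2" using sum_squares_bound[of a b] by (simp add: power2_sum)
  then have "((a + b)\<^sup>2)\<^sup>2 \<le> (2 * a\<^sup>2 + 2 * b\<^sup>2)\<^sup>2" by (intro power_mono) auto
  also have "\<dots> \<le> 8 * (a\<^sup>2)\<^sup>2 + 8 * (b\<^sup>2)\<^sup>2"
    using sum_squares_bound[of "a\<^sup>2" "b\<^sup>2"] by (simp add: power2_sum power_mult_distrib)
  finally show ?thesis by (simp flip: power_mult)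
qed

lemma qint_add:
  assumes "qint M f" "qint M g"
  shows "qint M (\<lambda>x. f x + g x)"
    and "(\<integral>x. (f x + g x)^4 \<partial>M) \<le> 8 * (\<integral>x. (f x)^4 \<partial>M) + 8 * (\<integral>x. (g x)^4 \<partial>M)"
proof -
  have i: "integrable M (\<lambda>x. 8 * (f x)^4 + 8 * (g x)^4)" using assms by (auto simp: qint_def)
  have "integrable M (\<lambda>x. (f x + g x)^4)"
    by (rule Bochner_Integration.integrable_bound[OF i])
       (use assms power4_add_le in \<open>auto simp: qint_def\<close>)
  then show "qint M (\<lambda>x. f x + g x)" using assms by (auto simp: qint_def)
  have "(\<integral>x. (f x + g x)^4 \<partial>M) \<le> (\<integral>x. 8 * (f x)^4 + 8 * (g x)^4 \<partial>M)"
    by (intro integral_mono i power4_add_le) fact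
  then show "(\<integral>x. (f x + g x)^4 \<partial>M) \<le> 8 * (\<integral>x. (f x)^4 \<partial>M) + 8 * (\<integral>x. (g x)^4 \<partial>M)"
    using assms by (auto simp: qint_def)
qed

lemma qint_diff: "qint M f \<Longrightarrow> qint M g \<Longrightarrow> qint M (\<lambda>x. f x - g x)"
  using qint_add(1)[of M f "\<lambda>x. -1 * g x"] qint_cmult[of M g "-1"] by simp

text \<open>The difference of the products is (f_n - f0)(g_n - g0) + (f_n - f0) g0 + f0 (g_n - g0),
  and the L2 norm of each summand is at most the product of two L4 norms.\<close>

lemma qint_product_tendsto:
  assumes f: "\<And>n. qint M (f n)" "qint M f0" "(\<lambda>n. \<integral>x. (f n x - f0 x)^4 \<partial>M) \<longlonglongrightarrow> 0"
    and g: "\<And>n. qint M (g n)" "qint M g0" "(\<lambda>n. \<integral>x. (g n x - g0 x)^4 \<partial>M) \<longlonglongrightarrow> 0"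
  shows "(\<lambda>n. \<integral>x. (f n x * g n x - f0 x * g0 x)\<^sup>2 \<partial>M) \<longlonglongrightarrow> 0"
proof (rule Lim_null_comparison)
  note d = qint_diff[OF f(1,2)] qint_diff[OF g(1,2)]
  define A B where "A n = (\<integral>x. (f n x - f0 x)^4 \<partial>M)" and "B n = (\<integral>x. (g n x - g0 x)^4 \<partial>M)" for n
  define F G where "F = (\<integral>x. (f0 x)^4 \<partial>M)" and "G = (\<integral>x. (g0 x)^4 \<partial>M)"
  let ?c = "\<lambda>n. 2 * (2 * (sqrt (A n) * sqrt (B n)) + 2 * (sqrt (A n) * sqrt G)) + 2 * (sqrt F * sqrt (B n))"
  have "?c \<longlonglongrightarrow> 2 * (2 * (sqrt 0 * sqrt 0) + 2 * (sqrt 0 * sqrt G)) + 2 * (sqrt F * sqrt 0)"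
    using f(3) g(3) unfolding A_def[symmetric] B_def[symmetric] by (intro tendsto_intros)
  then show "?c \<longlonglongrightarrow> 0" by simp
  have aux: "2 * (2 * x + 2 * y) + 2 * z \<le> 2 * (2 * a + 2 * b) + 2 * c"
    if "x \<le> a" "y \<le> b" "z \<le> c" for x y z a b c :: real
    using that by simp
  have bound: "(\<integral>x. (f n x * g n x - f0 x * g0 x)\<^sup>2 \<partial>M) \<le> ?c n" for n
  proof -
    have s: "sqint M (\<lambda>x. (f n x - f0 x) * (g n x - g0 x))" "sqint M (\<lambda>x. (f n x - f0 x) * g0 x)"
      "sqint M (\<lambda>x. f0 x * (g n x - g0 x))"
      by (intro qint_mult_sqint d f g)+
    have "(\<integral>x. (f n x * g n x - f0 x * g0 x)\<^sup>2 \<partial>M)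
        = (\<integral>x. (((f n x - f0 x) * (g n x - g0 x) + (f n x - f0 x) * g0 x) + f0 x * (g n x - g0 x))\<^sup>2 \<partial>M)"
      by (intro Bochner_Integration.integral_cong refl arg_cong[where f="\<lambda>t. t\<^sup>2"]) (simp add: algebra_simps)
    also have "\<dots> \<le> 2 * (\<integral>x. ((f n x - f0 x) * (g n x - g0 x) + (f n x - f0 x) * g0 x)\<^sup>2 \<partial>M)
        + 2 * (\<integral>x. (f0 x * (g n x - g0 x))\<^sup>2 \<partial>M)"
      by (intro integral_square_add_le sqint_add s)
    also have "\<dots> \<le> 2 * (2 * (\<integral>x. ((f n x - f0 x) * (g n x - g0 x))\<^sup>2 \<partial>M) + 2 * (\<integral>x. ((f n x - f0 x) * g0 x)\<^sup>2 \<partial>M))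
        + 2 * (\<integral>x. (f0 x * (g n x - g0 x))\<^sup>2 \<partial>M)"
      using integral_square_add_le[OF s(1,2)] by simp
    also have "\<dots> \<le> ?c n"
      unfolding A_def B_def F_def G_def
      by (rule aux[OF qint_mult_bound[OF d(1)[of n] d(2)[of n]] qint_mult_bound[OF d(1)[of n] g(2)]
        qint_mult_bound[OF f(2) d(2)[of n]]])
    finally show ?thesis .
  qed
  show "\<forall>\<^sub>F n in sequentially. norm (\<integral>x. (f n x * g n x - f0 x * g0 x)\<^sup>2 \<partial>M) \<le> ?c n"
  proof (intro always_eventually allI)
    fix n
    have nn: "0 \<le> (\<integral>x. (f n x * g n x - f0 x * g0 x)\<^sup>2 \<partial>M)"
      by (rule Bochner_Integration.integral_nonneg) simp
    show "norm (\<integral>x. (f n x * g n x - f0 x * g0 x)\<^sup>2 \<partial>M) \<le> ?c n"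
      unfolding real_norm_def abs_of_nonneg[OF nn] by (rule bound)
  qed
qed

section \<open>Continuous functions of compact support, test functions, integration by parts\<close>

section \<open>Test functions\<close>

text \<open>The class that contains test functions together with their directional derivatives, so
  that integrability, boundedness and measurability are proved once.\<close>

definition ccont :: "('a::euclidean_space \<Rightarrow> real) \<Rightarrow> bool" where
  "ccont f \<longleftrightarrow> continuous_on UNIV f \<and> (\<exists>K. compact K \<and> (\<forall>x. x \<notin> K \<longrightarrow> f x = 0))"

lemma ccont_cont: "ccont f \<Longrightarrow> continuous_on UNIV f"
  by (simp add: ccont_def)

lemma ccont_borel: "ccont f \<Longrightarrow> f \<in> borel_measurable borel"
  using borel_measurable_continuous_onI by (auto simp: ccont_def)

lemma ccont_integrable:
  assumes "ccont f" shows "integrable lborel f"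
proof -
  obtain K where K: "compact K" "\<And>x. x \<notin> K \<Longrightarrow> f x = 0"
    using assms by (auto simp: ccont_def)
  have "integrable lborel (\<lambda>x. indicator K x *\<^sub>R f x)"
    using assms K(1) by (intro borel_integrable_compact) (auto simp: ccont_def intro: continuous_on_subset)
  moreover have "(\<lambda>x. indicator K x *\<^sub>R f x) = f"
    using K(2) by (auto simp: fun_eq_iff indicator_def)
  ultimately show ?thesis by simp
qed

lemma ccont_bounded:
  assumes "ccont f" shows "\<exists>B\<ge>0. \<forall>x. \<bar>f x\<bar> \<le> B"
proof -
  obtain K where K: "compact K" "\<And>x. x \<notin> K \<Longrightarrow> f x = 0"
    using assms by (auto simp: ccont_def)
  have "compact (f ` K)"
    using assms K(1) by (intro compact_continuous_image) (auto simp: ccont_def intro: continuous_on_subset)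
  then obtain B where B: "\<And>x. x \<in> K \<Longrightarrow> \<bar>f x\<bar> \<le> B"
    using compact_imp_bounded bounded_iff by (metis imageI real_norm_def)
  have "\<bar>f x\<bar> \<le> max B 0" for x
    using B[of x] K(2)[of x] by (cases "x \<in> K") auto
  then show ?thesis by (intro exI[of _ "max B 0"]) auto
qed

lemma ccont_mult: "ccont f \<Longrightarrow> continuous_on UNIV g \<Longrightarrow> ccont (\<lambda>x. f x * g x)"
  unfolding ccont_def by (auto intro!: continuous_intros)

lemma ccont_cmult: "ccont f \<Longrightarrow> ccont (\<lambda>x. c * f x)"
  unfolding ccont_def by (auto intro!: continuous_intros)

lemma ccont_power: "ccont f \<Longrightarrow> 0 < n \<Longrightarrow> ccont (\<lambda>x. f x ^ n)"
  unfolding ccont_def by (auto intro!: continuous_intros)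

lemma ccont_add:
  assumes "ccont f" "ccont g" shows "ccont (\<lambda>x. f x + g x)"
proof -
  obtain K L where "compact K" "\<forall>x. x \<notin> K \<longrightarrow> f x = 0" "compact L" "\<forall>x. x \<notin> L \<longrightarrow> g x = 0"
    using assms by (auto simp: ccont_def)
  then have "\<exists>K. compact K \<and> (\<forall>x. x \<notin> K \<longrightarrow> f x + g x = 0)"
    by (intro exI[of _ "K \<union> L"]) auto
  then show ?thesis
    using assms by (auto simp: ccont_def intro!: continuous_intros)
qed

lemma ccont_zero: "ccont (\<lambda>x. 0)"
  unfolding ccont_def by (auto intro: exI[of _ "{}"])

lemma ccont_sum: "finite S \<Longrightarrow> (\<And>i. i \<in> S \<Longrightarrow> ccont (f i)) \<Longrightarrow> ccont (\<lambda>x. \<Sum>i\<in>S. f i x)"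
  by (induction S rule: finite_induct) (auto intro: ccont_zero ccont_add)

lemma ccont_sqint: "ccont f \<Longrightarrow> sqint lborel f"
  unfolding sqint_def using ccont_borel ccont_integrable[OF ccont_power[of f 2]] by auto

lemma test_fun_differentiable: "test_fun \<Omega> \<phi> \<Longrightarrow> \<phi> differentiable at x"
  unfolding test_fun_def Cinf_on_UNIV_iff_Cn by (metis Cn.simps(2))

lemma test_fun_ccont:
  assumes "test_fun \<Omega> \<phi>" shows "ccont \<phi>"
  unfolding ccont_def
proof
  show "continuous_on UNIV \<phi>"
    using test_fun_differentiable[OF assms] differentiable_imp_continuous_within
    by (auto intro!: continuous_at_imp_continuous_on)
  show "\<exists>K. compact K \<and> (\<forall>x. x \<notin> K \<longrightarrow> \<phi> x = 0)"
    using assms closure_subset[of "{x. \<phi> x \<noteq> 0}"] unfolding test_fun_def by blast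
qed

lemma test_fun_zero: "test_fun \<Omega> \<phi> \<Longrightarrow> x \<notin> \<Omega> \<Longrightarrow> \<phi> x = 0"
  using closure_subset[of "{x. \<phi> x \<noteq> 0}"] unfolding test_fun_def by blast

lemma test_funI_support:
  assumes "\<And>n. Cn n f" "{x. f x \<noteq> 0} \<subseteq> K" "compact K" "K \<subseteq> \<Omega>"
  shows "test_fun \<Omega> f"
proof -
  have "closure {x. f x \<noteq> 0} \<subseteq> K"
    using assms by (intro closure_minimal compact_imp_closed)
  moreover have "bounded {x. f x \<noteq> 0}"
    using assms compact_imp_bounded bounded_subset by blast
  ultimately show ?thesis
    using assms by (auto simp: test_fun_def Cinf_on_UNIV_iff_Cn)
qed

lemma test_fun_dderiv:
  assumes "test_fun \<Omega> \<phi>" "b \<in> Basis" shows "test_fun \<Omega> (dderiv b \<phi>)"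
proof (rule test_funI_support)
  show "Cn n (dderiv b \<phi>)" for n
    using assms unfolding test_fun_def Cinf_on_UNIV_iff_Cn by (metis Cn.simps(2))
  show "{x. dderiv b \<phi> x \<noteq> 0} \<subseteq> closure {x. \<phi> x \<noteq> 0}"
  proof
    fix x assume x: "x \<in> {x. dderiv b \<phi> x \<noteq> 0}"
    show "x \<in> closure {x. \<phi> x \<noteq> 0}"
    proof (rule ccontr)
      assume n: "x \<notin> closure {x. \<phi> x \<noteq> 0}"
      \<comment> \<open>Off the closed support the function vanishes on a whole neighbourhood, so
        differentiation does not enlarge the support.\<close>
      have "(\<phi> has_derivative (\<lambda>h. 0)) (at x)"
        by (rule has_derivative_transform_within_open[of "\<lambda>x. 0" _ _ _ "- closure {x. \<phi> x \<noteq> 0}"])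
           (use n closure_subset[of "{x. \<phi> x \<noteq> 0}"] in auto)
      then show False using x dderiv_eqI by fastforce
    qed
  qed
qed (use assms in \<open>auto simp: test_fun_def\<close>)

lemma test_fun_mult:
  assumes "test_fun \<Omega> f" "test_fun \<Omega> g" shows "test_fun \<Omega> (\<lambda>x. f x * g x)"
proof (rule test_funI_support)
  show "Cn n (\<lambda>x. f x * g x)" for n
    using assms by (auto simp: test_fun_def Cinf_on_UNIV_iff_Cn intro: Cn_mult)
  show "{x. f x * g x \<noteq> 0} \<subseteq> closure {x. f x \<noteq> 0}"
    using closure_subset[of "{x. f x \<noteq> 0}"] by auto
qed (use assms in \<open>auto simp: test_fun_def\<close>)

lemma test_fun_lincomb:
  assumes "test_fun \<Omega> f" "test_fun \<Omega> g" shows "test_fun \<Omega> (\<lambda>x. a * f x + b * g x)"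
proof (rule test_funI_support)
  show "Cn n (\<lambda>x. a * f x + b * g x)" for n
    using assms by (auto simp: test_fun_def Cinf_on_UNIV_iff_Cn intro!: Cn_mult Cn_add Cn_const)
  show "{x. a * f x + b * g x \<noteq> 0} \<subseteq> closure {x. f x \<noteq> 0} \<union> closure {x. g x \<noteq> 0}"
  proof
    fix x assume "x \<in> {x. a * f x + b * g x \<noteq> 0}"
    then have "x \<in> {x. f x \<noteq> 0} \<or> x \<in> {x. g x \<noteq> 0}" by auto
    then show "x \<in> closure {x. f x \<noteq> 0} \<union> closure {x. g x \<noteq> 0}"
      by (meson UnCI closure_subset subsetD)
  qed
qed (use assms in \<open>auto simp: test_fun_def\<close>)

lemma line_deriv:
  assumes "\<And>x. f differentiable at x"
  shows "((\<lambda>t. f (x + t *\<^sub>R v)) has_real_derivative dderiv v f (x + t *\<^sub>R v)) (at t)"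
proof -
  have "(f has_derivative frechet_derivative f (at (x + t *\<^sub>R v))) (at (x + t *\<^sub>R v))"
    using assms frechet_derivative_works by blast
  then have "((\<lambda>t. f (x + t *\<^sub>R v)) has_derivative (\<lambda>h. frechet_derivative f (at (x + t *\<^sub>R v)) (h *\<^sub>R v))) (at t)"
    by (rule has_derivative_compose[rotated]) (auto intro!: derivative_eq_intros)
  moreover have "frechet_derivative f (at (x + t *\<^sub>R v)) (h *\<^sub>R v) = dderiv v f (x + t *\<^sub>R v) * h" for h
    using linear_frechet_derivative[OF assms] by (simp add: dderiv_def linear_cmul)
  ultimately show ?thesis
    by (simp add: has_field_derivative_def)
qed

lemma dderiv_basis_expansion:
  assumes "f differentiable at x"
  shows "dderiv v f x = (\<Sum>b\<in>Basis. (v \<bullet> b) * dderiv b f x)"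
proof -
  have "linear (frechet_derivative f (at x))"
    using linear_frechet_derivative[OF assms] .
  then have "frechet_derivative f (at x) (\<Sum>b\<in>Basis. (v \<bullet> b) *\<^sub>R b)
      = (\<Sum>b\<in>Basis. (v \<bullet> b) * frechet_derivative f (at x) b)"
    by (simp add: linear_sum linear_cmul)
  then show ?thesis by (simp add: dderiv_def euclidean_representation)
qed

lemma ccont_dderiv:
  assumes "test_fun \<Omega> \<phi>" shows "ccont (dderiv v \<phi>)"
proof -
  have eq: "dderiv v \<phi> = (\<lambda>x. \<Sum>b\<in>Basis. (v \<bullet> b) * dderiv b \<phi> x)"
    by (intro ext dderiv_basis_expansion test_fun_differentiable[OF assms])
  show ?thesis
    unfolding eq by (intro ccont_sum ccont_cmult test_fun_ccont[OF test_fun_dderiv[OF assms]] finite_Basis)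
qed

lemma integral_translate:
  fixes f :: "'a::euclidean_space \<Rightarrow> real"
  assumes "f \<in> borel_measurable borel"
  shows "(\<integral>x. f (x + c) \<partial>lborel) = (\<integral>x. f x \<partial>lborel)"
proof -
  have "(\<integral>x. f x \<partial>lborel) = (\<integral>x. f x \<partial>distr lborel borel ((+) c))"
    by (simp add: lborel_distr_plus)
  also have "\<dots> = (\<integral>x. f (c + x) \<partial>lborel)"
    using assms by (intro integral_distr) auto
  finally show ?thesis by (simp add: add.commute)
qed

text \<open>The difference quotients have vanishing integral by translation invariance.\<close>

lemma integral_dderiv_eq_0:
  assumes "test_fun \<Omega> \<phi>"
  shows "(\<integral>x. dderiv v \<phi> x \<partial>lborel) = 0"
proof -
  have c: "ccont \<phi>" "ccont (dderiv v \<phi>)"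
    using test_fun_ccont[OF assms] ccont_dderiv[OF assms] by simp_all
  obtain K where K: "compact K" "\<And>x. x \<notin> K \<Longrightarrow> \<phi> x = 0"
    using c(1) unfolding ccont_def by blast
  obtain B where B: "0 \<le> B" "\<forall>x. \<bar>dderiv v \<phi> x\<bar> \<le> B"
    using ccont_bounded[OF c(2)] by blast
  note ld = line_deriv[OF test_fun_differentiable[OF assms]]
  obtain R where R: "K \<subseteq> cball 0 R"
    using compact_imp_bounded[OF K(1)] unfolding bounded_iff by (auto simp: subset_iff)
  \<comment> \<open>Since 0 < h n <= 1, every difference quotient vanishes outside this ball. Inside
    it the mean value theorem gives the bound \<open>B\<close>, so the dominating function does not
    depend on n.\<close>
  let ?L = "cball (0::'a) (R + norm v)"
  define h where "h n = 1 / real (Suc n)" for n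
  have h: "0 < h n" "h n \<le> 1" "h n \<noteq> 0" for n by (auto simp: h_def)
  have h0: "h \<longlonglongrightarrow> 0" unfolding h_def by (rule LIMSEQ_Suc[OF lim_1_over_n])
  define q where "q n x = (\<phi> (x + h n *\<^sub>R v) - \<phi> x) / h n" for n x
  have qb: "\<bar>q n x\<bar> \<le> indicator ?L x * B" for n x
  proof (cases "x \<in> ?L")
    case True
    obtain z where "\<phi> (x + h n *\<^sub>R v) - \<phi> (x + 0 *\<^sub>R v) = (h n - 0) * dderiv v \<phi> (x + z *\<^sub>R v)"
      using MVT2[OF h(1)[of n], of "\<lambda>t. \<phi> (x + t *\<^sub>R v)" "\<lambda>t. dderiv v \<phi> (x + t *\<^sub>R v)", OF ld] by blast
    then have "q n x = dderiv v \<phi> (x + z *\<^sub>R v)"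
      using h(1)[of n] by (simp add: q_def)
    then show ?thesis using True B(2) by simp
  next
    case False
    have "norm (h n *\<^sub>R v) \<le> norm v" using h[of n] by (simp add: mult_left_le_one_le)
    then have "norm (x + h n *\<^sub>R v) > R" "norm x > R"
      using False norm_triangle_ineq4[of "x + h n *\<^sub>R v" "h n *\<^sub>R v"] norm_ge_zero[of v]
      by (auto simp del: norm_scaleR norm_ge_zero)
    then have "x + h n *\<^sub>R v \<notin> K" "x \<notin> K" using R by auto
    then show ?thesis using False K(2) by (simp add: q_def)
  qed
  have [measurable]: "\<phi> \<in> borel_measurable borel" "dderiv v \<phi> \<in> borel_measurable borel"
    using c[THEN ccont_borel] by simp_all
  have "(\<lambda>n. \<integral>x. q n x \<partial>lborel) \<longlonglongrightarrow> (\<integral>x. dderiv v \<phi> x \<partial>lborel)"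
  proof (rule integral_dominated_convergence)
    show "integrable lborel (\<lambda>x. indicator ?L x * B :: real)"
      using emeasure_bounded_finite[of ?L]
      by (intro integrable_mult_left) (auto intro!: integrable_real_indicator)
    show "AE x in lborel. (\<lambda>n. q n x) \<longlonglongrightarrow> dderiv v \<phi> x"
    proof (rule AE_I2)
      fix x
      have "((\<lambda>t. (\<phi> (x + t *\<^sub>R v) - \<phi> x) / t) \<longlongrightarrow> dderiv v \<phi> x) (at 0)"
        using ld[of x v 0] by (simp add: has_field_derivative_iff)
      then show "(\<lambda>n. q n x) \<longlonglongrightarrow> dderiv v \<phi> x"
        unfolding q_def
        by (rule filterlim_compose)
           (use h h0 in \<open>auto simp: filterlim_at intro!: always_eventually\<close>)
    qed
    show "AE x in lborel. norm (q n x) \<le> indicator ?L x * B" for n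
      using qb by simp
  qed (auto simp: q_def)
  moreover have "(\<integral>x. q n x \<partial>lborel) = 0" for n
  proof -
    have "integrable lborel \<phi>" "integrable lborel (\<lambda>x. \<phi> (x + h n *\<^sub>R v))"
      using ccont_integrable[OF c(1)] lborel_integrable_real_affine
        integrable_distr_eq[of "(+) (h n *\<^sub>R v)" lborel borel \<phi>]
      by (simp_all add: lborel_distr_plus add.commute)
    then show ?thesis
      using integral_translate[of \<phi> "h n *\<^sub>R v"] by (simp add: q_def)
  qed
  ultimately show ?thesis by (simp add: LIMSEQ_const_iff)
qed

lemma integral_by_parts_test:
  assumes "test_fun \<Omega> \<phi>" "test_fun \<Omega> \<psi>"
  shows "(\<integral>x. \<phi> x * dderiv v \<psi> x \<partial>lborel) = - (\<integral>x. dderiv v \<phi> x * \<psi> x \<partial>lborel)"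
proof -
  note d = assms[THEN test_fun_differentiable]
  note c = assms[THEN test_fun_ccont] assms[THEN ccont_dderiv, of v]
  have "(\<integral>x. \<phi> x * dderiv v \<psi> x + dderiv v \<phi> x * \<psi> x \<partial>lborel) = 0"
    using integral_dderiv_eq_0[OF test_fun_mult[OF assms], of v] by (simp add: dderiv_mult[OF d])
  moreover have "integrable lborel (\<lambda>x. \<phi> x * dderiv v \<psi> x)" "integrable lborel (\<lambda>x. dderiv v \<phi> x * \<psi> x)"
    by (intro ccont_integrable ccont_mult c ccont_cont)+
  ultimately show ?thesis by simp
qed

section \<open>Weak gradients on a bounded open set and their uniqueness\<close>

section \<open>Weak gradients\<close>

locale bounded_open =
  fixes \<Omega> :: "'a::euclidean_space set"
  assumes open_dom: "open \<Omega>" and bounded_dom: "bounded \<Omega>"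
begin

abbreviation M where "M \<equiv> lebesgue_on \<Omega>"

lemma dom_lmeasurable: "\<Omega> \<in> lmeasurable"
  using open_dom bounded_dom by (rule lmeasurable_open[rotated])

lemma dom_sets: "\<Omega> \<in> sets lebesgue" "\<Omega> \<inter> space lebesgue \<in> sets lebesgue"
  using dom_lmeasurable by auto

lemma finite_measure_dom: "finite_measure M"
  by (rule finite_measure_lebesgue_on[OF dom_lmeasurable])

lemma borel_measurable_dom: "f \<in> borel_measurable borel \<Longrightarrow> f \<in> borel_measurable M"
  by (intro measurable_restrict_space1 measurable_completion) simp

text \<open>Bridge between the completed measure on the domain, in which the definitions are
  written, and Borel measure on the whole space, where translation invariance and Tonelli are at
  hand.\<close>

lemma integral_dom_eq_lborel:
  fixes f :: "'a \<Rightarrow> real"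
  assumes "f \<in> borel_measurable borel" "\<And>x. x \<notin> \<Omega> \<Longrightarrow> f x = 0"
  shows "(\<integral>x. f x \<partial>M) = (\<integral>x. f x \<partial>lborel)"
proof -
  have "(\<integral>x. f x \<partial>M) = (\<integral>x. indicator \<Omega> x *\<^sub>R f x \<partial>lebesgue)"
    by (rule integral_restrict_space[OF dom_sets(2)])
  also have "(\<lambda>x. indicator \<Omega> x *\<^sub>R f x) = f"
    using assms(2) by (auto simp: fun_eq_iff indicator_def)
  finally show ?thesis using assms(1) by (simp add: integral_completion)
qed

lemma integrable_dom:
  fixes f :: "'a \<Rightarrow> real"
  assumes "integrable lborel f"
  shows "integrable M f"
proof -
  have "integrable lebesgue f"
    using assms integrable_completion[OF borel_measurable_integrable[OF assms]] by simp
  then show ?thesis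
    unfolding integrable_restrict_space[OF dom_sets(2)]
    by (rule integrable_mult_indicator[OF dom_sets(1)])
qed

lemma ccont_sqint_dom: "ccont f \<Longrightarrow> sqint M f"
  unfolding sqint_def using borel_measurable_dom[OF ccont_borel]
    integrable_dom[OF ccont_integrable[OF ccont_power[of f 2]]] by simp

lemma sqint_one: "sqint M (\<lambda>x. c)"
proof -
  interpret finite_measure M by (rule finite_measure_dom)
  show ?thesis by (auto simp: sqint_def)
qed

lemma sqint_integrable: "sqint M f \<Longrightarrow> integrable M f"
  using sqint_mult_integrable[OF _ sqint_one[of 1]] by simp

text \<open>The functions exhausting \<open>U \<inter> \<Omega>\<close> are test functions on
  \<open>\<Omega>\<close>, and dominated convergence replaces them by the indicator.\<close>

lemma integral_open_eq_0:
  assumes f: "integrable M f" and test: "\<And>\<phi>. test_fun \<Omega> \<phi> \<Longrightarrow> (\<integral>x. f x * \<phi> x \<partial>M) = 0"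
    and U: "open U"
  shows "(\<integral>x. f x * indicator U x \<partial>M) = 0"
proof -
  have [measurable]: "f \<in> borel_measurable M" using f by simp
  have oU: "open (U \<inter> \<Omega>)" using U open_dom by auto
  obtain F where F: "\<And>n. test_fun (U \<inter> \<Omega>) (F n)" "\<And>n x. 0 \<le> F n x" "\<And>n x. F n x \<le> 1"
    "\<And>n x. x \<notin> U \<inter> \<Omega> \<Longrightarrow> F n x = 0" "\<And>x. x \<in> U \<inter> \<Omega> \<Longrightarrow> (\<lambda>n. F n x) \<longlonglongrightarrow> 1"
    using test_fun_exhaustion[OF oU] by metis
  have "test_fun \<Omega> (F n)" for n using F(1)[of n] by (auto simp: test_fun_def)
  then have "(\<integral>x. f x * F n x \<partial>M) = 0" for n by (rule test)
  moreover have "(\<lambda>n. \<integral>x. f x * F n x \<partial>M) \<longlonglongrightarrow> (\<integral>x. f x * indicator U x \<partial>M)"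
  proof (rule integral_dominated_convergence)
    show "integrable M (\<lambda>x. norm (f x))" using f by simp
    have "F n \<in> borel_measurable M" for n
      using F(1) test_fun_ccont ccont_borel borel_measurable_dom by blast
    then show "(\<lambda>x. f x * F n x) \<in> borel_measurable M" for n by simp
    have "U \<in> sets lebesgue" using U by (simp add: borel_open)
    then have "indicat_real U \<in> borel_measurable M"
      by (intro measurable_restrict_space1 borel_measurable_indicator)
    then show "(\<lambda>x. f x * indicator U x) \<in> borel_measurable M" by simp
    show "AE x in M. norm (f x * F n x) \<le> norm (f x)" for n
      using F(2,3) by (intro AE_I2) (simp add: abs_mult mult_left_le)
    show "AE x in M. (\<lambda>n. f x * F n x) \<longlonglongrightarrow> f x * indicator U x"
    proof (rule AE_I2)
      fix x assume "x \<in> space M"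
      then have "(\<lambda>n. F n x) \<longlonglongrightarrow> indicator U x"
        using F(4,5)[of x] by (cases "x \<in> U") auto
      then show "(\<lambda>n. f x * F n x) \<longlonglongrightarrow> f x * indicator U x"
        by (intro tendsto_intros)
    qed
  qed
  ultimately show ?thesis by (simp add: LIMSEQ_const_iff)
qed

lemma indicator_measurable_dom: "A \<in> sets borel \<Longrightarrow> indicat_real A \<in> borel_measurable M"
  by (intro borel_measurable_dom borel_measurable_indicator)

text \<open>Dynkin's argument: open sets are stable under intersection and generate the Borel sets,
  and the property survives complements and disjoint unions. The complement step needs the integral
  over the whole space, which is again the open case.\<close>

lemma integral_borel_set_eq_0:
  assumes f: "integrable M f" and test: "\<And>\<phi>. test_fun \<Omega> \<phi> \<Longrightarrow> (\<integral>x. f x * \<phi> x \<partial>M) = 0"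
    and A: "A \<in> sets borel"
  shows "(\<integral>x. f x * indicator A x \<partial>M) = 0"
proof -
  have fi: "integrable M (\<lambda>x. f x * indicator A x)" if "A \<in> sets borel" for A
  proof (rule Bochner_Integration.integrable_bound[OF f])
    show "(\<lambda>x. f x * indicator A x) \<in> borel_measurable M"
      using f indicator_measurable_dom[OF that] by (intro borel_measurable_times) auto
  qed (auto simp: indicator_def)
  have mem: "A \<in> sigma_sets UNIV {S. open S}" using A by (simp add: borel_def)
  have st: "Int_stable {S :: 'a set. open S}" by (auto simp: Int_stable_def)
  have sub: "{S :: 'a set. open S} \<subseteq> Pow UNIV" by simp
  from st sub mem show ?thesis
  proof (induction rule: sigma_sets_induct_disjoint)
    case (basic A)
    then show ?case using integral_open_eq_0[OF f test] by simp
  next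
    case (compl A)
    then have A: "A \<in> sets borel" by (simp add: borel_def)
    have "f x * indicator (UNIV - A) x = f x * indicator UNIV x - f x * indicator A x" for x
      by (auto simp: indicator_def)
    then have "(\<integral>x. f x * indicator (UNIV - A) x \<partial>M)
        = (\<integral>x. f x * indicator UNIV x \<partial>M) - (\<integral>x. f x * indicator A x \<partial>M)"
      using fi[OF A] fi[of UNIV] by (simp only: Bochner_Integration.integral_diff space_borel[symmetric] sets.top)
    then show ?case using compl integral_open_eq_0[OF f test open_UNIV] by simp
  next
    case (union A)
    then have A: "A i \<in> sets borel" for i by (auto simp: borel_def)
    have s: "(\<lambda>i. f x * indicator (A i) x) sums (f x * indicator (\<Union>i. A i) x)" for x
      using sums_mult[OF indicator_sums, of A "f x"] union(1)
      by (auto simp: disjoint_family_on_def)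
    have "(\<lambda>i. \<integral>x. (\<Sum>j<i. f x * indicator (A j) x) \<partial>M) \<longlonglongrightarrow> (\<integral>x. f x * indicator (\<Union>i. A i) x \<partial>M)"
    proof (rule integral_dominated_convergence)
      show "integrable M (\<lambda>x. norm (f x))" using f by simp
      show "(\<lambda>x. f x * indicator (\<Union>i. A i) x) \<in> borel_measurable M"
        using fi[of "\<Union>i. A i"] A by auto
      show "(\<lambda>x. \<Sum>j<i. f x * indicator (A j) x) \<in> borel_measurable M" for i
        using fi[OF A] by (intro borel_measurable_sum) simp
      show "AE x in M. (\<lambda>i. \<Sum>j<i. f x * indicator (A j) x) \<longlonglongrightarrow> f x * indicator (\<Union>i. A i) x"
        using s unfolding sums_def by simp
      show "AE x in M. norm (\<Sum>j<i. f x * indicator (A j) x) \<le> norm (f x)" for i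
      proof (rule AE_I2)
        fix x
        have "disjoint_family_on A {..<i}" using union(1) by (auto simp: disjoint_family_on_def)
        then have "(\<Sum>j<i. f x * indicator (A j) x) = f x * indicator (\<Union>j<i. A j) x"
          by (simp add: sum_distrib_left[symmetric] indicator_UN_disjoint)
        then show "norm (\<Sum>j<i. f x * indicator (A j) x) \<le> norm (f x)"
          by (auto simp: indicator_def)
      qed
    qed
    moreover have "(\<integral>x. (\<Sum>j<i. f x * indicator (A j) x) \<partial>M) = 0" for i
      by (subst Bochner_Integration.integral_sum[OF fi[OF A]]) (simp only: union(3) sum.neutral_const)
    ultimately show ?case by (simp add: LIMSEQ_const_iff)
  qed simp
qed

text \<open>\<open>f\<close> is only Lebesgue measurable, whereas uniqueness of densities is used
  for \<open>lborel\<close>. Hence \<open>f\<close> is extended by zero and replaced by a Borel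
  version \<open>g\<close>, whose integrals over all Borel sets vanish.\<close>

lemma du_Bois_Reymond:
  assumes f: "integrable M f" and test: "\<And>\<phi>. test_fun \<Omega> \<phi> \<Longrightarrow> (\<integral>x. f x * \<phi> x \<partial>M) = 0"
  shows "AE x in M. f x = 0"
proof -
  have i: "integrable lebesgue (\<lambda>x. indicator \<Omega> x *\<^sub>R f x)"
    using f unfolding integrable_restrict_space[OF dom_sets(2)] .
  then obtain g where g[measurable]: "g \<in> borel_measurable lborel" and ae: "AE x in lborel. indicator \<Omega> x *\<^sub>R f x = g x"
    using completion_ex_borel_measurable_real[of "\<lambda>x. indicator \<Omega> x *\<^sub>R f x" lborel] by auto
  have ae': "AE x in lebesgue. indicator \<Omega> x *\<^sub>R f x = g x"
    using ae by (rule AE_completion)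
  have gm: "g \<in> borel_measurable lebesgue" using measurable_completion[OF g] .
  have "integrable lebesgue g"
    using integrable_cong_AE_imp[OF i gm] ae' by (auto elim: eventually_mono)
  then have gi: "integrable lborel g" using integrable_completion[of g lborel] g by simp
  have "AE x in lborel. g x = (\<lambda>x. 0) x"
  proof (rule density_unique_real[OF gi])
    fix A :: "'a set" assume "A \<in> sets lborel"
    then have A: "A \<in> sets borel" by simp
    have "(\<integral>x. indicator A x * g x \<partial>lborel) = (\<integral>x. indicator A x * g x \<partial>lebesgue)"
      using A by (subst integral_completion) auto
    also have "\<dots> = (\<integral>x. indicator \<Omega> x *\<^sub>R (f x * indicator A x) \<partial>lebesgue)"
    proof (rule integral_cong_AE)
      show "(\<lambda>x. indicator A x * g x) \<in> borel_measurable lebesgue"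
        using A gm by (intro borel_measurable_times borel_measurable_indicator) auto
      have "(\<lambda>x. (indicator \<Omega> x *\<^sub>R f x) * indicator A x) \<in> borel_measurable lebesgue"
        using A i by (intro borel_measurable_times borel_measurable_indicator) auto
      then show "(\<lambda>x. indicator \<Omega> x *\<^sub>R (f x * indicator A x)) \<in> borel_measurable lebesgue"
        by (simp add: mult.assoc)
      show "AE x in lebesgue. indicator A x * g x = indicator \<Omega> x *\<^sub>R (f x * indicator A x)"
        using ae' by eventually_elim auto
    qed
    also have "\<dots> = (\<integral>x. f x * indicator A x \<partial>M)"
      by (rule integral_restrict_space[OF dom_sets(2), symmetric])
    also have "\<dots> = 0" by (rule integral_borel_set_eq_0[OF f test A])
    finally show "(LINT x:A|lborel. g x) = (LINT x:A|lborel. 0)"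
      by (simp add: set_lebesgue_integral_def)
  qed simp
  then have "AE x in lebesgue. g x = 0" by (intro AE_completion) simp
  with ae' have "AE x in lebesgue. x \<in> \<Omega> \<longrightarrow> f x = 0" by eventually_elim auto
  then show ?thesis by (subst AE_restrict_space_iff[OF dom_sets(2)])
qed

lemma L2_iff_sqint: "L2 \<Omega> f \<longleftrightarrow> sqint M f"
  by (simp add: L2_def sqint_def)

lemma weak_grad_sqint: "weak_grad \<Omega> u g \<Longrightarrow> i \<in> Basis \<Longrightarrow> sqint M (\<lambda>x. g x \<bullet> i)"
  by (simp add: weak_grad_def L2_iff_sqint)

lemma test_sqint: "test_fun \<Omega> \<phi> \<Longrightarrow> sqint M \<phi>"
  and test_dderiv_sqint: "test_fun \<Omega> \<phi> \<Longrightarrow> sqint M (dderiv v \<phi>)"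
  using ccont_sqint_dom test_fun_ccont ccont_dderiv by blast+

text \<open>Makes the choice inside \<open>grad\<close> harmless: the selected gradient agrees
  almost everywhere with any gradient that can be exhibited.\<close>

lemma weak_grad_unique:
  assumes "weak_grad \<Omega> u g" "weak_grad \<Omega> u h"
  shows "AE x in M. g x = h x"
proof -
  have "AE x in M. g x \<bullet> i - h x \<bullet> i = 0" if i: "i \<in> Basis" for i
  proof (rule du_Bois_Reymond)
    note s = weak_grad_sqint[OF assms(1) i] weak_grad_sqint[OF assms(2) i]
    show "integrable M (\<lambda>x. g x \<bullet> i - h x \<bullet> i)" by (rule sqint_integrable[OF sqint_diff[OF s]])
    fix \<phi> assume p: "test_fun \<Omega> \<phi>"
    have "(\<integral>x. (g x \<bullet> i) * \<phi> x \<partial>M) = (\<integral>x. (h x \<bullet> i) * \<phi> x \<partial>M)"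
      using assms i p unfolding weak_grad_def by fastforce
    then show "(\<integral>x. (g x \<bullet> i - h x \<bullet> i) * \<phi> x \<partial>M) = 0"
      using sqint_mult_integrable[OF s(1) test_sqint[OF p]] sqint_mult_integrable[OF s(2) test_sqint[OF p]]
      by (simp add: left_diff_distrib)
  qed
  then have "AE x in M. \<forall>i\<in>Basis. g x \<bullet> i - h x \<bullet> i = 0"
    by (intro AE_finite_allI finite_Basis) auto
  then show ?thesis
    by eventually_elim (auto intro: euclidean_eqI)
qed

lemma weak_grad_lincomb:
  assumes "sqint M u" "sqint M v" "weak_grad \<Omega> u g" "weak_grad \<Omega> v h"
  shows "weak_grad \<Omega> (\<lambda>x. a * u x + b * v x) (\<lambda>x. a *\<^sub>R g x + b *\<^sub>R h x)"
  unfolding weak_grad_def L2_iff_sqint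
proof (intro ballI conjI allI impI)
  fix i :: 'a assume i: "i \<in> Basis"
  note s = weak_grad_sqint[OF assms(3) i] weak_grad_sqint[OF assms(4) i]
  show "sqint M (\<lambda>x. (a *\<^sub>R g x + b *\<^sub>R h x) \<bullet> i)"
    using sqint_lincomb[OF s] by (simp add: inner_add_left)
  fix \<phi> assume p: "test_fun \<Omega> \<phi>"
  note i1 = sqint_mult_integrable[OF assms(1) test_dderiv_sqint[OF p, of i]]
    sqint_mult_integrable[OF assms(2) test_dderiv_sqint[OF p, of i]]
    sqint_mult_integrable[OF s(1) test_sqint[OF p]] sqint_mult_integrable[OF s(2) test_sqint[OF p]]
  have e: "(\<integral>x. u x * dderiv i \<phi> x \<partial>M) = - (\<integral>x. (g x \<bullet> i) * \<phi> x \<partial>M)"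
    "(\<integral>x. v x * dderiv i \<phi> x \<partial>M) = - (\<integral>x. (h x \<bullet> i) * \<phi> x \<partial>M)"
    using assms(3,4) i p unfolding weak_grad_def by auto
  have "(\<integral>x. (a * u x + b * v x) * dderiv i \<phi> x \<partial>M)
      = (\<integral>x. a * (u x * dderiv i \<phi> x) + b * (v x * dderiv i \<phi> x) \<partial>M)"
    by (simp add: algebra_simps)
  also have "\<dots> = a * (\<integral>x. u x * dderiv i \<phi> x \<partial>M) + b * (\<integral>x. v x * dderiv i \<phi> x \<partial>M)"
    using i1 by simp
  also have "\<dots> = - (a * (\<integral>x. (g x \<bullet> i) * \<phi> x \<partial>M) + b * (\<integral>x. (h x \<bullet> i) * \<phi> x \<partial>M))"
    unfolding e by simp
  also have "a * (\<integral>x. (g x \<bullet> i) * \<phi> x \<partial>M) + b * (\<integral>x. (h x \<bullet> i) * \<phi> x \<partial>M)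
      = (\<integral>x. a * ((g x \<bullet> i) * \<phi> x) + b * ((h x \<bullet> i) * \<phi> x) \<partial>M)"
    using i1 by simp
  also have "\<dots> = (\<integral>x. ((a *\<^sub>R g x + b *\<^sub>R h x) \<bullet> i) * \<phi> x \<partial>M)"
    by (simp add: inner_add_left algebra_simps)
  finally show "(\<integral>x. (a * u x + b * v x) * dderiv i \<phi> x \<partial>M)
      = - (\<integral>x. ((a *\<^sub>R g x + b *\<^sub>R h x) \<bullet> i) * \<phi> x \<partial>M)" .
qed

lemma weak_grad_cong_AE:
  assumes "sqint M u" "sqint M v" "AE x in M. u x = v x"
  shows "weak_grad \<Omega> u g \<longleftrightarrow> weak_grad \<Omega> v g"
proof -
  have "(\<integral>x. u x * dderiv i \<phi> x \<partial>M) = (\<integral>x. v x * dderiv i \<phi> x \<partial>M)" if "test_fun \<Omega> \<phi>" for i \<phi>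
    using test_dderiv_sqint[OF that, of i] assms
    by (intro integral_cong_AE) (auto simp: sqint_def elim: eventually_mono)
  then show ?thesis unfolding weak_grad_def by simp
qed

text \<open>The two functions have the same set of weak gradients, so the choice operator returns
  literally the same one; the equality holds everywhere.\<close>

lemma grad_cong_AE:
  assumes "sqint M u" "sqint M v" "AE x in M. u x = v x"
  shows "grad \<Omega> u = grad \<Omega> v"
proof -
  have "weak_grad \<Omega> u = weak_grad \<Omega> v" by (intro ext weak_grad_cong_AE[OF assms])
  then show ?thesis by (simp add: grad_def)
qed

text \<open>Both integrands vanish off the domain, so the integrals may be taken over the whole
  space, where integration by parts has no boundary term.\<close>

lemma weak_grad_test:
  assumes "test_fun \<Omega> \<phi>"
  shows "weak_grad \<Omega> \<phi> (\<lambda>x. \<Sum>b\<in>Basis. dderiv b \<phi> x *\<^sub>R b)"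
  unfolding weak_grad_def L2_iff_sqint
proof (intro ballI conjI allI impI)
  fix i :: 'a assume i: "i \<in> Basis"
  show "sqint M (\<lambda>x. (\<Sum>b\<in>Basis. dderiv b \<phi> x *\<^sub>R b) \<bullet> i)"
    using i test_dderiv_sqint[OF assms] by simp
  fix \<psi> assume p: "test_fun \<Omega> \<psi>"
  note c = test_fun_ccont[OF assms] test_fun_ccont[OF p] ccont_dderiv[OF assms, of i] ccont_dderiv[OF p, of i]
  have "(\<integral>x. \<phi> x * dderiv i \<psi> x \<partial>M) = (\<integral>x. \<phi> x * dderiv i \<psi> x \<partial>lborel)"
    using ccont_borel[OF ccont_mult[OF c(1) ccont_cont[OF c(4)]]] test_fun_zero[OF assms]
    by (intro integral_dom_eq_lborel) auto
  also have "\<dots> = - (\<integral>x. dderiv i \<phi> x * \<psi> x \<partial>lborel)"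
    by (rule integral_by_parts_test[OF assms p])
  also have "(\<integral>x. dderiv i \<phi> x * \<psi> x \<partial>lborel) = (\<integral>x. dderiv i \<phi> x * \<psi> x \<partial>M)"
    using ccont_borel[OF ccont_mult[OF c(3) ccont_cont[OF c(2)]]] test_fun_zero[OF p]
    by (intro integral_dom_eq_lborel[symmetric]) auto
  finally show "(\<integral>x. \<phi> x * dderiv i \<psi> x \<partial>M) = - (\<integral>x. ((\<Sum>b\<in>Basis. dderiv b \<phi> x *\<^sub>R b) \<bullet> i) * \<psi> x \<partial>M)"
    using i by simp
qed

text \<open>The weak gradient is a closed operator: its defining identity consists of pairings with
  fixed L2 functions, and these are continuous in L2.\<close>

lemma weak_grad_limit:
  assumes u: "\<And>n. sqint M (u n)" "sqint M u0" "(\<lambda>n. \<integral>x. (u n x - u0 x)\<^sup>2 \<partial>M) \<longlonglongrightarrow> 0"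
    and g: "\<And>n. weak_grad \<Omega> (u n) (g n)" "\<And>i. i \<in> Basis \<Longrightarrow> sqint M (\<lambda>x. h x \<bullet> i)"
    "\<And>i. i \<in> Basis \<Longrightarrow> (\<lambda>n. \<integral>x. (g n x \<bullet> i - h x \<bullet> i)\<^sup>2 \<partial>M) \<longlonglongrightarrow> 0"
  shows "weak_grad \<Omega> u0 h"
  unfolding weak_grad_def L2_iff_sqint
proof (intro ballI conjI allI impI g(2))
  fix i :: 'a and \<phi> assume i: "i \<in> Basis" and p: "test_fun \<Omega> \<phi>"
  have lu: "(\<lambda>n. \<integral>x. u n x * dderiv i \<phi> x \<partial>M) \<longlonglongrightarrow> (\<integral>x. u0 x * dderiv i \<phi> x \<partial>M)"
    by (rule integral_mult_tendsto[OF u test_dderiv_sqint[OF p] test_dderiv_sqint[OF p]]) simp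
  have lg: "(\<lambda>n. - (\<integral>x. (g n x \<bullet> i) * \<phi> x \<partial>M)) \<longlonglongrightarrow> - (\<integral>x. (h x \<bullet> i) * \<phi> x \<partial>M)"
    by (rule tendsto_minus, rule integral_mult_tendsto[OF weak_grad_sqint[OF g(1) i] g(2)[OF i] g(3)[OF i]
        test_sqint[OF p] test_sqint[OF p]]) simp
  have "(\<integral>x. u n x * dderiv i \<phi> x \<partial>M) = - (\<integral>x. (g n x \<bullet> i) * \<phi> x \<partial>M)" for n
    using g(1)[of n] i p unfolding weak_grad_def by auto
  then show "(\<integral>x. u0 x * dderiv i \<phi> x \<partial>M) = - (\<integral>x. (h x \<bullet> i) * \<phi> x \<partial>M)"
    using lg by (intro LIMSEQ_unique[OF lu]) simp
qed

lemma H1_sqint: "H1 \<Omega> u \<Longrightarrow> sqint M u"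
  by (simp add: H1_def L2_iff_sqint)

lemma H1_weak_grad: "H1 \<Omega> u \<Longrightarrow> weak_grad \<Omega> u (grad \<Omega> u)"
  unfolding H1_def grad_def by (metis someI)

lemma H1I: "sqint M u \<Longrightarrow> weak_grad \<Omega> u g \<Longrightarrow> H1 \<Omega> u"
  unfolding H1_def L2_iff_sqint by blast

lemma grad_sqint: "H1 \<Omega> u \<Longrightarrow> i \<in> Basis \<Longrightarrow> sqint M (\<lambda>x. grad \<Omega> u x \<bullet> i)"
  using weak_grad_sqint H1_weak_grad by blast

lemma grad_AE_eq: "H1 \<Omega> u \<Longrightarrow> weak_grad \<Omega> u g \<Longrightarrow> AE x in M. grad \<Omega> u x = g x"
  using weak_grad_unique H1_weak_grad by blast

lemma H1_lincomb:
  assumes "H1 \<Omega> u" "H1 \<Omega> v"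
  shows "H1 \<Omega> (\<lambda>x. a * u x + b * v x)"
    and "AE x in M. grad \<Omega> (\<lambda>x. a * u x + b * v x) x = a *\<^sub>R grad \<Omega> u x + b *\<^sub>R grad \<Omega> v x"
proof -
  note w = weak_grad_lincomb[OF assms[THEN H1_sqint] assms[THEN H1_weak_grad], of a b]
  show h: "H1 \<Omega> (\<lambda>x. a * u x + b * v x)"
    by (rule H1I[OF sqint_lincomb[OF assms[THEN H1_sqint]] w])
  show "AE x in M. grad \<Omega> (\<lambda>x. a * u x + b * v x) x = a *\<^sub>R grad \<Omega> u x + b *\<^sub>R grad \<Omega> v x"
    by (rule grad_AE_eq[OF h w])
qed

lemma H1_test: "test_fun \<Omega> \<phi> \<Longrightarrow> H1 \<Omega> \<phi>"
  using H1I test_sqint weak_grad_test by blast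

lemma grad_inner_integrable:
  assumes "H1 \<Omega> u" "H1 \<Omega> v"
  shows "integrable M (\<lambda>x. grad \<Omega> u x \<bullet> grad \<Omega> v x)"
proof (subst euclidean_inner, rule Bochner_Integration.integrable_sum)
  fix i :: 'a assume "i \<in> Basis"
  then show "integrable M (\<lambda>x. grad \<Omega> u x \<bullet> i * (grad \<Omega> v x \<bullet> i))"
    using assms by (intro sqint_mult_integrable grad_sqint)
qed

section \<open>Symmetric Dirichlet forms with a nonnegative weight\<close>

section \<open>Weighted Dirichlet forms\<close>

text \<open>One form for three purposes: weight 1 gives the H1 inner product, weight
  \<open>V\<close> the quadratic part of the energy, and weight V + beta z^2 the form a_z.\<close>

definition frm :: "('a \<Rightarrow> real) \<Rightarrow> ('a \<Rightarrow> real) \<Rightarrow> ('a \<Rightarrow> real) \<Rightarrow> real" where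
  "frm W v w = (\<integral>x. grad \<Omega> v x \<bullet> grad \<Omega> w x + W x * (v x * w x) \<partial>M)"

definition weight :: "('a \<Rightarrow> real) \<Rightarrow> bool" where
  "weight W \<longleftrightarrow> W \<in> borel_measurable M \<and> (AE x in M. 0 \<le> W x)"

text \<open>Isabelle's \<open>sqrt\<close> is an odd function, so negative values of \<open>W\<close>, which occur on a null set only,
  do no harm.\<close>

definition adm :: "('a \<Rightarrow> real) \<Rightarrow> ('a \<Rightarrow> real) \<Rightarrow> bool" where
  "adm W v \<longleftrightarrow> H1 \<Omega> v \<and> sqint M (\<lambda>x. sqrt (W x) * v x)"

lemma adm_H1: "adm W v \<Longrightarrow> H1 \<Omega> v"
  by (simp add: adm_def)

lemma weight_one: "weight (\<lambda>x. 1)"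
  by (simp add: weight_def)

lemma adm_one: "adm (\<lambda>x. 1) v \<longleftrightarrow> H1 \<Omega> v"
  by (auto simp: adm_def dest: H1_sqint)

lemma sqrt_weight_mult:
  assumes "weight W"
  shows "AE x in M. W x * (v x * w x) = (sqrt (W x) * v x) * (sqrt (W x) * w x)"
proof -
  have "AE x in M. 0 \<le> W x" using assms by (simp add: weight_def)
  then show ?thesis
  proof eventually_elim
    case (elim x)
    have "(sqrt (W x) * v x) * (sqrt (W x) * w x) = (sqrt (W x) * sqrt (W x)) * (v x * w x)"
      by (simp only: ac_simps)
    moreover have "sqrt (W x) * sqrt (W x) = W x" using elim by simp
    ultimately show ?case by (simp only:)
  qed
qed

lemma weight_mult_measurable:
  "weight W \<Longrightarrow> adm W v \<Longrightarrow> adm W w \<Longrightarrow> (\<lambda>x. W x * (v x * w x)) \<in> borel_measurable M"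
  using sqint_meas[OF H1_sqint[OF adm_H1]] by (auto simp: weight_def intro!: borel_measurable_times)

lemma weight_mult_integrable:
  assumes "weight W" "adm W v" "adm W w"
  shows "integrable M (\<lambda>x. W x * (v x * w x))"
proof -
  have "integrable M (\<lambda>x. (sqrt (W x) * v x) * (sqrt (W x) * w x))"
    using assms by (intro sqint_mult_integrable) (auto simp: adm_def)
  moreover have "AE x in M. (sqrt (W x) * v x) * (sqrt (W x) * w x) = W x * (v x * w x)"
    using sqrt_weight_mult[OF assms(1), of v w] by eventually_elim (rule sym)
  ultimately show ?thesis
    by (rule integrable_cong_AE_imp[OF _ weight_mult_measurable[OF assms]])
qed

lemma admI:
  assumes "weight W" "H1 \<Omega> v" "integrable M (\<lambda>x. W x * (v x * v x))"
  shows "adm W v"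
proof -
  have m: "W \<in> borel_measurable M" "v \<in> borel_measurable M"
    using assms(1,2) H1_sqint sqint_meas by (auto simp: weight_def)
  then have m2: "(\<lambda>x. sqrt (W x) * v x) \<in> borel_measurable M" by simp
  have "AE x in M. W x * (v x * v x) = (sqrt (W x) * v x)\<^sup>2"
    using sqrt_weight_mult[OF assms(1), of v v] by (simp add: power2_eq_square)
  then have "integrable M (\<lambda>x. (sqrt (W x) * v x)\<^sup>2)"
    using m2 by (intro integrable_cong_AE_imp[OF assms(3)]) auto
  then show ?thesis using assms(2) m2 by (simp add: adm_def sqint_def)
qed

lemma adm_lincomb:
  assumes "adm W u" "adm W v" shows "adm W (\<lambda>x. a * u x + b * v x)"
proof -
  have "sqint M (\<lambda>x. a * (sqrt (W x) * u x) + b * (sqrt (W x) * v x))"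
    using assms by (intro sqint_lincomb) (auto simp: adm_def)
  also have "(\<lambda>x. a * (sqrt (W x) * u x) + b * (sqrt (W x) * v x)) = (\<lambda>x. sqrt (W x) * (a * u x + b * v x))"
    by (simp add: algebra_simps)
  finally show ?thesis using H1_lincomb(1)[OF assms[THEN adm_H1]] by (simp add: adm_def)
qed

lemma frm_integrable:
  assumes "weight W" "adm W v" "adm W w"
  shows "integrable M (\<lambda>x. grad \<Omega> v x \<bullet> grad \<Omega> w x + W x * (v x * w x))"
  using assms by (intro Bochner_Integration.integrable_add grad_inner_integrable weight_mult_integrable adm_H1)

lemma frm_eq:
  assumes "weight W" "adm W v" "adm W w"
  shows "frm W v w = (\<integral>x. grad \<Omega> v x \<bullet> grad \<Omega> w x \<partial>M) + (\<integral>x. W x * (v x * w x) \<partial>M)"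
  unfolding frm_def
  by (intro Bochner_Integration.integral_add grad_inner_integrable weight_mult_integrable adm_H1 assms)
     (use assms adm_H1 in auto)

lemma frm_sym: "frm W v w = frm W w v"
  unfolding frm_def by (simp add: inner_commute mult.commute)

lemma frm_lincomb_left:
  assumes W: "weight W" and u: "adm W u" and v: "adm W v" and w: "adm W w"
  shows "frm W (\<lambda>x. a * u x + b * v x) w = a * frm W u w + b * frm W v w"
proof -
  note l = adm_lincomb[OF u v, of a b]
  have "frm W (\<lambda>x. a * u x + b * v x) w
      = (\<integral>x. a * (grad \<Omega> u x \<bullet> grad \<Omega> w x + W x * (u x * w x)) + b * (grad \<Omega> v x \<bullet> grad \<Omega> w x + W x * (v x * w x)) \<partial>M)"
    unfolding frm_def
  proof (rule integral_cong_AE)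
    show "(\<lambda>x. grad \<Omega> (\<lambda>x. a * u x + b * v x) x \<bullet> grad \<Omega> w x + W x * ((a * u x + b * v x) * w x)) \<in> borel_measurable M"
      using frm_integrable[OF W l w] by (rule borel_measurable_integrable)
    show "(\<lambda>x. a * (grad \<Omega> u x \<bullet> grad \<Omega> w x + W x * (u x * w x))
        + b * (grad \<Omega> v x \<bullet> grad \<Omega> w x + W x * (v x * w x))) \<in> borel_measurable M"
      by (intro borel_measurable_add borel_measurable_times borel_measurable_const
          borel_measurable_integrable[OF frm_integrable[OF W u w]]
          borel_measurable_integrable[OF frm_integrable[OF W v w]])
    show "AE x in M. grad \<Omega> (\<lambda>x. a * u x + b * v x) x \<bullet> grad \<Omega> w x + W x * ((a * u x + b * v x) * w x)
        = a * (grad \<Omega> u x \<bullet> grad \<Omega> w x + W x * (u x * w x)) + b * (grad \<Omega> v x \<bullet> grad \<Omega> w x + W x * (v x * w x))"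
      using H1_lincomb(2)[OF u[THEN adm_H1] v[THEN adm_H1], of a b]
      by eventually_elim (simp add: inner_add_left algebra_simps)
  qed
  also have "\<dots> = a * frm W u w + b * frm W v w"
    unfolding frm_def using frm_integrable[OF W u w] frm_integrable[OF W v w] by simp
  finally show ?thesis .
qed

lemma frm_lincomb_right:
  assumes "weight W" "adm W u" "adm W v" "adm W w"
  shows "frm W w (\<lambda>x. a * u x + b * v x) = a * frm W w u + b * frm W w v"
  using frm_lincomb_left[OF assms, of a b] by (simp add: frm_sym[of W w])

lemma frm_lincomb_square:
  assumes "weight W" "adm W u" "adm W v"
  shows "frm W (\<lambda>x. a * u x + b * v x) (\<lambda>x. a * u x + b * v x)
    = a\<^sup>2 * frm W u u + 2 * a * b * frm W u v + b\<^sup>2 * frm W v v"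
  using frm_lincomb_left[OF assms adm_lincomb[OF assms(2,3)], of a b a b]
    frm_lincomb_right[OF assms assms(2), of a b] frm_lincomb_right[OF assms assms(3), of a b] frm_sym[of W v u]
  by (simp add: power2_eq_square algebra_simps)

lemma frm_nonneg:
  assumes "weight W" shows "0 \<le> frm W v v"
  unfolding frm_def
proof (rule integral_nonneg_AE)
  show "AE x in M. 0 \<le> grad \<Omega> v x \<bullet> grad \<Omega> v x + W x * (v x * v x)"
    using assms unfolding weight_def by (auto elim!: eventually_mono)
qed

lemma frm_Cauchy_Schwarz:
  assumes "weight W" "adm W u" "adm W v"
  shows "(frm W u v)\<^sup>2 \<le> frm W u u * frm W v v"
  by (rule nonneg_quadratic_discriminant)
     (use frm_lincomb_square[OF assms] frm_nonneg[OF assms(1)] in metis)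

lemma frm_Cauchy_Schwarz_sqrt:
  assumes "weight W" "adm W u" "adm W v"
  shows "\<bar>frm W u v\<bar> \<le> sqrt (frm W u u) * sqrt (frm W v v)"
  using real_sqrt_le_mono[OF frm_Cauchy_Schwarz[OF assms]] by (simp add: real_sqrt_mult)

lemma frm_add_square_le:
  assumes "weight W" "adm W u" "adm W v"
  shows "frm W (\<lambda>x. u x + v x) (\<lambda>x. u x + v x) \<le> 2 * frm W u u + 2 * frm W v v"
  using frm_lincomb_square[OF assms, of 1 1] frm_lincomb_square[OF assms, of 1 "-1"]
    frm_nonneg[OF assms(1), of "\<lambda>x. 1 * u x + (-1) * v x"] by simp

lemma frm_cong_AE:
  assumes "H1 \<Omega> u" "H1 \<Omega> u'" "adm W w" "weight W" "AE x in M. u x = u' x"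
  shows "frm W u w = frm W u' w"
proof -
  have g: "grad \<Omega> u = grad \<Omega> u'"
    using assms by (intro grad_cong_AE H1_sqint)
  have m: "(\<lambda>x. grad \<Omega> u' x \<bullet> grad \<Omega> w x) \<in> borel_measurable M"
    using grad_inner_integrable[OF assms(2) adm_H1[OF assms(3)]] by (rule borel_measurable_integrable)
  have m2: "u \<in> borel_measurable M" "u' \<in> borel_measurable M" "w \<in> borel_measurable M" "W \<in> borel_measurable M"
    using H1_sqint[OF assms(1)] H1_sqint[OF assms(2)] H1_sqint[OF adm_H1[OF assms(3)]] assms(4)
    by (auto simp: weight_def sqint_def)
  show ?thesis
    unfolding frm_def g
    by (rule integral_cong_AE) (use m m2 assms(5) in \<open>auto elim: eventually_mono\<close>)
qed

section \<open>Linear structure, closedness and completeness of \<open>H10\<close>\<close>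

section \<open>The Hilbert space H10\<close>

text \<open>The squared H1 norm, kept as an instance of the form so that bilinearity and
  Cauchy-Schwarz apply directly; \<open>H1norm_tendsto_iff\<close> translates limits back.\<close>

abbreviation nsq :: "('a \<Rightarrow> real) \<Rightarrow> real" where
  "nsq u \<equiv> frm (\<lambda>x. 1) u u"

lemma nsq_eq: "H1 \<Omega> u \<Longrightarrow> nsq u = (\<integral>x. (u x)\<^sup>2 \<partial>M) + (\<integral>x. (norm (grad \<Omega> u x))\<^sup>2 \<partial>M)"
  using frm_eq[OF weight_one, of u u] unfolding power2_norm_eq_inner
  by (simp add: adm_one power2_eq_square)

lemma H1norm_eq: "H1 \<Omega> u \<Longrightarrow> H1norm \<Omega> u = sqrt (nsq u)"
  by (simp add: H1norm_def nsq_eq)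

lemma norm_grad_expand:
  assumes "H1 \<Omega> u"
  shows "(\<integral>x. (norm (grad \<Omega> u x))\<^sup>2 \<partial>M) = (\<Sum>i\<in>Basis. \<integral>x. (grad \<Omega> u x \<bullet> i)\<^sup>2 \<partial>M)"
proof -
  have "(norm (grad \<Omega> u x))\<^sup>2 = (\<Sum>i\<in>Basis. (grad \<Omega> u x \<bullet> i)\<^sup>2)" for x
    unfolding power2_norm_eq_inner by (subst euclidean_inner) (simp add: power2_eq_square)
  then show ?thesis
    using sqint_int[OF grad_sqint[OF assms]] by simp
qed

lemma L2_le_nsq: "H1 \<Omega> u \<Longrightarrow> (\<integral>x. (u x)\<^sup>2 \<partial>M) \<le> nsq u"
  by (simp add: nsq_eq)

lemma grad_comp_le_nsq:
  assumes "H1 \<Omega> u" "i \<in> Basis"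
  shows "(\<integral>x. (grad \<Omega> u x \<bullet> i)\<^sup>2 \<partial>M) \<le> nsq u"
proof -
  have "(\<integral>x. (grad \<Omega> u x \<bullet> i)\<^sup>2 \<partial>M) \<le> (\<Sum>i\<in>Basis. \<integral>x. (grad \<Omega> u x \<bullet> i)\<^sup>2 \<partial>M)"
    using assms(2) by (intro member_le_sum) auto
  moreover have "0 \<le> (\<integral>x. (u x)\<^sup>2 \<partial>M)" by simp
  ultimately show ?thesis
    unfolding nsq_eq[OF assms(1)] norm_grad_expand[OF assms(1)] by linarith
qed

lemma H1_diff: "H1 \<Omega> u \<Longrightarrow> H1 \<Omega> v \<Longrightarrow> H1 \<Omega> (\<lambda>x. u x - v x)"
  using H1_lincomb(1)[of u v 1 "-1"] by simp

lemma grad_diff: "H1 \<Omega> u \<Longrightarrow> H1 \<Omega> v \<Longrightarrow> AE x in M. grad \<Omega> (\<lambda>x. u x - v x) x = grad \<Omega> u x - grad \<Omega> v x"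
  using H1_lincomb(2)[of u v 1 "-1"] by simp

lemma nsq_diff_triangle:
  assumes "H1 \<Omega> u" "H1 \<Omega> v" "H1 \<Omega> w"
  shows "nsq (\<lambda>x. u x - w x) \<le> 2 * nsq (\<lambda>x. u x - v x) + 2 * nsq (\<lambda>x. v x - w x)"
  using frm_add_square_le[OF weight_one, of "\<lambda>x. u x - v x" "\<lambda>x. v x - w x"] H1_diff assms
  by (simp add: adm_one)

lemma H10_H1: "u \<in> H10 \<Omega> \<Longrightarrow> H1 \<Omega> u"
  by (simp add: H10_def)

lemma sqrt_tendsto_0_iff:
  fixes f :: "nat \<Rightarrow> real"
  assumes "\<And>n. 0 \<le> f n" shows "(\<lambda>n. sqrt (f n)) \<longlonglongrightarrow> 0 \<longleftrightarrow> f \<longlonglongrightarrow> 0"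
proof
  assume "(\<lambda>n. sqrt (f n)) \<longlonglongrightarrow> 0"
  then have "(\<lambda>n. (sqrt (f n))\<^sup>2) \<longlonglongrightarrow> 0\<^sup>2" by (rule tendsto_power)
  then show "f \<longlonglongrightarrow> 0" using assms by simp
next
  assume "f \<longlonglongrightarrow> 0"
  then have "(\<lambda>n. sqrt (f n)) \<longlonglongrightarrow> sqrt 0" by (rule tendsto_real_sqrt)
  then show "(\<lambda>n. sqrt (f n)) \<longlonglongrightarrow> 0" by simp
qed

lemma H1norm_tendsto_iff:
  assumes "\<And>n. H1 \<Omega> (u n)"
  shows "(\<lambda>n. H1norm \<Omega> (u n)) \<longlonglongrightarrow> 0 \<longleftrightarrow> (\<lambda>n. nsq (u n)) \<longlonglongrightarrow> 0"
  unfolding H1norm_eq[OF assms] by (rule sqrt_tendsto_0_iff) (rule frm_nonneg[OF weight_one])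

lemma H10_iff:
  "u \<in> H10 \<Omega> \<longleftrightarrow> H1 \<Omega> u \<and> (\<exists>\<phi>. (\<forall>k. test_fun \<Omega> (\<phi> k)) \<and> (\<lambda>k. nsq (\<lambda>x. \<phi> k x - u x)) \<longlonglongrightarrow> 0)"
proof -
  have "(\<lambda>k. H1norm \<Omega> (\<lambda>x. \<phi> k x - u x)) \<longlonglongrightarrow> 0 \<longleftrightarrow> (\<lambda>k. nsq (\<lambda>x. \<phi> k x - u x)) \<longlonglongrightarrow> 0"
    if "H1 \<Omega> u" "\<forall>k. test_fun \<Omega> (\<phi> k)" for \<phi>
    using that by (intro H1norm_tendsto_iff H1_diff[OF H1_test that(1)]) auto
  then show ?thesis unfolding H10_def by blast
qed

lemma H10_approx:
  assumes "u \<in> H10 \<Omega>" "0 < e"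
  shows "\<exists>\<phi>. test_fun \<Omega> \<phi> \<and> nsq (\<lambda>x. \<phi> x - u x) < e"
proof -
  obtain \<phi> where p: "\<And>k. test_fun \<Omega> (\<phi> k)" "(\<lambda>k. nsq (\<lambda>x. \<phi> k x - u x)) \<longlonglongrightarrow> 0"
    using assms(1) unfolding H10_iff by blast
  have "\<forall>\<^sub>F k in sequentially. nsq (\<lambda>x. \<phi> k x - u x) < e"
    using order_tendstoD(2)[OF p(2) assms(2)] .
  then obtain k where "nsq (\<lambda>x. \<phi> k x - u x) < e"
    unfolding eventually_sequentially by blast
  then show ?thesis using p(1) by blast
qed

lemma H10I_approx:
  assumes "H1 \<Omega> u" "\<And>e. 0 < e \<Longrightarrow> \<exists>\<phi>. test_fun \<Omega> \<phi> \<and> nsq (\<lambda>x. \<phi> x - u x) \<le> e"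
  shows "u \<in> H10 \<Omega>"
proof -
  have "\<forall>k. \<exists>\<phi>. test_fun \<Omega> \<phi> \<and> nsq (\<lambda>x. \<phi> x - u x) \<le> 1 / real (Suc k)"
    using assms(2) by simp
  then obtain \<phi> where p: "\<And>k. test_fun \<Omega> (\<phi> k)" "\<And>k. nsq (\<lambda>x. \<phi> k x - u x) \<le> 1 / real (Suc k)"
    by metis
  have "(\<lambda>k. nsq (\<lambda>x. \<phi> k x - u x)) \<longlonglongrightarrow> 0"
    by (rule tendsto_sandwich[OF _ _ tendsto_const LIMSEQ_Suc[OF lim_1_over_n]])
       (auto intro!: always_eventually p(2) frm_nonneg[OF weight_one] simp del: of_nat_Suc)
  then show ?thesis using assms(1) p(1) unfolding H10_iff by blast
qed

lemma H10_lincomb: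
  assumes "u \<in> H10 \<Omega>" "v \<in> H10 \<Omega>" shows "(\<lambda>x. a * u x + b * v x) \<in> H10 \<Omega>"
proof (rule H10I_approx)
  note h = assms[THEN H10_H1]
  show "H1 \<Omega> (\<lambda>x. a * u x + b * v x)" using H1_lincomb(1)[OF h] .
  fix e :: real assume e: "0 < e"
  \<comment> \<open>The summand 1 keeps \<open>c\<close> positive when a = b = 0.\<close>
  define c where "c = 2 * a\<^sup>2 + 2 * b\<^sup>2 + 1"
  have c: "c > 0" by (simp add: c_def add_nonneg_pos)
  define k where "k = e / c"
  have k: "0 < k" "c * k = e" using c e by (auto simp: k_def)
  obtain \<phi> where p: "test_fun \<Omega> \<phi>" "nsq (\<lambda>x. \<phi> x - u x) < k"
    using H10_approx[OF assms(1) k(1)] by auto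
  obtain \<psi> where q: "test_fun \<Omega> \<psi>" "nsq (\<lambda>x. \<psi> x - v x) < k"
    using H10_approx[OF assms(2) k(1)] by auto
  note d = H1_diff[OF H1_test[OF p(1)] h(1)] H1_diff[OF H1_test[OF q(1)] h(2)]
  have s: "nsq (\<lambda>x. t * w x) = t\<^sup>2 * nsq w" if "H1 \<Omega> w" for t w
    using frm_lincomb_square[OF weight_one, of w w t 0] that by (simp add: adm_one)
  have d': "H1 \<Omega> (\<lambda>x. a * (\<phi> x - u x))" "H1 \<Omega> (\<lambda>x. b * (\<psi> x - v x))"
    using H1_lincomb(1)[OF d(1) d(1), of a 0] H1_lincomb(1)[OF d(2) d(2), of b 0] by simp_all
  have "(\<lambda>x. (a * \<phi> x + b * \<psi> x) - (a * u x + b * v x)) = (\<lambda>x. a * (\<phi> x - u x) + b * (\<psi> x - v x))"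
    by (simp add: algebra_simps)
  then have "nsq (\<lambda>x. (a * \<phi> x + b * \<psi> x) - (a * u x + b * v x))
      \<le> 2 * (a\<^sup>2 * nsq (\<lambda>x. \<phi> x - u x)) + 2 * (b\<^sup>2 * nsq (\<lambda>x. \<psi> x - v x))"
    using frm_add_square_le[OF weight_one d'[folded adm_one]] s[OF d(1)] s[OF d(2)] by simp
  also have "\<dots> \<le> 2 * (a\<^sup>2 * k) + 2 * (b\<^sup>2 * k)"
    using p(2) q(2) by (intro add_mono mult_left_mono) auto
  also have "\<dots> \<le> e"
    using k(1) unfolding k(2)[symmetric] by (simp add: c_def algebra_simps)
  finally show "\<exists>\<phi>. test_fun \<Omega> \<phi> \<and> nsq (\<lambda>x. \<phi> x - (a * u x + b * v x)) \<le> e"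
    using test_fun_lincomb[OF p(1) q(1)] by blast
qed

lemma H10_diff: "u \<in> H10 \<Omega> \<Longrightarrow> v \<in> H10 \<Omega> \<Longrightarrow> (\<lambda>x. u x - v x) \<in> H10 \<Omega>"
  using H10_lincomb[of u v 1 "-1"] by simp

lemma H10_cmult: "u \<in> H10 \<Omega> \<Longrightarrow> (\<lambda>x. c * u x) \<in> H10 \<Omega>"
  using H10_lincomb[of u u c 0] by simp

lemma H10_zero: "(\<lambda>x. 0) \<in> H10 \<Omega>"
proof -
  have t: "test_fun \<Omega> (\<lambda>x. 0)"
    by (rule test_funI_support[where K="{}"]) (auto intro: Cn_const)
  have "nsq (\<lambda>x. 0 - 0) = 0"
    using frm_lincomb_square[OF weight_one H1_test[OF t, folded adm_one] H1_test[OF t, folded adm_one], of 0 0] by simp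
  then show ?thesis
    using H10I_approx[OF H1_test[OF t]] t by force
qed

lemma H10_closed:
  assumes "\<And>n. u n \<in> H10 \<Omega>" "H1 \<Omega> u0" "(\<lambda>n. nsq (\<lambda>x. u n x - u0 x)) \<longlonglongrightarrow> 0"
  shows "u0 \<in> H10 \<Omega>"
proof (rule H10I_approx[OF assms(2)])
  fix e :: real assume e: "0 < e"
  have "\<forall>\<^sub>F n in sequentially. nsq (\<lambda>x. u n x - u0 x) < e / 4"
    using order_tendstoD(2)[OF assms(3), of "e / 4"] e by simp
  then obtain n where n: "nsq (\<lambda>x. u n x - u0 x) < e / 4"
    unfolding eventually_sequentially by blast
  obtain \<phi> where p: "test_fun \<Omega> \<phi>" "nsq (\<lambda>x. \<phi> x - u n x) < e / 4"
    using H10_approx[OF assms(1)[of n], of "e / 4"] e by auto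
  have "nsq (\<lambda>x. \<phi> x - u0 x) \<le> e"
    using nsq_diff_triangle[OF H1_test[OF p(1)] H10_H1[OF assms(1)[of n]] assms(2)] n p(2) by simp
  then show "\<exists>\<phi>. test_fun \<Omega> \<phi> \<and> nsq (\<lambda>x. \<phi> x - u0 x) \<le> e" using p(1) by blast
qed

lemma nsq_diff_AE_eq_0:
  assumes "H1 \<Omega> u" "H1 \<Omega> v" "AE x in M. u x = v x"
  shows "nsq (\<lambda>x. u x - v x) = 0"
proof -
  note d = H1_diff[OF assms(1,2)]
  have z: "AE x in M. u x - v x = 0" using assms(3) by eventually_elim simp
  have "frm (\<lambda>x. 1) (\<lambda>x. u x - v x) (\<lambda>x. u x - v x) = frm (\<lambda>x. 1) (\<lambda>x. 0) (\<lambda>x. u x - v x)"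
    using d H10_H1[OF H10_zero] z by (intro frm_cong_AE weight_one) (auto simp: adm_one)
  also have "\<dots> = 0"
    using frm_lincomb_left[OF weight_one, of u u "\<lambda>x. u x - v x" 0 0] assms(1) d by (simp add: adm_one)
  finally show ?thesis .
qed

text \<open>Needed for limits prescribed only as L2 functions. The constant sequence
  \<open>u\<close> converges to \<open>v\<close> in H1, because their H1 distance is 0, and
  \<open>H10\<close> is closed.\<close>

lemma H10_cong_AE:
  assumes "u \<in> H10 \<Omega>" "sqint M v" "AE x in M. u x = v x"
  shows "v \<in> H10 \<Omega>"
proof -
  note h = H10_H1[OF assms(1)]
  have hv: "H1 \<Omega> v"
    using H1I[OF assms(2)] H1_weak_grad[OF h] weak_grad_cong_AE[OF H1_sqint[OF h] assms(2,3)] by blast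
  then show ?thesis
    using nsq_diff_AE_eq_0[OF h hv assms(3)] by (intro H10_closed[OF assms(1) hv]) simp
qed

text \<open>The functions and each partial derivative converge separately in L2; closedness of the
  weak gradient identifies the assembled limit \<open>g\<close> as the gradient of the limit
  function.\<close>

lemma H1_complete:
  assumes u: "\<And>n. H1 \<Omega> (u n)"
    and cauchy: "\<And>e. e > 0 \<Longrightarrow> \<exists>N. \<forall>m\<ge>N. \<forall>n\<ge>N. nsq (\<lambda>x. u m x - u n x) < e"
  shows "\<exists>u0. H1 \<Omega> u0 \<and> (\<lambda>n. nsq (\<lambda>x. u n x - u0 x)) \<longlonglongrightarrow> 0"
proof -
  have c1: "\<exists>N. \<forall>m\<ge>N. \<forall>n\<ge>N. (\<integral>x. (u m x - u n x)\<^sup>2 \<partial>M) < e" if pos: "e > 0" for e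
  proof -
    obtain N where "\<forall>m\<ge>N. \<forall>n\<ge>N. nsq (\<lambda>x. u m x - u n x) < e" using cauchy[OF pos] by blast
    then show ?thesis
      by (intro exI[of _ N] allI impI le_less_trans[OF L2_le_nsq[OF H1_diff[OF u u]]]) simp
  qed
  obtain u0 where u0: "sqint M u0" "(\<lambda>n. \<integral>x. (u n x - u0 x)\<^sup>2 \<partial>M) \<longlonglongrightarrow> 0"
    by (rule L2_complete[OF finite_measure_dom H1_sqint[OF u] c1])
  have "\<exists>h. sqint M h \<and> (\<lambda>n. \<integral>x. (grad \<Omega> (u n) x \<bullet> i - h x)\<^sup>2 \<partial>M) \<longlonglongrightarrow> 0" if i: "i \<in> Basis" for i
  proof -
    have e: "(\<integral>x. (grad \<Omega> (u m) x \<bullet> i - grad \<Omega> (u n) x \<bullet> i)\<^sup>2 \<partial>M)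
        = (\<integral>x. (grad \<Omega> (\<lambda>x. u m x - u n x) x \<bullet> i)\<^sup>2 \<partial>M)" for m n
      using grad_diff[OF u u, of m n] grad_sqint[OF u i, of m] grad_sqint[OF u i, of n] grad_sqint[OF H1_diff[OF u u] i, of m n]
      by (intro integral_cong_AE) (auto simp: inner_diff_left sqint_def elim!: eventually_mono)
    have c2: "\<exists>N. \<forall>m\<ge>N. \<forall>n\<ge>N. (\<integral>x. (grad \<Omega> (u m) x \<bullet> i - grad \<Omega> (u n) x \<bullet> i)\<^sup>2 \<partial>M) < e" if pos: "e > 0" for e
    proof -
      obtain N where "\<forall>m\<ge>N. \<forall>n\<ge>N. nsq (\<lambda>x. u m x - u n x) < e" using cauchy[OF pos] by blast
      then show ?thesis
        unfolding e by (intro exI[of _ N] allI impI le_less_trans[OF grad_comp_le_nsq[OF H1_diff[OF u u] i]]) simp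
    qed
    obtain h where "sqint M h" "(\<lambda>n. \<integral>x. (grad \<Omega> (u n) x \<bullet> i - h x)\<^sup>2 \<partial>M) \<longlonglongrightarrow> 0"
      by (rule L2_complete[OF finite_measure_dom grad_sqint[OF u i] c2])
    then show ?thesis by blast
  qed
  then have "\<forall>i. \<exists>h. i \<in> Basis \<longrightarrow> sqint M h \<and> (\<lambda>n. \<integral>x. (grad \<Omega> (u n) x \<bullet> i - h x)\<^sup>2 \<partial>M) \<longlonglongrightarrow> 0"
    by blast
  from choice[OF this] obtain h where "\<forall>i. i \<in> Basis \<longrightarrow> sqint M (h i) \<and> (\<lambda>n. \<integral>x. (grad \<Omega> (u n) x \<bullet> i - h i x)\<^sup>2 \<partial>M) \<longlonglongrightarrow> 0"
    ..
  then have h: "\<And>i. i \<in> Basis \<Longrightarrow> sqint M (h i)"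
    "\<And>i. i \<in> Basis \<Longrightarrow> (\<lambda>n. \<integral>x. (grad \<Omega> (u n) x \<bullet> i - h i x)\<^sup>2 \<partial>M) \<longlonglongrightarrow> 0"
    by simp_all
  define g where "g x = (\<Sum>i\<in>Basis. h i x *\<^sub>R i)" for x
  have gi: "g x \<bullet> i = h i x" if "i \<in> Basis" for x i
    using that by (simp add: g_def)
  have w: "weak_grad \<Omega> u0 g"
    by (rule weak_grad_limit[OF H1_sqint[OF u] u0 H1_weak_grad[OF u]]) (use h gi in simp_all)
  have h0: "H1 \<Omega> u0" by (rule H1I[OF u0(1) w])
  have e: "nsq (\<lambda>x. u n x - u0 x)
      = (\<integral>x. (u n x - u0 x)\<^sup>2 \<partial>M) + (\<Sum>i\<in>Basis. \<integral>x. (grad \<Omega> (u n) x \<bullet> i - h i x)\<^sup>2 \<partial>M)" for n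
  proof -
    have "(\<integral>x. (grad \<Omega> (\<lambda>x. u n x - u0 x) x \<bullet> i)\<^sup>2 \<partial>M) = (\<integral>x. (grad \<Omega> (u n) x \<bullet> i - h i x)\<^sup>2 \<partial>M)"
      if i: "i \<in> Basis" for i
    proof (rule integral_cong_AE)
      show "AE x in M. (grad \<Omega> (\<lambda>x. u n x - u0 x) x \<bullet> i)\<^sup>2 = (grad \<Omega> (u n) x \<bullet> i - h i x)\<^sup>2"
        using grad_diff[OF u h0, of n] grad_AE_eq[OF h0 w]
        by eventually_elim (simp add: inner_diff_left gi[OF i])
    qed (use grad_sqint[OF u i, of n] h(1)[OF i] grad_sqint[OF H1_diff[OF u h0] i, of n] in \<open>auto simp: sqint_def\<close>)
    then show ?thesis
      using H1_diff[OF u h0] by (simp add: nsq_eq norm_grad_expand)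
  qed
  have "(\<lambda>n. nsq (\<lambda>x. u n x - u0 x)) \<longlonglongrightarrow> 0 + (\<Sum>i\<in>(Basis::'a set). 0)"
    unfolding e by (intro tendsto_add tendsto_sum u0 h)
  then show ?thesis using h0 by auto
qed

lemma H10_complete:
  assumes u: "\<And>n. u n \<in> H10 \<Omega>"
    and cauchy: "\<And>e. e > 0 \<Longrightarrow> \<exists>N. \<forall>m\<ge>N. \<forall>n\<ge>N. nsq (\<lambda>x. u m x - u n x) < e"
  shows "\<exists>u0\<in>H10 \<Omega>. (\<lambda>n. nsq (\<lambda>x. u n x - u0 x)) \<longlonglongrightarrow> 0"
proof -
  obtain u0 where "H1 \<Omega> u0" "(\<lambda>n. nsq (\<lambda>x. u n x - u0 x)) \<longlonglongrightarrow> 0"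
    using H1_complete[of u] H10_H1[OF u] cauchy by blast
  then show ?thesis using H10_closed[of u] u by blast
qed

end

section \<open>Fourth powers controlled by L2 norm and gradient in dimensions one to three\<close>

section \<open>A Gagliardo--Nirenberg inequality\<close>

text \<open>The fundamental theorem of calculus for g^2, whose derivative is 2 g g', started at a
  point left of \<open>t\<close> where \<open>g\<close> vanishes.\<close>

lemma one_dim_square_le:
  fixes g g' :: "real \<Rightarrow> real"
  assumes d: "\<And>s. (g has_real_derivative g' s) (at s)" and c: "continuous_on UNIV g'"
    and z: "\<exists>R. \<forall>s. R < \<bar>s\<bar> \<longrightarrow> g s = 0"
  shows "ennreal ((g t)\<^sup>2) \<le> (\<integral>\<^sup>+s. ennreal (2 * \<bar>g s * g' s\<bar>) \<partial>lborel)"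
proof -
  obtain R where R: "\<forall>s. R < \<bar>s\<bar> \<longrightarrow> g s = 0" using z by blast
  define a where "a = - (\<bar>R\<bar> + \<bar>t\<bar> + 1)"
  have a: "a \<le> t" "g a = 0" using R by (auto simp: a_def)
  have cont: "isCont g s" "isCont g' s" for s
    using d DERIV_isCont c continuous_on_eq_continuous_at[of UNIV g'] by auto
  have "((\<lambda>s. (g s)\<^sup>2) has_real_derivative 2 * (g s * g' s)) (at s)" for s
    using d[of s] by (auto intro!: derivative_eq_intros)
  then have b: "has_bochner_integral lborel (\<lambda>s. (2 * (g s * g' s)) * indicator {a..t} s) ((g t)\<^sup>2 - (g a)\<^sup>2)"
    using a(1) cont by (intro has_bochner_integral_FTC_Icc_real) (auto intro!: continuous_intros)
  have "ennreal ((g t)\<^sup>2) = ennreal (norm (\<integral>s. (2 * (g s * g' s)) * indicator {a..t} s \<partial>lborel))"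
    using has_bochner_integral_integral_eq[OF b] a(2) by simp
  also have "\<dots> \<le> (\<integral>\<^sup>+s. norm ((2 * (g s * g' s)) * indicator {a..t} s) \<partial>lborel)"
    by (rule integral_norm_bound_ennreal) (rule integrable.intros[OF b])
  also have "\<dots> \<le> (\<integral>\<^sup>+s. ennreal (2 * \<bar>g s * g' s\<bar>) \<partial>lborel)"
    by (intro nn_integral_mono ennreal_leI) (auto simp: indicator_def abs_mult)
  finally show ?thesis .
qed

text \<open>Tonelli in coordinates: Lebesgue measure is the image of a product of line measures over
  \<open>Basis\<close>. In the versions for two and three coordinates the basis is listed backwards,
  so that the insertion rule strips the outermost variable first.\<close>

lemma nn_integral_basis1:
  fixes h :: "'a::euclidean_space \<Rightarrow> ennreal"
  assumes B: "Basis = {a::'a}" and h[measurable]: "h \<in> borel_measurable borel"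
  shows "(\<integral>\<^sup>+x. h x \<partial>lborel) = (\<integral>\<^sup>+x. h (x *\<^sub>R a) \<partial>lborel)"
proof -
  interpret product_sigma_finite "\<lambda>_::'a. lborel :: real measure" by standard
  have "(\<integral>\<^sup>+x. h x \<partial>lborel) = (\<integral>\<^sup>+p. h (\<Sum>b\<in>Basis. p b *\<^sub>R b) \<partial>(\<Pi>\<^sub>M b\<in>(Basis::'a set). lborel))"
    by (subst lborel_eq) (subst nn_integral_distr; simp)
  also have "\<dots> = (\<integral>\<^sup>+x. h (x *\<^sub>R a) \<partial>lborel)"
    unfolding B using product_nn_integral_singleton[of "\<lambda>x. h (x *\<^sub>R a)" a] by simp
  finally show ?thesis .
qed

lemma nn_integral_basis2:
  fixes h :: "'a::euclidean_space \<Rightarrow> ennreal"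
  assumes B: "Basis = {a, b::'a}" "a \<noteq> b" and h[measurable]: "h \<in> borel_measurable borel"
  shows "(\<integral>\<^sup>+x. h x \<partial>lborel) = (\<integral>\<^sup>+y. \<integral>\<^sup>+x. h (x *\<^sub>R a + y *\<^sub>R b) \<partial>lborel \<partial>lborel)"
proof -
  interpret product_sigma_finite "\<lambda>_::'a. lborel :: real measure" by standard
  have B': "Basis = {b, a}" using B by auto
  have "(\<integral>\<^sup>+x. h x \<partial>lborel) = (\<integral>\<^sup>+p. h (\<Sum>b\<in>Basis. p b *\<^sub>R b) \<partial>(\<Pi>\<^sub>M b\<in>(Basis::'a set). lborel))"
    by (subst lborel_eq) (subst nn_integral_distr; simp)
  also have "\<dots> = (\<integral>\<^sup>+y. \<integral>\<^sup>+p. h (p a *\<^sub>R a + y *\<^sub>R b) \<partial>(\<Pi>\<^sub>M b\<in>{a}. lborel) \<partial>lborel)"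
    unfolding B' using B(2) by (subst product_nn_integral_insert_rev) (simp_all add: add.commute)
  also have "\<dots> = (\<integral>\<^sup>+y. \<integral>\<^sup>+x. h (x *\<^sub>R a + y *\<^sub>R b) \<partial>lborel \<partial>lborel)"
    using product_nn_integral_singleton[of "\<lambda>x. h (x *\<^sub>R a + _ *\<^sub>R b)" a] by simp
  finally show ?thesis .
qed

lemma nn_integral_basis3:
  fixes h :: "'a::euclidean_space \<Rightarrow> ennreal"
  assumes B: "Basis = {a, b, c::'a}" "a \<noteq> b" "a \<noteq> c" "b \<noteq> c" and h[measurable]: "h \<in> borel_measurable borel"
  shows "(\<integral>\<^sup>+x. h x \<partial>lborel) = (\<integral>\<^sup>+z. \<integral>\<^sup>+y. \<integral>\<^sup>+x. h (x *\<^sub>R a + y *\<^sub>R b + z *\<^sub>R c) \<partial>lborel \<partial>lborel \<partial>lborel)"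
proof -
  interpret product_sigma_finite "\<lambda>_::'a. lborel :: real measure" by standard
  have B': "Basis = {c, b, a}" using B by auto
  have "(\<integral>\<^sup>+x. h x \<partial>lborel) = (\<integral>\<^sup>+p. h (\<Sum>b\<in>Basis. p b *\<^sub>R b) \<partial>(\<Pi>\<^sub>M b\<in>(Basis::'a set). lborel))"
    by (subst lborel_eq) (subst nn_integral_distr; simp)
  also have "\<dots> = (\<integral>\<^sup>+z. \<integral>\<^sup>+p. h (p a *\<^sub>R a + p b *\<^sub>R b + z *\<^sub>R c) \<partial>(\<Pi>\<^sub>M b\<in>{b, a}. lborel) \<partial>lborel)"
    unfolding B' using B(2-4) by (subst product_nn_integral_insert_rev) (simp_all add: ac_simps)
  also have "\<dots> = (\<integral>\<^sup>+z. \<integral>\<^sup>+y. \<integral>\<^sup>+p. h (p a *\<^sub>R a + y *\<^sub>R b + z *\<^sub>R c) \<partial>(\<Pi>\<^sub>M b\<in>{a}. lborel) \<partial>lborel \<partial>lborel)"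
    using B(2-4) by (subst product_nn_integral_insert_rev) simp_all
  also have "\<dots> = (\<integral>\<^sup>+z. \<integral>\<^sup>+y. \<integral>\<^sup>+x. h (x *\<^sub>R a + y *\<^sub>R b + z *\<^sub>R c) \<partial>lborel \<partial>lborel \<partial>lborel)"
    using product_nn_integral_singleton[of "\<lambda>x. h (x *\<^sub>R a + _ *\<^sub>R b + _ *\<^sub>R c)" a] by simp
  finally show ?thesis .
qed


text \<open>Stated for iterated integrals to fit the planar slices of the three-dimensional
  estimate.\<close>

lemma nn_integral_Cauchy_Schwarz_iterated:
  fixes f g :: "real \<Rightarrow> real \<Rightarrow> ennreal"
  assumes f[measurable]: "case_prod f \<in> borel_measurable (borel \<Otimes>\<^sub>M borel)"
    and g[measurable]: "case_prod g \<in> borel_measurable (borel \<Otimes>\<^sub>M borel)"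
  shows "(\<integral>\<^sup>+y. \<integral>\<^sup>+x. f y x * g y x \<partial>lborel \<partial>lborel)\<^sup>2
    \<le> (\<integral>\<^sup>+y. \<integral>\<^sup>+x. (f y x)\<^sup>2 \<partial>lborel \<partial>lborel) * (\<integral>\<^sup>+y. \<integral>\<^sup>+x. (g y x)\<^sup>2 \<partial>lborel \<partial>lborel)"
proof -
  have m: "case_prod f \<in> borel_measurable (lborel \<Otimes>\<^sub>M lborel)" "case_prod g \<in> borel_measurable (lborel \<Otimes>\<^sub>M lborel)"
    using f g by (simp_all cong: measurable_cong_sets sets_pair_measure_cong)
  have "(\<integral>\<^sup>+y. \<integral>\<^sup>+x. h y x \<partial>lborel \<partial>lborel) = (\<integral>\<^sup>+p. case_prod h p \<partial>(lborel \<Otimes>\<^sub>M lborel))"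
    if "case_prod h \<in> borel_measurable (lborel \<Otimes>\<^sub>M lborel)" for h :: "real \<Rightarrow> real \<Rightarrow> ennreal"
    using lborel.nn_integral_fst[OF that] by simp
  note e = this
  have m': "case_prod (\<lambda>y x. f y x * g y x) \<in> borel_measurable (lborel \<Otimes>\<^sub>M lborel)"
    "case_prod (\<lambda>y x. (f y x)\<^sup>2) \<in> borel_measurable (lborel \<Otimes>\<^sub>M lborel)"
    "case_prod (\<lambda>y x. (g y x)\<^sup>2) \<in> borel_measurable (lborel \<Otimes>\<^sub>M lborel)"
    using m by (simp_all add: split_beta')
  show ?thesis
    unfolding m'[THEN e] using Cauchy_Schwarz_nn_integral[OF m] by (simp add: split_beta')
qed

lemma line_square_le:
  fixes \<phi> :: "'a::euclidean_space \<Rightarrow> real"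
  assumes t: "test_fun \<Omega> \<phi>" and b: "b \<in> Basis"
  shows "ennreal ((\<phi> (t *\<^sub>R b + w))\<^sup>2) \<le> (\<integral>\<^sup>+s. ennreal (2 * \<bar>\<phi> (s *\<^sub>R b + w) * dderiv b \<phi> (s *\<^sub>R b + w)\<bar>) \<partial>lborel)"
proof (rule one_dim_square_le)
  show "((\<lambda>s. \<phi> (s *\<^sub>R b + w)) has_real_derivative dderiv b \<phi> (s *\<^sub>R b + w)) (at s)" for s
    using line_deriv[OF test_fun_differentiable[OF t], of w b s] by (simp add: add.commute)
  show "continuous_on UNIV (\<lambda>s. dderiv b \<phi> (s *\<^sub>R b + w))"
    by (rule continuous_on_compose2[OF ccont_cont[OF ccont_dderiv[OF t]]]) (auto intro!: continuous_intros)
  obtain K where K: "compact K" "\<forall>x. x \<notin> K \<longrightarrow> \<phi> x = 0"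
    using test_fun_ccont[OF t] unfolding ccont_def by blast
  then obtain R where R: "\<forall>x\<in>K. norm x \<le> R" using compact_imp_bounded[OF K(1)] unfolding bounded_iff by blast
  have "\<phi> (s *\<^sub>R b + w) = 0" if s: "R + norm w < \<bar>s\<bar>" for s
  proof -
    have "norm (s *\<^sub>R b) \<le> norm (s *\<^sub>R b + w) + norm w" using norm_triangle_ineq4[of "s *\<^sub>R b + w" w] by simp
    then have "R < norm (s *\<^sub>R b + w)" using s b by simp
    then have "s *\<^sub>R b + w \<notin> K" using R by (meson not_le)
    then show ?thesis using K(2) by blast
  qed
  then show "\<exists>R. \<forall>s. R < \<bar>s\<bar> \<longrightarrow> \<phi> (s *\<^sub>R b + w) = 0" by blast
qed

lemma ennreal_double_prod: "ennreal (2 * \<bar>u * v\<bar>) = 2 * (ennreal \<bar>u\<bar> * ennreal \<bar>v\<bar>)"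
  by (simp add: ennreal_mult abs_mult)

lemma ennreal_abs_square: "(ennreal \<bar>u\<bar>)\<^sup>2 = ennreal (u\<^sup>2)"
  by (simp add: ennreal_power)

lemma nn_integral_double_prod_square_le:
  fixes u v :: "'b \<Rightarrow> real"
  assumes [measurable]: "u \<in> borel_measurable M" "v \<in> borel_measurable M"
  shows "(\<integral>\<^sup>+x. ennreal (2 * \<bar>u x * v x\<bar>) \<partial>M)\<^sup>2 \<le> 4 * (\<integral>\<^sup>+x. ennreal ((u x)\<^sup>2) \<partial>M) * (\<integral>\<^sup>+x. ennreal ((v x)\<^sup>2) \<partial>M)"
proof -
  have "(\<integral>\<^sup>+x. ennreal (2 * \<bar>u x * v x\<bar>) \<partial>M)\<^sup>2 = 4 * (\<integral>\<^sup>+x. ennreal \<bar>u x\<bar> * ennreal \<bar>v x\<bar> \<partial>M)\<^sup>2"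
    unfolding ennreal_double_prod by (subst nn_integral_cmult) (simp_all add: power_mult_distrib)
  also have "\<dots> \<le> 4 * ((\<integral>\<^sup>+x. (ennreal \<bar>u x\<bar>)\<^sup>2 \<partial>M) * (\<integral>\<^sup>+x. (ennreal \<bar>v x\<bar>)\<^sup>2 \<partial>M))"
    by (intro mult_left_mono Cauchy_Schwarz_nn_integral) auto
  finally show ?thesis by (simp add: ennreal_abs_square mult.assoc)
qed

lemma iterated_double_prod_square_le:
  fixes u v :: "real \<Rightarrow> real \<Rightarrow> real"
  assumes [measurable]: "case_prod u \<in> borel_measurable (borel \<Otimes>\<^sub>M borel)" "case_prod v \<in> borel_measurable (borel \<Otimes>\<^sub>M borel)"
  shows "(\<integral>\<^sup>+y. \<integral>\<^sup>+x. ennreal (2 * \<bar>u y x * v y x\<bar>) \<partial>lborel \<partial>lborel)\<^sup>2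
    \<le> 4 * (\<integral>\<^sup>+y. \<integral>\<^sup>+x. ennreal ((u y x)\<^sup>2) \<partial>lborel \<partial>lborel) * (\<integral>\<^sup>+y. \<integral>\<^sup>+x. ennreal ((v y x)\<^sup>2) \<partial>lborel \<partial>lborel)"
proof -
  have "(\<integral>\<^sup>+y. \<integral>\<^sup>+x. ennreal (2 * \<bar>u y x * v y x\<bar>) \<partial>lborel \<partial>lborel)\<^sup>2
      = 4 * (\<integral>\<^sup>+y. \<integral>\<^sup>+x. ennreal \<bar>u y x\<bar> * ennreal \<bar>v y x\<bar> \<partial>lborel \<partial>lborel)\<^sup>2"
    unfolding ennreal_double_prod
    by (subst nn_integral_cmult, simp, subst nn_integral_cmult, simp) (simp add: power_mult_distrib)
  also have "\<dots> \<le> 4 * ((\<integral>\<^sup>+y. \<integral>\<^sup>+x. (ennreal \<bar>u y x\<bar>)\<^sup>2 \<partial>lborel \<partial>lborel) * (\<integral>\<^sup>+y. \<integral>\<^sup>+x. (ennreal \<bar>v y x\<bar>)\<^sup>2 \<partial>lborel \<partial>lborel))"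
    by (intro mult_left_mono nn_integral_Cauchy_Schwarz_iterated) (auto simp: split_beta')
  finally show ?thesis by (simp add: ennreal_abs_square mult.assoc)
qed


lemma ennreal_power4: "ennreal (u^4) = ennreal (u\<^sup>2) * ennreal (u\<^sup>2)"
  by (simp add: ennreal_mult[symmetric] power4_eq_xxxx power2_eq_square mult.assoc)

text \<open>The square of a test function is bounded by its line integrals in every coordinate direction, and the
  line integral in direction \<open>a\<close> no longer depends on the coordinate along \<open>a\<close>. Hence the fourth power
  is bounded by a product of two functions whose integrals separate.\<close>

lemma Ladyzhenskaya_dim1:
  fixes \<phi> :: "'a::euclidean_space \<Rightarrow> real"
  assumes t: "test_fun \<Omega> \<phi>" and B: "Basis = {a::'a}"
  shows "(\<integral>\<^sup>+x. ennreal ((\<phi> x)^4) \<partial>lborel)\<^sup>2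
    \<le> 4 * (\<integral>\<^sup>+x. ennreal ((\<phi> x)\<^sup>2) \<partial>lborel)^3 * (\<integral>\<^sup>+x. ennreal ((dderiv a \<phi> x)\<^sup>2) \<partial>lborel)"
proof -
  have [measurable]: "\<phi> \<in> borel_measurable borel" "dderiv a \<phi> \<in> borel_measurable borel"
    using ccont_borel[OF test_fun_ccont[OF t]] ccont_borel[OF ccont_dderiv[OF t, of a]] .
  define S where "S = (\<integral>\<^sup>+x. ennreal (2 * \<bar>\<phi> x * dderiv a \<phi> x\<bar>) \<partial>lborel)"
  define A where "A = (\<integral>\<^sup>+x. ennreal ((\<phi> x)\<^sup>2) \<partial>lborel)"
  define D where "D = (\<integral>\<^sup>+x. ennreal ((dderiv a \<phi> x)\<^sup>2) \<partial>lborel)"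
  have S: "ennreal ((\<phi> x)\<^sup>2) \<le> S" for x
  proof -
    have "x = (x \<bullet> a) *\<^sub>R a" using euclidean_representation[of x] by (simp add: B)
    moreover have "S = (\<integral>\<^sup>+s. ennreal (2 * \<bar>\<phi> (s *\<^sub>R a) * dderiv a \<phi> (s *\<^sub>R a)\<bar>) \<partial>lborel)"
      unfolding S_def by (rule nn_integral_basis1[OF B]) simp
    ultimately show ?thesis
      using line_square_le[OF t, of a "x \<bullet> a" 0] by (simp add: B)
  qed
  have S2: "S\<^sup>2 \<le> 4 * A * D"
    unfolding S_def A_def D_def by (rule nn_integral_double_prod_square_le) simp_all
  have "(\<integral>\<^sup>+x. ennreal ((\<phi> x)^4) \<partial>lborel) \<le> (\<integral>\<^sup>+x. S * ennreal ((\<phi> x)\<^sup>2) \<partial>lborel)"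
  proof (rule nn_integral_mono)
    fix x
    have "ennreal ((\<phi> x)^4) = ennreal ((\<phi> x)\<^sup>2) * ennreal ((\<phi> x)\<^sup>2)"
      by (rule ennreal_power4)
    also have "\<dots> \<le> S * ennreal ((\<phi> x)\<^sup>2)" by (intro mult_right_mono S) simp
    finally show "ennreal ((\<phi> x)^4) \<le> S * ennreal ((\<phi> x)\<^sup>2)" .
  qed
  also have "\<dots> = S * A" unfolding A_def by (rule nn_integral_cmult) simp
  finally have "(\<integral>\<^sup>+x. ennreal ((\<phi> x)^4) \<partial>lborel)\<^sup>2 \<le> (S * A)\<^sup>2" by (intro power_mono) auto
  also have "\<dots> = S\<^sup>2 * A\<^sup>2" by (simp add: power_mult_distrib)
  also have "\<dots> \<le> 4 * A * D * A\<^sup>2" by (intro mult_right_mono S2) simp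
  also have "\<dots> = 4 * A^3 * D" by (simp add: power2_eq_square power3_eq_cube ac_simps)
  finally show ?thesis unfolding A_def D_def .
qed

lemma Ladyzhenskaya_dim2:
  fixes \<phi> :: "'a::euclidean_space \<Rightarrow> real"
  assumes t: "test_fun \<Omega> \<phi>" and B: "Basis = {a, b::'a}" "a \<noteq> b"
  shows "(\<integral>\<^sup>+x. ennreal ((\<phi> x)^4) \<partial>lborel)\<^sup>2
    \<le> 16 * (\<integral>\<^sup>+x. ennreal ((\<phi> x)\<^sup>2) \<partial>lborel)\<^sup>2 * (\<integral>\<^sup>+x. ennreal ((dderiv a \<phi> x)\<^sup>2) \<partial>lborel)
      * (\<integral>\<^sup>+x. ennreal ((dderiv b \<phi> x)\<^sup>2) \<partial>lborel)"
proof -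
  have m[measurable]: "\<phi> \<in> borel_measurable borel" "dderiv v \<phi> \<in> borel_measurable borel" for v
    using ccont_borel[OF test_fun_ccont[OF t]] ccont_borel[OF ccont_dderiv[OF t, of v]] .
  define K where "K v x = ennreal (2 * \<bar>\<phi> x * dderiv v \<phi> x\<bar>)" for v x
  have K[measurable]: "K v \<in> borel_measurable borel" for v unfolding K_def by simp
  define A where "A = (\<integral>\<^sup>+x. ennreal ((\<phi> x)\<^sup>2) \<partial>lborel)"
  define D where "D v = (\<integral>\<^sup>+x. ennreal ((dderiv v \<phi> x)\<^sup>2) \<partial>lborel)" for v
  define P where "P y = (\<integral>\<^sup>+x. K a (x *\<^sub>R a + y *\<^sub>R b) \<partial>lborel)" for y
  define Q where "Q x = (\<integral>\<^sup>+y. K b (y *\<^sub>R b + x *\<^sub>R a) \<partial>lborel)" for x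
  have PQm[measurable]: "P \<in> borel_measurable borel" "Q \<in> borel_measurable borel"
    unfolding P_def Q_def by measurable
  have P: "ennreal ((\<phi> (x *\<^sub>R a + y *\<^sub>R b))\<^sup>2) \<le> P y" for x y
    unfolding P_def K_def by (rule line_square_le[OF t]) (simp add: B)
  have Q: "ennreal ((\<phi> (x *\<^sub>R a + y *\<^sub>R b))\<^sup>2) \<le> Q x" for x y
    unfolding Q_def K_def using line_square_le[OF t, of b y "x *\<^sub>R a"] by (simp add: B add.commute)
  have KS: "(\<integral>\<^sup>+x. K v x \<partial>lborel)\<^sup>2 \<le> 4 * A * D v" for v
    unfolding K_def A_def D_def by (rule nn_integral_double_prod_square_le) simp_all
  have "(\<integral>\<^sup>+x. ennreal ((\<phi> x)^4) \<partial>lborel)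
      = (\<integral>\<^sup>+y. \<integral>\<^sup>+x. ennreal ((\<phi> (x *\<^sub>R a + y *\<^sub>R b))^4) \<partial>lborel \<partial>lborel)"
    by (rule nn_integral_basis2[OF B]) simp
  also have "\<dots> \<le> (\<integral>\<^sup>+y. \<integral>\<^sup>+x. P y * Q x \<partial>lborel \<partial>lborel)"
  proof (intro nn_integral_mono)
    fix y x
    have "ennreal ((\<phi> (x *\<^sub>R a + y *\<^sub>R b))^4)
        = ennreal ((\<phi> (x *\<^sub>R a + y *\<^sub>R b))\<^sup>2) * ennreal ((\<phi> (x *\<^sub>R a + y *\<^sub>R b))\<^sup>2)"
      by (rule ennreal_power4)
    also have "\<dots> \<le> P y * Q x" by (intro mult_mono P Q) simp_all
    finally show "ennreal ((\<phi> (x *\<^sub>R a + y *\<^sub>R b))^4) \<le> P y * Q x" .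
  qed
  also have "\<dots> = (\<integral>\<^sup>+y. P y \<partial>lborel) * (\<integral>\<^sup>+x. Q x \<partial>lborel)"
    by (subst nn_integral_cmult, simp) (subst nn_integral_multc, simp_all)
  also have "(\<integral>\<^sup>+y. P y \<partial>lborel) = (\<integral>\<^sup>+x. K a x \<partial>lborel)"
    unfolding P_def by (rule nn_integral_basis2[OF B, symmetric]) simp
  also have "(\<integral>\<^sup>+x. Q x \<partial>lborel) = (\<integral>\<^sup>+x. K b x \<partial>lborel)"
    unfolding Q_def by (rule nn_integral_basis2[symmetric]) (use B in auto)
  finally have "(\<integral>\<^sup>+x. ennreal ((\<phi> x)^4) \<partial>lborel)\<^sup>2 \<le> ((\<integral>\<^sup>+x. K a x \<partial>lborel) * (\<integral>\<^sup>+x. K b x \<partial>lborel))\<^sup>2"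
    by (intro power_mono) auto
  also have "\<dots> = (\<integral>\<^sup>+x. K a x \<partial>lborel)\<^sup>2 * (\<integral>\<^sup>+x. K b x \<partial>lborel)\<^sup>2" by (simp add: power_mult_distrib)
  also have "\<dots> \<le> (4 * A * D a) * (4 * A * D b)" by (intro mult_mono KS) auto
  also have "\<dots> = (4 * 4) * A\<^sup>2 * D a * D b" by (simp only: power2_eq_square ac_simps)
  finally show ?thesis unfolding A_def D_def by simp
qed

text \<open>With the third coordinate z frozen, the planar argument bounds the slice integral by R a
  z * R b z. Cauchy-Schwarz on the slice estimates each factor by the slice mass
  \<open>\<alpha> z\<close> times a slice gradient; the mass is at most \<open>S\<close> for every
  z, by line integrals in the third direction. Integration over z then restores the full
  gradients.\<close>

lemma Ladyzhenskaya_dim3: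
  fixes \<phi> :: "'a::euclidean_space \<Rightarrow> real"
  assumes t: "test_fun \<Omega> \<phi>" and B: "Basis = {a, b, c::'a}" "a \<noteq> b" "a \<noteq> c" "b \<noteq> c"
  shows "(\<integral>\<^sup>+x. ennreal ((\<phi> x)^4) \<partial>lborel)\<^sup>2
    \<le> 64 * (\<integral>\<^sup>+x. ennreal ((\<phi> x)\<^sup>2) \<partial>lborel) * (\<integral>\<^sup>+x. ennreal ((dderiv a \<phi> x)\<^sup>2) \<partial>lborel)
      * (\<integral>\<^sup>+x. ennreal ((dderiv b \<phi> x)\<^sup>2) \<partial>lborel) * (\<integral>\<^sup>+x. ennreal ((dderiv c \<phi> x)\<^sup>2) \<partial>lborel)"
proof -
  have m[measurable]: "\<phi> \<in> borel_measurable borel" "dderiv v \<phi> \<in> borel_measurable borel" for v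
    using ccont_borel[OF test_fun_ccont[OF t]] ccont_borel[OF ccont_dderiv[OF t, of v]] .
  define K where "K v x = ennreal (2 * \<bar>\<phi> x * dderiv v \<phi> x\<bar>)" for v x
  have K[measurable]: "K v \<in> borel_measurable borel" for v unfolding K_def by simp
  define A where "A = (\<integral>\<^sup>+x. ennreal ((\<phi> x)\<^sup>2) \<partial>lborel)"
  define D where "D v = (\<integral>\<^sup>+x. ennreal ((dderiv v \<phi> x)\<^sup>2) \<partial>lborel)" for v
  define pt where "pt x y z = x *\<^sub>R a + y *\<^sub>R b + z *\<^sub>R c" for x y z :: real
  have pt[measurable]: "(\<lambda>p. pt (f p) (g p) (h p)) \<in> borel_measurable N"
    if "f \<in> borel_measurable N" "g \<in> borel_measurable N" "h \<in> borel_measurable N" for f g h and N :: "'n measure"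
    using that unfolding pt_def by measurable
  have int3: "(\<integral>\<^sup>+x. h x \<partial>lborel) = (\<integral>\<^sup>+z. \<integral>\<^sup>+y. \<integral>\<^sup>+x. h (pt x y z) \<partial>lborel \<partial>lborel \<partial>lborel)"
    if "h \<in> borel_measurable borel" for h :: "'a \<Rightarrow> ennreal"
    unfolding pt_def by (rule nn_integral_basis3[OF B that])
  define P where "P y z = (\<integral>\<^sup>+x. K a (pt x y z) \<partial>lborel)" for y z
  define Q where "Q x z = (\<integral>\<^sup>+y. K b (pt x y z) \<partial>lborel)" for x z
  define S where "S = (\<integral>\<^sup>+x. K c x \<partial>lborel)"
  define \<alpha> where "\<alpha> z = (\<integral>\<^sup>+y. \<integral>\<^sup>+x. ennreal ((\<phi> (pt x y z))\<^sup>2) \<partial>lborel \<partial>lborel)" for z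
  define \<delta> where "\<delta> v z = (\<integral>\<^sup>+y. \<integral>\<^sup>+x. ennreal ((dderiv v \<phi> (pt x y z))\<^sup>2) \<partial>lborel \<partial>lborel)" for v z
  define R where "R v z = (\<integral>\<^sup>+y. \<integral>\<^sup>+x. K v (pt x y z) \<partial>lborel \<partial>lborel)" for v z
  have [measurable]: "(\<lambda>y. P y z) \<in> borel_measurable borel" "(\<lambda>x. Q x z) \<in> borel_measurable borel" for z
    unfolding P_def Q_def by measurable
  have Rm[measurable]: "R v \<in> borel_measurable borel" and dm[measurable]: "\<delta> v \<in> borel_measurable borel" for v
    unfolding R_def \<delta>_def by measurable
  have P: "ennreal ((\<phi> (pt x y z))\<^sup>2) \<le> P y z" for x y z
    unfolding P_def K_def pt_def
    using line_square_le[OF t, of a x "y *\<^sub>R b + z *\<^sub>R c"] by (simp add: B add.assoc)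
  have Q: "ennreal ((\<phi> (pt x y z))\<^sup>2) \<le> Q x z" for x y z
    unfolding Q_def K_def pt_def
    using line_square_le[OF t, of b y "x *\<^sub>R a + z *\<^sub>R c"] by (simp add: B ac_simps)
  have T: "ennreal ((\<phi> (pt x y z))\<^sup>2) \<le> (\<integral>\<^sup>+s. K c (pt x y s) \<partial>lborel)" for x y z
    unfolding K_def pt_def
    using line_square_le[OF t, of c z "x *\<^sub>R a + y *\<^sub>R b"] by (simp add: B ac_simps)
  have "\<alpha> z \<le> (\<integral>\<^sup>+y. \<integral>\<^sup>+x. \<integral>\<^sup>+s. K c (pt x y s) \<partial>lborel \<partial>lborel \<partial>lborel)" for z
    unfolding \<alpha>_def by (intro nn_integral_mono T)
  moreover have "(\<integral>\<^sup>+y. \<integral>\<^sup>+x. \<integral>\<^sup>+s. K c (pt x y s) \<partial>lborel \<partial>lborel \<partial>lborel) = S"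
  proof -
    have B': "Basis = {c, a, b}" "c \<noteq> a" "c \<noteq> b" "a \<noteq> b" using B by auto
    show ?thesis
      unfolding S_def using nn_integral_basis3[OF B' K, of c] by (simp add: pt_def ac_simps)
  qed
  ultimately have \<alpha>: "\<alpha> z \<le> S" for z by simp
  have S2: "S\<^sup>2 \<le> 4 * A * D c"
    unfolding S_def K_def A_def D_def by (rule nn_integral_double_prod_square_le) simp_all
  have R2: "(R v z)\<^sup>2 \<le> 4 * S * \<delta> v z" for v z
  proof -
    have "(R v z)\<^sup>2 \<le> 4 * \<alpha> z * \<delta> v z"
      unfolding R_def K_def \<alpha>_def \<delta>_def
      by (rule iterated_double_prod_square_le) measurable
    also have "\<dots> \<le> 4 * S * \<delta> v z" by (intro mult_left_mono mult_right_mono \<alpha>) auto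
    finally show ?thesis .
  qed
  have D: "(\<integral>\<^sup>+z. \<delta> v z \<partial>lborel) = D v" for v
    unfolding D_def \<delta>_def by (rule int3[symmetric]) simp
  have RR: "(\<integral>\<^sup>+z. (R v z)\<^sup>2 \<partial>lborel) \<le> 4 * S * D v" for v
  proof -
    have "(\<integral>\<^sup>+z. (R v z)\<^sup>2 \<partial>lborel) \<le> (\<integral>\<^sup>+z. 4 * S * \<delta> v z \<partial>lborel)"
      by (intro nn_integral_mono R2)
    also have "\<dots> = 4 * S * D v" unfolding D[symmetric] by (rule nn_integral_cmult) simp
    finally show ?thesis .
  qed
  have "(\<integral>\<^sup>+x. ennreal ((\<phi> x)^4) \<partial>lborel)
      = (\<integral>\<^sup>+z. \<integral>\<^sup>+y. \<integral>\<^sup>+x. ennreal ((\<phi> (pt x y z))^4) \<partial>lborel \<partial>lborel \<partial>lborel)"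
    by (rule int3) simp
  also have "\<dots> \<le> (\<integral>\<^sup>+z. \<integral>\<^sup>+y. \<integral>\<^sup>+x. P y z * Q x z \<partial>lborel \<partial>lborel \<partial>lborel)"
  proof (intro nn_integral_mono)
    fix z y x
    have "ennreal ((\<phi> (pt x y z))^4) = ennreal ((\<phi> (pt x y z))\<^sup>2) * ennreal ((\<phi> (pt x y z))\<^sup>2)"
      by (rule ennreal_power4)
    also have "\<dots> \<le> P y z * Q x z" by (intro mult_mono P Q) simp_all
    finally show "ennreal ((\<phi> (pt x y z))^4) \<le> P y z * Q x z" .
  qed
  also have "\<dots> = (\<integral>\<^sup>+z. (\<integral>\<^sup>+y. P y z \<partial>lborel) * (\<integral>\<^sup>+x. Q x z \<partial>lborel) \<partial>lborel)"
    by (subst nn_integral_cmult, simp) (subst nn_integral_multc, simp_all)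
  also have "\<dots> = (\<integral>\<^sup>+z. R a z * R b z \<partial>lborel)"
  proof -
    have "(\<integral>\<^sup>+x. Q x z \<partial>lborel) = R b z" for z
      unfolding Q_def R_def by (rule lborel_pair.Fubini') measurable
    then show ?thesis by (simp add: P_def R_def)
  qed
  finally have "(\<integral>\<^sup>+x. ennreal ((\<phi> x)^4) \<partial>lborel)\<^sup>2 \<le> (\<integral>\<^sup>+z. R a z * R b z \<partial>lborel)\<^sup>2"
    by (intro power_mono) auto
  also have "\<dots> \<le> (\<integral>\<^sup>+z. (R a z)\<^sup>2 \<partial>lborel) * (\<integral>\<^sup>+z. (R b z)\<^sup>2 \<partial>lborel)"
    by (rule Cauchy_Schwarz_nn_integral) simp_all
  also have "\<dots> \<le> (4 * S * D a) * (4 * S * D b)" by (intro mult_mono RR) auto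
  also have "\<dots> = (4 * 4) * D a * D b * S\<^sup>2" by (simp only: power2_eq_square ac_simps)
  also have "\<dots> \<le> (4 * 4) * D a * D b * (4 * A * D c)" by (intro mult_left_mono S2) simp
  also have "\<dots> = (4 * 4 * 4) * A * D a * D b * D c" by (simp only: ac_simps)
  finally show ?thesis unfolding A_def D_def by simp
qed

locale low_dim = bounded_open \<Omega> for \<Omega> :: "'a::euclidean_space set" +
  assumes dim: "DIM('a) \<in> {1, 2, 3}"
begin

text \<open>A common weaker form of the three estimates: one factor \<open>A\<close> is kept apart,
  since it will carry the convergence to 0, and everything else is absorbed into the squared H1
  norm. The constants are 4, 16 and 64, hence 64.\<close>

lemma Gagliardo_Nirenberg_lborel:
  fixes \<phi> :: "'a \<Rightarrow> real"
  assumes t: "test_fun \<Omega> \<phi>"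
  defines "A \<equiv> (\<integral>\<^sup>+x. ennreal ((\<phi> x)\<^sup>2) \<partial>lborel)"
    and "D \<equiv> (\<lambda>b. \<integral>\<^sup>+x. ennreal ((dderiv b \<phi> x)\<^sup>2) \<partial>lborel)"
  shows "(\<integral>\<^sup>+x. ennreal ((\<phi> x)^4) \<partial>lborel)\<^sup>2 \<le> 64 * A * (A + (\<Sum>b\<in>Basis. D b))^3"
proof -
  define N where "N = A + (\<Sum>b\<in>Basis. D b)"
  have AN: "A \<le> N" by (simp add: N_def)
  have DN: "D b \<le> N" if "b \<in> Basis" for b
  proof -
    have "D b \<le> (\<Sum>b\<in>Basis. D b)" using that by (intro member_le_sum) auto
    also have "\<dots> \<le> N" by (simp add: N_def)
    finally show ?thesis .
  qed
  have c64: "(4::ennreal) \<le> 64" "(16::ennreal) \<le> 64" by simp_all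
  consider "card (Basis :: 'a set) = 1" | "card (Basis :: 'a set) = 2" | "card (Basis :: 'a set) = 3"
    using dim by auto
  then have "(\<integral>\<^sup>+x. ennreal ((\<phi> x)^4) \<partial>lborel)\<^sup>2 \<le> 64 * A * N^3"
  proof cases
    case 1
    then obtain a where B: "Basis = {a::'a}" by (rule card_1_singletonE)
    have "(\<integral>\<^sup>+x. ennreal ((\<phi> x)^4) \<partial>lborel)\<^sup>2 \<le> 4 * A^3 * D a"
      unfolding A_def D_def by (rule Ladyzhenskaya_dim1[OF t B])
    also have "\<dots> = 4 * (A * (A * A * D a))" by (simp add: power3_eq_cube ac_simps)
    also have "\<dots> \<le> 64 * (A * (N * N * N))"
      using DN[of a] B by (intro mult_mono c64 AN) auto
    finally show ?thesis by (simp add: power3_eq_cube ac_simps)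
  next
    case 2
    then obtain a b where B: "Basis = {a, b::'a}" "a \<noteq> b" by (auto simp: card_2_iff)
    have "(\<integral>\<^sup>+x. ennreal ((\<phi> x)^4) \<partial>lborel)\<^sup>2 \<le> 16 * A\<^sup>2 * D a * D b"
      unfolding A_def D_def by (rule Ladyzhenskaya_dim2[OF t B])
    also have "\<dots> = 16 * (A * (A * D a * D b))" by (simp add: power2_eq_square ac_simps)
    also have "\<dots> \<le> 64 * (A * (N * N * N))"
      using DN[of a] DN[of b] B by (intro mult_mono c64 AN) auto
    finally show ?thesis by (simp add: power3_eq_cube ac_simps)
  next
    case 3
    then obtain a b c where B: "Basis = {a, b, c::'a}" "a \<noteq> b" "a \<noteq> c" "b \<noteq> c" by (auto simp: card_3_iff)
    have "(\<integral>\<^sup>+x. ennreal ((\<phi> x)^4) \<partial>lborel)\<^sup>2 \<le> 64 * A * D a * D b * D c"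
      unfolding A_def D_def by (rule Ladyzhenskaya_dim3[OF t B])
    also have "\<dots> = 64 * (A * (D a * D b * D c))" by (simp add: ac_simps)
    also have "\<dots> \<le> 64 * (A * (N * N * N))"
      using DN[of a] DN[of b] DN[of c] B by (intro mult_mono order_refl) auto
    finally show ?thesis by (simp add: power3_eq_cube ac_simps)
  qed
  then show ?thesis by (simp add: N_def)
qed

end

context bounded_open
begin

lemma nn_integral_lborel_eq_dom:
  assumes "ccont h" "\<And>x. 0 \<le> h x" "\<And>x. x \<notin> \<Omega> \<Longrightarrow> h x = 0"
  shows "(\<integral>\<^sup>+x. ennreal (h x) \<partial>lborel) = ennreal (\<integral>x. h x \<partial>M)"
proof -
  have "(\<integral>\<^sup>+x. ennreal (h x) \<partial>lborel) = ennreal (\<integral>x. h x \<partial>lborel)"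
    using assms(2) by (intro nn_integral_eq_integral ccont_integrable assms(1)) auto
  then show ?thesis
    using integral_dom_eq_lborel[OF ccont_borel[OF assms(1)] assms(3)] by simp
qed

lemma nsq_test:
  assumes t: "test_fun \<Omega> \<phi>"
  shows "nsq \<phi> = (\<integral>x. (\<phi> x)\<^sup>2 \<partial>M) + (\<Sum>b\<in>Basis. \<integral>x. (dderiv b \<phi> x)\<^sup>2 \<partial>M)"
proof -
  have "(\<integral>x. (grad \<Omega> \<phi> x \<bullet> i)\<^sup>2 \<partial>M) = (\<integral>x. (dderiv i \<phi> x)\<^sup>2 \<partial>M)" if i: "i \<in> Basis" for i
  proof (rule integral_cong_AE)
    show "AE x in M. (grad \<Omega> \<phi> x \<bullet> i)\<^sup>2 = (dderiv i \<phi> x)\<^sup>2"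
      using grad_AE_eq[OF H1_test[OF t] weak_grad_test[OF t]] by eventually_elim (simp add: i)
  qed (use grad_sqint[OF H1_test[OF t] i] test_dderiv_sqint[OF t, of i] in \<open>auto simp: sqint_def\<close>)
  then show ?thesis using H1_test[OF t] by (simp add: nsq_eq norm_grad_expand)
qed

lemma frm_tendsto:
  assumes W: "weight W" and u: "\<And>n. adm W (u n)" "adm W u0" "(\<lambda>n. frm W (\<lambda>x. u n x - u0 x) (\<lambda>x. u n x - u0 x)) \<longlonglongrightarrow> 0"
    and v: "\<And>n. adm W (v n)" "adm W v0" "(\<lambda>n. frm W (\<lambda>x. v n x - v0 x) (\<lambda>x. v n x - v0 x)) \<longlonglongrightarrow> 0"
  shows "(\<lambda>n. frm W (u n) (v n)) \<longlonglongrightarrow> frm W u0 v0"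
proof -
  define a b where "a n = (\<lambda>x. u n x - u0 x)" and "b n = (\<lambda>x. v n x - v0 x)" for n
  have ab: "adm W (a n)" "adm W (b n)" for n
    using adm_lincomb[OF u(1)[of n] u(2), of 1 "-1"] adm_lincomb[OF v(1)[of n] v(2), of 1 "-1"] by (simp_all add: a_def b_def)
  have a0: "(\<lambda>n. sqrt (frm W (a n) (a n))) \<longlonglongrightarrow> 0" and b0: "(\<lambda>n. sqrt (frm W (b n) (b n))) \<longlonglongrightarrow> 0"
    using tendsto_real_sqrt[OF u(3)] tendsto_real_sqrt[OF v(3)] by (simp_all add: a_def b_def)
  have e: "frm W (u n) (v n) = frm W (a n) (b n) + frm W (a n) v0 + frm W u0 (b n) + frm W u0 v0" for n
    using frm_lincomb_left[OF W ab(1)[of n] u(2) v(1)[of n], of 1 1]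
      frm_lincomb_right[OF W ab(2)[of n] v(2) ab(1)[of n], of 1 1]
      frm_lincomb_right[OF W ab(2)[of n] v(2) u(2), of 1 1]
    by (simp add: a_def b_def)
  have "(\<lambda>n. frm W (a n) (b n)) \<longlonglongrightarrow> 0"
  proof (rule Lim_null_comparison)
    show "(\<lambda>n. sqrt (frm W (a n) (a n)) * sqrt (frm W (b n) (b n))) \<longlonglongrightarrow> 0"
      using tendsto_mult[OF a0 b0] by simp
  qed (use frm_Cauchy_Schwarz_sqrt[OF W ab] in \<open>auto intro!: always_eventually\<close>)
  moreover have "(\<lambda>n. frm W (a n) v0) \<longlonglongrightarrow> 0"
  proof (rule Lim_null_comparison)
    show "(\<lambda>n. sqrt (frm W (a n) (a n)) * sqrt (frm W v0 v0)) \<longlonglongrightarrow> 0"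
      using tendsto_mult[OF a0 tendsto_const] by simp
  qed (use frm_Cauchy_Schwarz_sqrt[OF W ab(1) v(2)] in \<open>auto intro!: always_eventually\<close>)
  moreover have "(\<lambda>n. frm W u0 (b n)) \<longlonglongrightarrow> 0"
  proof (rule Lim_null_comparison)
    show "(\<lambda>n. sqrt (frm W u0 u0) * sqrt (frm W (b n) (b n))) \<longlonglongrightarrow> 0"
      using tendsto_mult[OF tendsto_const b0] by simp
  qed (use frm_Cauchy_Schwarz_sqrt[OF W u(2) ab(2)] in \<open>auto intro!: always_eventually\<close>)
  ultimately have "(\<lambda>n. frm W (a n) (b n) + frm W (a n) v0 + frm W u0 (b n) + frm W u0 v0) \<longlonglongrightarrow> 0 + 0 + 0 + frm W u0 v0"
    by (intro tendsto_intros)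
  then show ?thesis unfolding e by simp
qed

lemma nsq_tendsto_imp_L2_tendsto:
  assumes "\<And>n. H1 \<Omega> (u n)" "H1 \<Omega> u0" "(\<lambda>n. nsq (\<lambda>x. u n x - u0 x)) \<longlonglongrightarrow> 0"
  shows "(\<lambda>n. \<integral>x. (u n x - u0 x)\<^sup>2 \<partial>M) \<longlonglongrightarrow> 0"
  by (rule tendsto_sandwich[OF _ _ tendsto_const assms(3)])
     (auto intro!: always_eventually L2_le_nsq H1_diff assms)

end

context low_dim
begin

lemma Gagliardo_Nirenberg_test:
  assumes t: "test_fun \<Omega> \<phi>"
  shows "(\<integral>x. (\<phi> x)^4 \<partial>M)\<^sup>2 \<le> 64 * (\<integral>x. (\<phi> x)\<^sup>2 \<partial>M) * (nsq \<phi>)^3"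
proof -
  note c = test_fun_ccont[OF t]
  have d: "ccont (dderiv b \<phi>)" "x \<notin> \<Omega> \<Longrightarrow> dderiv b \<phi> x = 0" if "b \<in> Basis" for b x
    using test_fun_ccont test_fun_zero test_fun_dderiv[OF t that] by blast+
  have e4: "(\<integral>\<^sup>+x. ennreal ((\<phi> x)^4) \<partial>lborel) = ennreal (\<integral>x. (\<phi> x)^4 \<partial>M)"
    using test_fun_zero[OF t] by (intro nn_integral_lborel_eq_dom ccont_power c) auto
  have e2: "(\<integral>\<^sup>+x. ennreal ((\<phi> x)\<^sup>2) \<partial>lborel) = ennreal (\<integral>x. (\<phi> x)\<^sup>2 \<partial>M)"
    using test_fun_zero[OF t] by (intro nn_integral_lborel_eq_dom ccont_power c) auto
  have ed: "(\<integral>\<^sup>+x. ennreal ((dderiv b \<phi> x)\<^sup>2) \<partial>lborel) = ennreal (\<integral>x. (dderiv b \<phi> x)\<^sup>2 \<partial>M)" if "b \<in> Basis" for b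
    using d(2)[OF that] by (intro nn_integral_lborel_eq_dom ccont_power d(1)[OF that]) auto
  have "ennreal ((\<integral>x. (\<phi> x)^4 \<partial>M)\<^sup>2) \<le> 64 * ennreal (\<integral>x. (\<phi> x)\<^sup>2 \<partial>M) * (ennreal (\<integral>x. (\<phi> x)\<^sup>2 \<partial>M) + (\<Sum>b\<in>Basis. ennreal (\<integral>x. (dderiv b \<phi> x)\<^sup>2 \<partial>M)))^3"
    using Gagliardo_Nirenberg_lborel[OF t] by (simp add: e4 e2 ed ennreal_power[symmetric])
  also have "ennreal (\<integral>x. (\<phi> x)\<^sup>2 \<partial>M) + (\<Sum>b\<in>Basis. ennreal (\<integral>x. (dderiv b \<phi> x)\<^sup>2 \<partial>M)) = ennreal (nsq \<phi>)"
    unfolding nsq_test[OF t] by (simp add: ennreal_plus sum_nonneg)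
  also have "64 * ennreal (\<integral>x. (\<phi> x)\<^sup>2 \<partial>M) * (ennreal (nsq \<phi>))^3 = ennreal (64 * (\<integral>x. (\<phi> x)\<^sup>2 \<partial>M) * (nsq \<phi>)^3)"
    using frm_nonneg[OF weight_one, of \<phi>] by (simp add: ennreal_mult ennreal_power)
  finally show ?thesis
    using frm_nonneg[OF weight_one, of \<phi>] by (simp add: ennreal_le_iff)
qed

text \<open>By density. The right-hand side is continuous in H1; for the left-hand side lower
  semicontinuity along an almost everywhere convergent subsequence suffices, and it also yields that
  \<open>u\<close> lies in L4.\<close>

lemma Gagliardo_Nirenberg:
  assumes u: "u \<in> H10 \<Omega>"
  shows "qint M u" and "(\<integral>x. (u x)^4 \<partial>M) \<le> sqrt (64 * (\<integral>x. (u x)\<^sup>2 \<partial>M) * (nsq u)^3)"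
proof -
  note hu = H10_H1[OF u]
  obtain \<phi> where p: "\<And>k. test_fun \<Omega> (\<phi> k)" "(\<lambda>k. nsq (\<lambda>x. \<phi> k x - u x)) \<longlonglongrightarrow> 0"
    using u unfolding H10_iff by blast
  note hp = H1_test[OF p(1)]
  note l2 = nsq_tendsto_imp_L2_tendsto[OF hp hu p(2)]
  obtain r where r: "strict_mono (r :: nat \<Rightarrow> nat)" "AE x in M. (\<lambda>n. \<phi> (r n) x) \<longlonglongrightarrow> u x"
    by (rule L2_tendsto_AE_subseq[OF H1_sqint[OF hp] H1_sqint[OF hu] l2])
  have "(\<lambda>n. \<integral>x. \<phi> n x * \<phi> n x \<partial>M) \<longlonglongrightarrow> (\<integral>x. u x * u x \<partial>M)"
    by (rule integral_mult_tendsto[OF H1_sqint[OF hp] H1_sqint[OF hu] l2 H1_sqint[OF hp] H1_sqint[OF hu] l2])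
  moreover have "(\<lambda>n. nsq (\<phi> n)) \<longlonglongrightarrow> nsq u"
    by (rule frm_tendsto[OF weight_one]) (simp_all add: adm_one hp hu p(2))
  ultimately have "(\<lambda>n. sqrt (64 * (\<integral>x. (\<phi> n x)\<^sup>2 \<partial>M) * (nsq (\<phi> n))^3)) \<longlonglongrightarrow> sqrt (64 * (\<integral>x. (u x)\<^sup>2 \<partial>M) * (nsq u)^3)"
    unfolding power2_eq_square by (intro tendsto_intros)
  from LIMSEQ_subseq_LIMSEQ[OF this r(1)]
  have lim: "(\<lambda>n. sqrt (64 * (\<integral>x. (\<phi> (r n) x)\<^sup>2 \<partial>M) * (nsq (\<phi> (r n)))^3)) \<longlonglongrightarrow> sqrt (64 * (\<integral>x. (u x)\<^sup>2 \<partial>M) * (nsq u)^3)"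
    by (simp add: o_def)
  have ae: "AE x in M. (\<lambda>n. (\<phi> (r n) x)^4) \<longlonglongrightarrow> (u x)^4"
    using r(2) by eventually_elim (intro tendsto_power)
  have um: "u \<in> borel_measurable M" using H1_sqint[OF hu] by (rule sqint_meas)
  have le: "(\<integral>x. (\<phi> (r n) x)^4 \<partial>M) \<le> sqrt (64 * (\<integral>x. (\<phi> (r n) x)\<^sup>2 \<partial>M) * (nsq (\<phi> (r n)))^3)" for n
    by (rule real_le_rsqrt) (rule Gagliardo_Nirenberg_test[OF p(1)])
  have int: "integrable M (\<lambda>x. (\<phi> (r n) x)^4)" for n
    by (intro integrable_dom ccont_integrable ccont_power test_fun_ccont[OF p(1)]) simp
  have um4: "(\<lambda>x. (u x)^4) \<in> borel_measurable M" using um by simp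
  note F = integral_Fatou_bound[OF int _ _ um4 ae le lim]
  show "qint M u" unfolding qint_def using um F(1) by simp
  show "(\<integral>x. (u x)^4 \<partial>M) \<le> sqrt (64 * (\<integral>x. (u x)\<^sup>2 \<partial>M) * (nsq u)^3)" using F(2) by simp
qed

text \<open>The single L2 factor of the inequality carries the convergence while the H1 bound
  controls the rest. This is the interpolation that upgrades L2 smallness to L4 smallness.\<close>

lemma nsq_tendsto_imp_L4_tendsto:
  assumes "\<And>n. u n \<in> H10 \<Omega>" "(\<lambda>n. \<integral>x. (u n x)\<^sup>2 \<partial>M) \<longlonglongrightarrow> 0" "\<And>n. nsq (u n) \<le> K"
  shows "(\<lambda>n. \<integral>x. (u n x)^4 \<partial>M) \<longlonglongrightarrow> 0"
proof (rule tendsto_sandwich[OF _ _ tendsto_const])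
  have "(\<lambda>n. sqrt (64 * (\<integral>x. (u n x)\<^sup>2 \<partial>M) * K^3)) \<longlonglongrightarrow> sqrt (64 * 0 * K^3)"
    by (intro tendsto_intros assms(2))
  then show "(\<lambda>n. sqrt (64 * (\<integral>x. (u n x)\<^sup>2 \<partial>M) * K^3)) \<longlonglongrightarrow> 0" by simp
  have "(\<integral>x. (u n x)^4 \<partial>M) \<le> sqrt (64 * (\<integral>x. (u n x)\<^sup>2 \<partial>M) * K^3)" for n
    by (rule order_trans[OF Gagliardo_Nirenberg(2)[OF assms(1)]])
       (intro real_sqrt_le_mono mult_left_mono power_mono assms frm_nonneg[OF weight_one], simp)
  then show "\<forall>\<^sub>F n in sequentially. (\<integral>x. (u n x)^4 \<partial>M) \<le> sqrt (64 * (\<integral>x. (u n x)\<^sup>2 \<partial>M) * K^3)" by simp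
qed (auto intro!: always_eventually)

end

section \<open>Rellich's theorem by averaging over small balls\<close>

section \<open>Rellich compactness\<close>

lemma nn_integral_translate:
  fixes f :: "'a::euclidean_space \<Rightarrow> ennreal"
  assumes "f \<in> borel_measurable borel"
  shows "(\<integral>\<^sup>+x. f (x + c) \<partial>lborel) = (\<integral>\<^sup>+x. f x \<partial>lborel)"
proof -
  have "(\<integral>\<^sup>+x. f x \<partial>lborel) = (\<integral>\<^sup>+x. f x \<partial>distr lborel borel ((+) c))"
    by (simp add: lborel_distr_plus)
  also have "\<dots> = (\<integral>\<^sup>+x. f (c + x) \<partial>lborel)"
    using assms by (intro nn_integral_distr) auto
  finally show ?thesis by (simp add: add.commute)
qed

lemma ccont_translate:
  fixes f :: "'a::euclidean_space \<Rightarrow> real"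
  assumes "ccont f" shows "ccont (\<lambda>h. f (x + h))"
proof -
  obtain K where K: "compact K" "\<forall>x. x \<notin> K \<longrightarrow> f x = 0" using assms by (auto simp: ccont_def)
  have "continuous_on UNIV (\<lambda>h. f (x + h))"
    by (rule continuous_on_compose2[OF ccont_cont[OF assms]]) (auto intro!: continuous_intros)
  moreover have "compact ((+) (- x) ` K)" using compact_translation[OF K(1)] .
  moreover have "\<forall>h. h \<notin> (+) (- x) ` K \<longrightarrow> f (x + h) = 0"
  proof (intro allI impI)
    fix h assume "h \<notin> (+) (- x) ` K"
    then have "x + h \<notin> K" by (metis add_minus_cancel image_eqI minus_add_cancel)
    then show "f (x + h) = 0" using K(2) by blast
  qed
  ultimately show ?thesis unfolding ccont_def by blast
qed

definition grad_sq :: "('a::euclidean_space \<Rightarrow> real) \<Rightarrow> real" where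
  "grad_sq \<phi> = (\<Sum>b\<in>Basis. \<integral>x. (dderiv b \<phi> x)\<^sup>2 \<partial>lborel)"

lemma grad_sq_nonneg: "0 \<le> grad_sq \<phi>"
  by (simp add: grad_sq_def sum_nonneg)

lemma integral_dderiv_square_le:
  assumes t: "test_fun \<Omega> \<phi>"
  shows "(\<integral>\<^sup>+x. ennreal ((dderiv v \<phi> x)\<^sup>2) \<partial>lborel) \<le> ennreal ((norm v)\<^sup>2 * grad_sq \<phi>)"
proof -
  note c = ccont_power[OF ccont_dderiv[OF t], of 2]
  have le: "(dderiv v \<phi> x)\<^sup>2 \<le> (norm v)\<^sup>2 * (\<Sum>b\<in>Basis. (dderiv b \<phi> x)\<^sup>2)" for x
  proof -
    have "(dderiv v \<phi> x)\<^sup>2 = (\<Sum>b\<in>Basis. (v \<bullet> b) * dderiv b \<phi> x)\<^sup>2"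
      by (subst dderiv_basis_expansion[OF test_fun_differentiable[OF t]]) simp
    also have "\<dots> \<le> (\<Sum>b\<in>Basis. (v \<bullet> b)\<^sup>2) * (\<Sum>b\<in>Basis. (dderiv b \<phi> x)\<^sup>2)"
      by (rule Cauchy_Schwarz_ineq_sum)
    also have "(\<Sum>b\<in>Basis. (v \<bullet> b)\<^sup>2) = (norm v)\<^sup>2"
      unfolding power2_norm_eq_inner by (subst (2) euclidean_inner) (simp add: power2_eq_square)
    finally show ?thesis .
  qed
  have i: "integrable lborel (\<lambda>x. (dderiv b \<phi> x)\<^sup>2)" for b
    by (rule ccont_integrable[OF c]) simp
  have "(\<integral>x. (dderiv v \<phi> x)\<^sup>2 \<partial>lborel) \<le> (\<integral>x. (norm v)\<^sup>2 * (\<Sum>b\<in>Basis. (dderiv b \<phi> x)\<^sup>2) \<partial>lborel)"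
    using i by (intro integral_mono le) auto
  also have "\<dots> = (norm v)\<^sup>2 * grad_sq \<phi>"
    using i by (simp add: grad_sq_def)
  finally show ?thesis
    using nn_integral_eq_integral[OF i, of v] by (simp add: ennreal_leI)
qed

text \<open>The increment is the integral of the directional derivative along the segment.
  Cauchy-Schwarz on the unit interval, Tonelli and translation invariance reduce it to the
  derivative in direction \<open>h\<close>.\<close>

lemma translation_estimate:
  assumes t: "test_fun \<Omega> \<phi>"
  shows "(\<integral>\<^sup>+x. ennreal ((\<phi> (x + h) - \<phi> x)\<^sup>2) \<partial>lborel) \<le> ennreal ((norm h)\<^sup>2 * grad_sq \<phi>)"
proof -
  have [measurable]: "\<phi> \<in> borel_measurable borel" "dderiv h \<phi> \<in> borel_measurable borel"
    using ccont_borel[OF test_fun_ccont[OF t]] ccont_borel[OF ccont_dderiv[OF t, of h]] .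
  have pw: "ennreal ((\<phi> (x + h) - \<phi> x)\<^sup>2) \<le> (\<integral>\<^sup>+s. indicator {0..1::real} s * ennreal ((dderiv h \<phi> (x + s *\<^sub>R h))\<^sup>2) \<partial>lborel)" for x
  proof -
    have cont: "isCont (\<lambda>s. dderiv h \<phi> (x + s *\<^sub>R h)) s" for s :: real
    proof -
      have "continuous_on UNIV (\<lambda>s::real. dderiv h \<phi> (x + s *\<^sub>R h))"
        by (rule continuous_on_compose2[OF ccont_cont[OF ccont_dderiv[OF t]]]) (auto intro!: continuous_intros)
      then show ?thesis by (simp add: continuous_on_eq_continuous_at)
    qed
    have b: "has_bochner_integral lborel (\<lambda>s. dderiv h \<phi> (x + s *\<^sub>R h) * indicator {0..1::real} s) (\<phi> (x + 1 *\<^sub>R h) - \<phi> (x + 0 *\<^sub>R h))"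
      by (rule has_bochner_integral_FTC_Icc_real[OF _ line_deriv[OF test_fun_differentiable[OF t]] cont]) simp
    have "ennreal \<bar>\<phi> (x + h) - \<phi> x\<bar> = ennreal (norm (\<integral>s. dderiv h \<phi> (x + s *\<^sub>R h) * indicator {0..1::real} s \<partial>lborel))"
      using has_bochner_integral_integral_eq[OF b] by simp
    also have "\<dots> \<le> (\<integral>\<^sup>+s. norm (dderiv h \<phi> (x + s *\<^sub>R h) * indicator {0..1::real} s) \<partial>lborel)"
      by (rule integral_norm_bound_ennreal) (rule integrable.intros[OF b])
    \<comment> \<open>The indicator is doubled so that Cauchy-Schwarz on the whole line can hand one
      copy to each factor; the first factor then integrates to 1.\<close>
    also have "\<dots> = (\<integral>\<^sup>+s. indicator {0..1::real} s * (indicator {0..1::real} s * ennreal \<bar>dderiv h \<phi> (x + s *\<^sub>R h)\<bar>) \<partial>lborel)"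
      by (intro nn_integral_cong) (auto simp: indicator_def)
    finally have "(ennreal \<bar>\<phi> (x + h) - \<phi> x\<bar>)\<^sup>2 \<le> (\<integral>\<^sup>+s. indicator {0..1::real} s * (indicator {0..1::real} s * ennreal \<bar>dderiv h \<phi> (x + s *\<^sub>R h)\<bar>) \<partial>lborel)\<^sup>2"
      by (intro power_mono) auto
    also have "\<dots> \<le> (\<integral>\<^sup>+s. (indicator {0..1::real} s)\<^sup>2 \<partial>lborel) * (\<integral>\<^sup>+s. (indicator {0..1::real} s * ennreal \<bar>dderiv h \<phi> (x + s *\<^sub>R h)\<bar>)\<^sup>2 \<partial>lborel)"
      by (rule Cauchy_Schwarz_nn_integral) measurable
    also have "(\<integral>\<^sup>+s. (indicator {0..1::real} s)\<^sup>2 \<partial>lborel) = (\<integral>\<^sup>+s. indicator {0..1::real} s \<partial>lborel)"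
      by (intro nn_integral_cong) (auto simp: indicator_def)
    also have "\<dots> = 1" by simp
    also have "(\<integral>\<^sup>+s. (indicator {0..1::real} s * ennreal \<bar>dderiv h \<phi> (x + s *\<^sub>R h)\<bar>)\<^sup>2 \<partial>lborel)
        = (\<integral>\<^sup>+s. indicator {0..1::real} s * ennreal ((dderiv h \<phi> (x + s *\<^sub>R h))\<^sup>2) \<partial>lborel)"
      by (intro nn_integral_cong) (auto simp: indicator_def ennreal_abs_square)
    finally show ?thesis by (simp add: ennreal_abs_square)
  qed
  have "(\<integral>\<^sup>+x. ennreal ((\<phi> (x + h) - \<phi> x)\<^sup>2) \<partial>lborel)
      \<le> (\<integral>\<^sup>+x. \<integral>\<^sup>+s. indicator {0..1::real} s * ennreal ((dderiv h \<phi> (x + s *\<^sub>R h))\<^sup>2) \<partial>lborel \<partial>lborel)"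
    by (intro nn_integral_mono pw)
  also have "\<dots> = (\<integral>\<^sup>+s. \<integral>\<^sup>+x. indicator {0..1::real} s * ennreal ((dderiv h \<phi> (x + s *\<^sub>R h))\<^sup>2) \<partial>lborel \<partial>lborel)"
    by (rule lborel_pair.Fubini') measurable
  also have "\<dots> = (\<integral>\<^sup>+s. indicator {0..1::real} s * (\<integral>\<^sup>+x. ennreal ((dderiv h \<phi> x)\<^sup>2) \<partial>lborel) \<partial>lborel)"
  proof (rule nn_integral_cong)
    fix s :: real
    have "(\<integral>\<^sup>+x. indicator {0..1::real} s * ennreal ((dderiv h \<phi> (x + s *\<^sub>R h))\<^sup>2) \<partial>lborel)
        = indicator {0..1::real} s * (\<integral>\<^sup>+x. ennreal ((dderiv h \<phi> (x + s *\<^sub>R h))\<^sup>2) \<partial>lborel)"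
      by (rule nn_integral_cmult) simp
    also have "(\<integral>\<^sup>+x. ennreal ((dderiv h \<phi> (x + s *\<^sub>R h))\<^sup>2) \<partial>lborel) = (\<integral>\<^sup>+x. ennreal ((dderiv h \<phi> x)\<^sup>2) \<partial>lborel)"
      by (rule nn_integral_translate[of "\<lambda>x. ennreal ((dderiv h \<phi> x)\<^sup>2)"]) simp
    finally show "(\<integral>\<^sup>+x. indicator {0..1::real} s * ennreal ((dderiv h \<phi> (x + s *\<^sub>R h))\<^sup>2) \<partial>lborel)
        = indicator {0..1::real} s * (\<integral>\<^sup>+x. ennreal ((dderiv h \<phi> x)\<^sup>2) \<partial>lborel)" .
  qed
  also have "\<dots> = (\<integral>\<^sup>+x. ennreal ((dderiv h \<phi> x)\<^sup>2) \<partial>lborel)"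
    by (subst nn_integral_multc) simp_all
  also have "\<dots> \<le> ennreal ((norm h)\<^sup>2 * grad_sq \<phi>)" by (rule integral_dderiv_square_le[OF t])
  finally show ?thesis .
qed

definition ball_vol :: "'a::euclidean_space itself \<Rightarrow> real \<Rightarrow> real" where
  "ball_vol _ d = measure lborel (ball (0::'a) d)"

text \<open>A sharp ball instead of a smooth kernel: the compactness argument asks the averages only
  for boundedness, equicontinuity and closeness in L2.\<close>

definition ball_avg :: "real \<Rightarrow> ('a::euclidean_space \<Rightarrow> real) \<Rightarrow> 'a \<Rightarrow> real" where
  "ball_avg d \<phi> x = (\<integral>h. indicator (ball (0::'a) d) h * \<phi> (x + h) \<partial>lborel) / ball_vol TYPE('a) d"

lemma ball_vol_pos: "0 < d \<Longrightarrow> 0 < ball_vol TYPE('a::euclidean_space) d"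
  unfolding ball_vol_def by (simp add: content_ball_pos)

lemma sqint_ball: "sqint lborel (indicator (ball (0::'a::euclidean_space) d) :: 'a \<Rightarrow> real)"
proof -
  have "(\<lambda>x. (indicat_real (ball (0::'a) d) x)\<^sup>2) = indicat_real (ball (0::'a) d)"
    by (auto simp: indicator_def)
  then show ?thesis
    using emeasure_bounded_finite[of "ball (0::'a) d"]
    by (auto simp: sqint_def intro!: borel_measurable_indicator)
qed

lemma integral_ball_square: "(\<integral>h. (indicat_real (ball (0::'a::euclidean_space) d) h)\<^sup>2 \<partial>lborel) = ball_vol TYPE('a) d"
proof -
  have "(\<lambda>x. (indicat_real (ball (0::'a) d) x)\<^sup>2) = indicat_real (ball (0::'a) d)"
    by (auto simp: indicator_def)
  then show ?thesis by (simp add: ball_vol_def)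
qed

lemma ball_avg_integral_square_le:
  fixes g :: "'a::euclidean_space \<Rightarrow> real"
  assumes d: "0 < d" and g: "sqint lborel g"
  shows "((\<integral>h. indicator (ball (0::'a) d) h * g h \<partial>lborel) / ball_vol TYPE('a) d)\<^sup>2
    \<le> (\<integral>h. (g h)\<^sup>2 \<partial>lborel) / ball_vol TYPE('a) d"
proof -
  define v where "v = ball_vol TYPE('a) d"
  have v: "0 < v" unfolding v_def by (rule ball_vol_pos[OF d])
  define I where "I = (\<integral>h. indicator (ball (0::'a) d) h * g h \<partial>lborel)"
  have cs: "I\<^sup>2 \<le> v * (\<integral>h. (g h)\<^sup>2 \<partial>lborel)"
    using integral_Cauchy_Schwarz[OF sqint_ball g, of d] unfolding integral_ball_square I_def v_def .
  have "(I / v)\<^sup>2 = I\<^sup>2 / v\<^sup>2" by (rule power_divide)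
  also have "\<dots> \<le> (v * (\<integral>h. (g h)\<^sup>2 \<partial>lborel)) / v\<^sup>2" by (intro divide_right_mono cs) simp
  also have "\<dots> = (\<integral>h. (g h)\<^sup>2 \<partial>lborel) / v" using v by (simp add: power2_eq_square)
  finally show ?thesis unfolding I_def v_def .
qed

lemma ball_avg_square_le:
  fixes \<phi> :: "'a::euclidean_space \<Rightarrow> real"
  assumes d: "0 < d" and c: "ccont \<phi>"
  shows "(ball_avg d \<phi> x)\<^sup>2 \<le> (\<integral>h. (\<phi> h)\<^sup>2 \<partial>lborel) / ball_vol TYPE('a) d"
proof -
  have "(\<integral>h. (\<phi> (x + h))\<^sup>2 \<partial>lborel) = (\<integral>h. (\<phi> h)\<^sup>2 \<partial>lborel)"
    using integral_translate[OF ccont_borel[OF ccont_power[OF c, of 2]], of x] by (simp add: add.commute)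
  then show ?thesis
    using ball_avg_integral_square_le[OF d ccont_sqint[OF ccont_translate[OF c]], of x]
    by (simp add: ball_avg_def)
qed

text \<open>Cauchy-Schwarz and the translation estimate for the shift x - y. The Lipschitz constant
  depends on \<open>\<phi>\<close> only through its gradient norm, so a bounded family is
  equicontinuous at a fixed radius.\<close>

lemma ball_avg_diff_square_le:
  fixes \<phi> :: "'a::euclidean_space \<Rightarrow> real"
  assumes d: "0 < d" and t: "test_fun \<Omega> \<phi>"
  shows "(ball_avg d \<phi> x - ball_avg d \<phi> y)\<^sup>2 \<le> (norm (x - y))\<^sup>2 * grad_sq \<phi> / ball_vol TYPE('a) d"
proof -
  note c = test_fun_ccont[OF t]
  let ?B = "indicat_real (ball (0::'a) d)"
  have s: "sqint lborel (\<lambda>h. \<phi> (x + h) - \<phi> (y + h))"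
    by (intro sqint_diff ccont_sqint ccont_translate c)
  have i: "integrable lborel (\<lambda>h. ?B h * \<phi> (x + h))" for x
    by (intro sqint_mult_integrable sqint_ball ccont_sqint ccont_translate c)
  have "ball_avg d \<phi> x - ball_avg d \<phi> y = (\<integral>h. ?B h * (\<phi> (x + h) - \<phi> (y + h)) \<partial>lborel) / ball_vol TYPE('a) d"
    using i[of x] i[of y] by (simp add: ball_avg_def diff_divide_distrib[symmetric] right_diff_distrib)
  then have "(ball_avg d \<phi> x - ball_avg d \<phi> y)\<^sup>2 \<le> (\<integral>h. (\<phi> (x + h) - \<phi> (y + h))\<^sup>2 \<partial>lborel) / ball_vol TYPE('a) d"
    using ball_avg_integral_square_le[OF d s] by simp
  also have "(\<integral>h. (\<phi> (x + h) - \<phi> (y + h))\<^sup>2 \<partial>lborel) \<le> (norm (x - y))\<^sup>2 * grad_sq \<phi>"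
  proof -
    have [measurable]: "\<phi> \<in> borel_measurable borel" using ccont_borel[OF c] .
    have "ennreal (\<integral>h. (\<phi> (x + h) - \<phi> (y + h))\<^sup>2 \<partial>lborel) = (\<integral>\<^sup>+h. ennreal ((\<phi> (x + h) - \<phi> (y + h))\<^sup>2) \<partial>lborel)"
      using sqint_int[OF s] by (intro nn_integral_eq_integral[symmetric]) auto
    also have "\<dots> = (\<integral>\<^sup>+h. ennreal ((\<phi> (h + y + (x - y)) - \<phi> (h + y))\<^sup>2) \<partial>lborel)"
      by (simp add: algebra_simps)
    also have "\<dots> = (\<integral>\<^sup>+h. ennreal ((\<phi> (h + (x - y)) - \<phi> h)\<^sup>2) \<partial>lborel)"
      by (rule nn_integral_translate[of "\<lambda>h. ennreal ((\<phi> (h + (x - y)) - \<phi> h)\<^sup>2)"]) simp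
    also have "\<dots> \<le> ennreal ((norm (x - y))\<^sup>2 * grad_sq \<phi>)" by (rule translation_estimate[OF t])
    finally show ?thesis using grad_sq_nonneg[of \<phi>] by (simp add: ennreal_le_iff)
  qed
  finally show ?thesis using ball_vol_pos[OF d, where 'a='a] by (simp add: divide_right_mono)
qed

lemma ball_avg_continuous:
  fixes \<phi> :: "'a::euclidean_space \<Rightarrow> real"
  assumes d: "0 < d" and t: "test_fun \<Omega> \<phi>"
  shows "continuous_on UNIV (ball_avg d \<phi>)"
proof -
  define L where "L = sqrt (grad_sq \<phi> / ball_vol TYPE('a) d)"
  have "dist (ball_avg d \<phi> x) (ball_avg d \<phi> y) \<le> L * dist x y" for x y
  proof -
    have "sqrt ((ball_avg d \<phi> x - ball_avg d \<phi> y)\<^sup>2) \<le> sqrt ((norm (x - y))\<^sup>2 * (grad_sq \<phi> / ball_vol TYPE('a) d))"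
      using ball_avg_diff_square_le[OF d t, of x y] by (intro real_sqrt_le_mono) simp
    then have "\<bar>ball_avg d \<phi> x - ball_avg d \<phi> y\<bar> \<le> norm (x - y) * L"
      unfolding real_sqrt_abs real_sqrt_mult L_def by simp
    then show ?thesis by (simp add: dist_norm mult.commute)
  qed
  moreover have "0 \<le> L" using grad_sq_nonneg[of \<phi>] ball_vol_pos[OF d, where 'a='a] by (simp add: L_def)
  ultimately have "L-lipschitz_on UNIV (ball_avg d \<phi>)"
    by (intro lipschitz_onI) auto
  then show ?thesis by (rule lipschitz_on_continuous_on)
qed

text \<open>Cauchy-Schwarz over the ball, then Tonelli: every shift h in the ball costs at most d^2
  times the gradient norm, and the volume of the ball cancels.\<close>

lemma ball_avg_approx:
  fixes \<phi> :: "'a::euclidean_space \<Rightarrow> real"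
  assumes d: "0 < d" and t: "test_fun \<Omega> \<phi>"
  shows "(\<integral>\<^sup>+x. ennreal ((ball_avg d \<phi> x - \<phi> x)\<^sup>2) \<partial>lborel) \<le> ennreal (d\<^sup>2 * grad_sq \<phi>)"
proof -
  note c = test_fun_ccont[OF t]
  let ?B = "indicat_real (ball (0::'a) d)"
  define v where "v = ball_vol TYPE('a) d"
  have v: "0 < v" unfolding v_def by (rule ball_vol_pos[OF d])
  have [measurable]: "\<phi> \<in> borel_measurable borel" using ccont_borel[OF c] .
  have am[measurable]: "ball_avg d \<phi> \<in> borel_measurable borel"
    by (rule borel_measurable_continuous_onI[OF ball_avg_continuous[OF d t]])
  have ballm[measurable]: "ball (0::'a) d \<in> sets borel" by simp
  have pw: "ennreal ((ball_avg d \<phi> x - \<phi> x)\<^sup>2) \<le> ennreal (1 / v) * (\<integral>\<^sup>+h. indicator (ball 0 d) h * ennreal ((\<phi> (x + h) - \<phi> x)\<^sup>2) \<partial>lborel)" for x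
  proof -
    have i: "integrable lborel (\<lambda>h. ?B h * \<phi> (x + h))"
      by (intro sqint_mult_integrable sqint_ball ccont_sqint ccont_translate c)
    have iB: "integrable lborel ?B" using emeasure_bounded_finite[of "ball (0::'a) d"] by simp
    have sB: "(\<lambda>h. (?B h)\<^sup>2) = ?B" by (auto simp: indicator_def)
    \<comment> \<open>A second copy of the indicator is carried along, since the difference phi(x +
      h) - phi(x) need not be square integrable in h over the whole space.\<close>
    have s: "sqint lborel (\<lambda>h. ?B h * (\<phi> (x + h) - \<phi> x))"
    proof -
      have "sqint lborel (\<lambda>h. ?B h * \<phi> (x + h))"
        by (rule sqint_bound[OF ccont_sqint[OF ccont_translate[OF c, of x]]]) (auto simp: indicator_def)
      from sqint_diff[OF this sqint_cmult[OF sqint_ball[of d], of "\<phi> x"]]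
      show ?thesis by (simp add: algebra_simps)
    qed
    have "(\<integral>h. ?B h * (?B h * (\<phi> (x + h) - \<phi> x)) \<partial>lborel) = (\<integral>h. ?B h * \<phi> (x + h) - \<phi> x * ?B h \<partial>lborel)"
      by (intro Bochner_Integration.integral_cong) (auto simp: indicator_def)
    also have "\<dots> = (\<integral>h. ?B h * \<phi> (x + h) \<partial>lborel) - \<phi> x * v"
      using i iB by (simp add: v_def ball_vol_def)
    finally have "ball_avg d \<phi> x - \<phi> x = (\<integral>h. ?B h * (?B h * (\<phi> (x + h) - \<phi> x)) \<partial>lborel) / v"
      using v by (simp add: ball_avg_def v_def[symmetric] field_simps)
    then have "(ball_avg d \<phi> x - \<phi> x)\<^sup>2 \<le> (\<integral>h. (?B h * (\<phi> (x + h) - \<phi> x))\<^sup>2 \<partial>lborel) / v"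
      using ball_avg_integral_square_le[OF d s] by (simp add: v_def)
    then have "ennreal ((ball_avg d \<phi> x - \<phi> x)\<^sup>2) \<le> ennreal (1 / v * (\<integral>h. (?B h * (\<phi> (x + h) - \<phi> x))\<^sup>2 \<partial>lborel))"
      by (intro ennreal_leI) simp
    also have "\<dots> = ennreal (1 / v) * ennreal (\<integral>h. (?B h * (\<phi> (x + h) - \<phi> x))\<^sup>2 \<partial>lborel)"
      using v by (intro ennreal_mult) auto
    also have "ennreal (\<integral>h. (?B h * (\<phi> (x + h) - \<phi> x))\<^sup>2 \<partial>lborel) = (\<integral>\<^sup>+h. ennreal ((?B h * (\<phi> (x + h) - \<phi> x))\<^sup>2) \<partial>lborel)"
      using sqint_int[OF s] by (intro nn_integral_eq_integral[symmetric]) auto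
    also have "\<dots> = (\<integral>\<^sup>+h. indicator (ball 0 d) h * ennreal ((\<phi> (x + h) - \<phi> x)\<^sup>2) \<partial>lborel)"
      by (intro nn_integral_cong) (auto simp: indicator_def)
    finally show ?thesis .
  qed
  have "(\<integral>\<^sup>+x. ennreal ((ball_avg d \<phi> x - \<phi> x)\<^sup>2) \<partial>lborel)
      \<le> (\<integral>\<^sup>+x. ennreal (1 / v) * (\<integral>\<^sup>+h. indicator (ball 0 d) h * ennreal ((\<phi> (x + h) - \<phi> x)\<^sup>2) \<partial>lborel) \<partial>lborel)"
    by (intro nn_integral_mono pw)
  also have "\<dots> = ennreal (1 / v) * (\<integral>\<^sup>+x. \<integral>\<^sup>+h. indicator (ball 0 d) h * ennreal ((\<phi> (x + h) - \<phi> x)\<^sup>2) \<partial>lborel \<partial>lborel)"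
    by (rule nn_integral_cmult) measurable
  also have "(\<integral>\<^sup>+x. \<integral>\<^sup>+h. indicator (ball 0 d) h * ennreal ((\<phi> (x + h) - \<phi> x)\<^sup>2) \<partial>lborel \<partial>lborel)
      = (\<integral>\<^sup>+h. \<integral>\<^sup>+x. indicator (ball 0 d) h * ennreal ((\<phi> (x + h) - \<phi> x)\<^sup>2) \<partial>lborel \<partial>lborel)"
    by (rule lborel_pair.Fubini') measurable
  also have "\<dots> \<le> (\<integral>\<^sup>+h. indicator (ball (0::'a) d) h * ennreal (d\<^sup>2 * grad_sq \<phi>) \<partial>lborel)"
  proof (rule nn_integral_mono)
    fix h :: 'a
    have "(\<integral>\<^sup>+x. indicator (ball 0 d) h * ennreal ((\<phi> (x + h) - \<phi> x)\<^sup>2) \<partial>lborel)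
        = indicator (ball 0 d) h * (\<integral>\<^sup>+x. ennreal ((\<phi> (x + h) - \<phi> x)\<^sup>2) \<partial>lborel)"
      by (rule nn_integral_cmult) simp
    also have "\<dots> \<le> indicator (ball 0 d) h * ennreal ((norm h)\<^sup>2 * grad_sq \<phi>)"
      by (intro mult_left_mono translation_estimate[OF t]) simp
    also have "\<dots> \<le> indicator (ball 0 d) h * ennreal (d\<^sup>2 * grad_sq \<phi>)"
      using grad_sq_nonneg[of \<phi>]
      by (auto simp: indicator_def intro!: ennreal_leI mult_right_mono power_mono)
    finally show "(\<integral>\<^sup>+x. indicator (ball 0 d) h * ennreal ((\<phi> (x + h) - \<phi> x)\<^sup>2) \<partial>lborel)
        \<le> indicator (ball 0 d) h * ennreal (d\<^sup>2 * grad_sq \<phi>)" .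
  qed
  also have "\<dots> = ennreal v * ennreal (d\<^sup>2 * grad_sq \<phi>)"
    using emeasure_bounded_finite[of "ball (0::'a) d"]
    by (subst nn_integral_multc) (simp_all add: v_def ball_vol_def emeasure_eq_ennreal_measure less_top)
  finally have "(\<integral>\<^sup>+x. ennreal ((ball_avg d \<phi> x - \<phi> x)\<^sup>2) \<partial>lborel)
      \<le> ennreal (1 / v) * (ennreal v * ennreal (d\<^sup>2 * grad_sq \<phi>))"
    by (simp add: mult_left_mono)
  also have "\<dots> = ennreal (d\<^sup>2 * grad_sq \<phi>)"
    using v grad_sq_nonneg[of \<phi>] by (simp add: ennreal_mult[symmetric])
  finally show ?thesis .
qed

context bounded_open
begin

lemma nn_integral_dom_le:
  assumes f[measurable]: "f \<in> borel_measurable borel" and le: "(\<integral>\<^sup>+x. ennreal ((f x)\<^sup>2) \<partial>lborel) \<le> ennreal c" and c: "0 \<le> c"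
  shows "sqint M f" and "(\<integral>x. (f x)\<^sup>2 \<partial>M) \<le> c"
proof -
  have fm: "f \<in> borel_measurable M" by (rule borel_measurable_dom[OF f])
  have "(\<integral>\<^sup>+x. ennreal ((f x)\<^sup>2) \<partial>M) = (\<integral>\<^sup>+x. ennreal ((f x)\<^sup>2) * indicator \<Omega> x \<partial>lebesgue)"
    by (rule nn_integral_restrict_space[OF dom_sets(2)])
  also have "\<dots> \<le> (\<integral>\<^sup>+x. ennreal ((f x)\<^sup>2) \<partial>lebesgue)"
    by (intro nn_integral_mono) (auto simp: indicator_def)
  also have "\<dots> \<le> ennreal c" using le by (simp add: nn_integral_completion)
  finally have n: "(\<integral>\<^sup>+x. ennreal ((f x)\<^sup>2) \<partial>M) \<le> ennreal c" .
  have i: "integrable M (\<lambda>x. (f x)\<^sup>2)"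
    using fm le_less_trans[OF n] by (intro integrableI_nonneg) auto
  then show "sqint M f" using fm by (simp add: sqint_def)
  show "(\<integral>x. (f x)\<^sup>2 \<partial>M) \<le> c"
    using n nn_integral_eq_integral[OF i] c by simp
qed

lemma lborel_norms_le_nsq:
  assumes t: "test_fun \<Omega> \<phi>"
  shows "grad_sq \<phi> \<le> nsq \<phi>" and "(\<integral>x. (\<phi> x)\<^sup>2 \<partial>lborel) \<le> nsq \<phi>"
proof -
  have d: "(\<integral>x. (dderiv b \<phi> x)\<^sup>2 \<partial>M) = (\<integral>x. (dderiv b \<phi> x)\<^sup>2 \<partial>lborel)" if "b \<in> Basis" for b
    using test_fun_zero[OF test_fun_dderiv[OF t that]] ccont_borel[OF ccont_power[OF ccont_dderiv[OF t], of 2]]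
    by (intro integral_dom_eq_lborel) auto
  have p: "(\<integral>x. (\<phi> x)\<^sup>2 \<partial>M) = (\<integral>x. (\<phi> x)\<^sup>2 \<partial>lborel)"
    using test_fun_zero[OF t] ccont_borel[OF ccont_power[OF test_fun_ccont[OF t], of 2]]
    by (intro integral_dom_eq_lborel) auto
  have "nsq \<phi> = (\<integral>x. (\<phi> x)\<^sup>2 \<partial>lborel) + grad_sq \<phi>"
    unfolding nsq_test[OF t] grad_sq_def p using d by simp
  moreover have "0 \<le> (\<integral>x. (\<phi> x)\<^sup>2 \<partial>lborel)" by simp
  ultimately show "grad_sq \<phi> \<le> nsq \<phi>" "(\<integral>x. (\<phi> x)\<^sup>2 \<partial>lborel) \<le> nsq \<phi>"
    using grad_sq_nonneg[of \<phi>] by linarith+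
qed

text \<open>Averages over small balls are uniformly close in \<open>L\<^sup>2\<close> to the functions themselves and equicontinuous
  for a fixed radius, so a diagonal subsequence makes all averages converge pointwise.\<close>

lemma Rellich_test:
  assumes t: "\<And>n. test_fun \<Omega> (\<phi> n)" and K: "\<And>n. nsq (\<phi> n) \<le> K"
  shows "\<exists>r. strict_mono (r :: nat \<Rightarrow> nat) \<and>
    (\<forall>e>0. \<exists>N. \<forall>m\<ge>N. \<forall>n\<ge>N. (\<integral>x. (\<phi> (r m) x - \<phi> (r n) x)\<^sup>2 \<partial>M) < e)"
proof -
  note c = test_fun_ccont[OF t]
  define d :: "nat \<Rightarrow> real" where "d k = 1 / real (Suc k)" for k
  have d: "0 < d k" for k by (simp add: d_def)
  define v where "v k = ball_vol TYPE('a) (d k)" for k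
  have v: "0 < v k" for k unfolding v_def by (rule ball_vol_pos[OF d])
  have K0: "0 \<le> K" using order_trans[OF frm_nonneg[OF weight_one] K] .
  have G: "grad_sq (\<phi> n) \<le> K" and P: "(\<integral>x. (\<phi> n x)\<^sup>2 \<partial>lborel) \<le> K" for n
    using lborel_norms_le_nsq[OF t, of n] K[of n] by linarith+
  \<comment> \<open>One constant bounds both the size (\<open>Ab\<close>) and the Lipschitz constant
    (\<open>AL\<close>) of all averages at radius \<open>d k\<close>.\<close>
  define C where "C k = sqrt (K / v k)" for k
  have Ab: "\<bar>ball_avg (d k) (\<phi> n) x\<bar> \<le> C k" for k n x
  proof -
    have "(ball_avg (d k) (\<phi> n) x)\<^sup>2 \<le> (\<integral>h. (\<phi> n h)\<^sup>2 \<partial>lborel) / v k"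
      unfolding v_def by (rule ball_avg_square_le[OF d c])
    also have "\<dots> \<le> K / v k" using P v[of k] by (intro divide_right_mono) auto
    finally show ?thesis unfolding C_def using real_sqrt_le_mono by fastforce
  qed
  have AL: "\<bar>ball_avg (d k) (\<phi> n) x - ball_avg (d k) (\<phi> n) y\<bar> \<le> norm (x - y) * C k" for k n x y
  proof -
    have "(ball_avg (d k) (\<phi> n) x - ball_avg (d k) (\<phi> n) y)\<^sup>2 \<le> (norm (x - y))\<^sup>2 * grad_sq (\<phi> n) / v k"
      unfolding v_def by (rule ball_avg_diff_square_le[OF d t])
    also have "\<dots> \<le> (norm (x - y))\<^sup>2 * K / v k"
      using G v[of k] by (intro divide_right_mono mult_left_mono) auto
    finally have "sqrt ((ball_avg (d k) (\<phi> n) x - ball_avg (d k) (\<phi> n) y)\<^sup>2) \<le> sqrt ((norm (x - y))\<^sup>2 * (K / v k))"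
      by (intro real_sqrt_le_mono) simp
    then show ?thesis unfolding real_sqrt_abs real_sqrt_mult C_def by simp
  qed
  obtain Q :: "'a set" where Q: "countable Q" "\<And>X. open X \<Longrightarrow> X \<noteq> {} \<Longrightarrow> \<exists>q\<in>Q. q \<in> X"
    using countable_dense_exists by metis
  \<comment> \<open>The quotient is bounded by 1 simultaneously for all pairs of a radius index and
    a dense point, as the diagonal extraction requires; adding 1 avoids a zero denominator.\<close>
  define f where "f n p = ball_avg (d (fst p)) (\<phi> n) (snd p) / (C (fst p) + 1)" for n p
  have C0: "0 \<le> C k" for k unfolding C_def using K0 v[of k] by simp
  have fb: "norm (f n p) \<le> 1" for n p
    using Ab[of "fst p" n "snd p"] C0[of "fst p"] by (simp add: f_def abs_divide divide_le_eq)
  have cnt: "countable ((UNIV :: nat set) \<times> Q)" using Q(1) by simp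
  have "\<exists>r. strict_mono (r :: nat \<Rightarrow> nat) \<and> (\<forall>p\<in>UNIV \<times> Q. \<exists>l. (\<lambda>n. f (r n) p) \<longlonglongrightarrow> l)"
    by (rule function_convergent_subsequence[OF cnt, of f 1, OF fb]) auto
  then obtain r where r: "strict_mono (r :: nat \<Rightarrow> nat)" "\<forall>p\<in>UNIV \<times> Q. \<exists>l. (\<lambda>n. f (r n) p) \<longlonglongrightarrow> l"
    by blast
  define a where "a n k x = ball_avg (d k) (\<phi> (r n)) x" for n k x
  have convQ: "Cauchy (\<lambda>n. a n k q)" if "q \<in> Q" for k q
  proof -
    obtain l where "(\<lambda>n. f (r n) (k, q)) \<longlonglongrightarrow> l" using r(2) \<open>q \<in> Q\<close> by blast
    then have "(\<lambda>n. (C k + 1) * f (r n) (k, q)) \<longlonglongrightarrow> (C k + 1) * l" by (intro tendsto_intros)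
    moreover have "(C k + 1) * f (r n) (k, q) = a n k q" for n
      using C0[of k] by (simp add: f_def a_def)
    ultimately show ?thesis using LIMSEQ_imp_Cauchy by simp
  qed
  have conv: "convergent (\<lambda>n. a n k x)" for k x
  proof -
    have "Cauchy (\<lambda>n. a n k x)"
    proof (rule CauchyI)
      fix e :: real assume e: "0 < e"
      \<comment> \<open>Moving from x to a point closer than \<open>\<rho>\<close> changes every
        average by at most e/3, which leaves e/3 for the Cauchy property at the dense point
        \<open>q\<close>.\<close>
      define \<rho> where "\<rho> = e / 3 / (C k + 1)"
      have \<rho>: "0 < \<rho>" using e C0[of k] by (simp add: \<rho>_def)
      obtain q where q: "q \<in> Q" "q \<in> ball x \<rho>" using Q(2)[of "ball x \<rho>"] \<rho> by auto
      have "norm (x - q) * C k \<le> \<rho> * (C k + 1)"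
        using q(2) C0[of k] \<rho> by (intro mult_mono) (auto simp: dist_norm)
      also have "\<dots> = e / 3"
      proof -
        have "y / x * x = y" if "x \<noteq> 0" for x y :: real using that by simp
        then show ?thesis unfolding \<rho>_def using C0[of k] by (smt (verit))
      qed
      finally have close: "\<bar>a n k x - a n k q\<bar> \<le> e / 3" for n
        using AL[of k "r n" x q] by (simp add: a_def)
      have e3: "0 < e / 3" using e by simp
      obtain N where N: "\<forall>m\<ge>N. \<forall>n\<ge>N. norm (a m k q - a n k q) < e / 3"
        using CauchyD[OF convQ[OF q(1), of k] e3] by blast
      have "norm (a m k x - a n k x) < e" if "m \<ge> N" "n \<ge> N" for m n
        using close[of m] close[of n] N[rule_format, OF that] unfolding real_norm_def by linarith
      then show "\<exists>N. \<forall>m\<ge>N. \<forall>n\<ge>N. norm (a m k x - a n k x) < e" by blast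
    qed
    then show ?thesis by (simp add: Cauchy_convergent_iff)
  qed
  define l where "l k x = lim (\<lambda>n. a n k x)" for k x
  have al: "(\<lambda>n. a n k x) \<longlonglongrightarrow> l k x" for k x
    using conv unfolding l_def convergent_LIMSEQ_iff .
  have lb: "\<bar>l k x\<bar> \<le> C k" for k x
    using tendsto_rabs[OF al, of k x] Ab unfolding a_def by (intro LIMSEQ_le_const2) auto
  have ab: "a n k \<in> borel_measurable borel" for n k
    unfolding a_def using borel_measurable_continuous_onI[OF ball_avg_continuous[OF d t]] .
  then have am: "a n k \<in> borel_measurable M" for n k by (rule borel_measurable_dom)
  have lm: "l k \<in> borel_measurable M" for k
    using borel_measurable_LIMSEQ_metric[OF am al] .
  have as: "sqint M (a n k)" for n k
    by (rule sqint_bound[OF sqint_one[of "C k"] am]) (use Ab[of k "r n"] C0[of k] in \<open>auto simp: a_def\<close>)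
  have ls: "sqint M (l k)" for k
    by (rule sqint_bound[OF sqint_one[of "C k"] lm]) (use lb[of k] C0[of k] in auto)
  have dct: "(\<lambda>n. \<integral>x. (a n k x - l k x)\<^sup>2 \<partial>M) \<longlonglongrightarrow> (\<integral>x. 0 \<partial>M)" for k
  proof (rule integral_dominated_convergence)
    show "integrable M (\<lambda>x. (2 * C k)\<^sup>2)" using sqint_int[OF sqint_one] .
    show "(\<lambda>x. (a n k x - l k x)\<^sup>2) \<in> borel_measurable M" for n using am lm by simp
    show "AE x in M. (\<lambda>n. (a n k x - l k x)\<^sup>2) \<longlonglongrightarrow> 0"
    proof (rule AE_I2)
      fix x
      have "(\<lambda>n. (a n k x - l k x)\<^sup>2) \<longlonglongrightarrow> (l k x - l k x)\<^sup>2" by (intro tendsto_intros al)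
      then show "(\<lambda>n. (a n k x - l k x)\<^sup>2) \<longlonglongrightarrow> 0" by simp
    qed
    show "AE x in M. norm ((a n k x - l k x)\<^sup>2) \<le> (2 * C k)\<^sup>2" for n
    proof (rule AE_I2)
      fix x
      have "\<bar>a n k x - l k x\<bar> \<le> 2 * C k" using Ab[of k "r n" x] lb[of k x] unfolding a_def by linarith
      then show "norm ((a n k x - l k x)\<^sup>2) \<le> (2 * C k)\<^sup>2"
        using power_mono[of "\<bar>a n k x - l k x\<bar>" "2 * C k" 2] by simp
    qed
  qed simp
  have ps: "sqint M (\<phi> n)" for n by (rule ccont_sqint_dom[OF c])
  \<comment> \<open>The first term is uniform in n and small for large k; the second tends to 0 in n
    for fixed k. Hence k is fixed before \<open>N\<close> is chosen.\<close>
  have E: "(\<integral>x. (\<phi> (r n) x - l k x)\<^sup>2 \<partial>M) \<le> 2 * ((d k)\<^sup>2 * K) + 2 * (\<integral>x. (a n k x - l k x)\<^sup>2 \<partial>M)" for n k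
  proof -
    have "(\<integral>\<^sup>+x. ennreal ((a n k x - \<phi> (r n) x)\<^sup>2) \<partial>lborel) \<le> ennreal ((d k)\<^sup>2 * grad_sq (\<phi> (r n)))"
      unfolding a_def by (rule ball_avg_approx[OF d t])
    then have le: "(\<integral>\<^sup>+x. ennreal ((a n k x - \<phi> (r n) x)\<^sup>2) \<partial>lborel) \<le> ennreal ((d k)\<^sup>2 * K)"
      by (rule order_trans) (intro ennreal_leI mult_left_mono G, simp)
    have "(\<lambda>x. a n k x - \<phi> (r n) x) \<in> borel_measurable borel"
      using ab ccont_borel[OF c] by simp
    from nn_integral_dom_le(2)[OF this le] have "(\<integral>x. (a n k x - \<phi> (r n) x)\<^sup>2 \<partial>M) \<le> (d k)\<^sup>2 * K" using K0 by simp
    then have 1: "(\<integral>x. (\<phi> (r n) x - a n k x)\<^sup>2 \<partial>M) \<le> (d k)\<^sup>2 * K" by (simp add: power2_commute)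
    have "(\<integral>x. (\<phi> (r n) x - l k x)\<^sup>2 \<partial>M) \<le> 2 * (\<integral>x. (\<phi> (r n) x - a n k x)\<^sup>2 \<partial>M) + 2 * (\<integral>x. (a n k x - l k x)\<^sup>2 \<partial>M)"
      using integral_square_add_le[OF sqint_diff[OF ps as] sqint_diff[OF as ls], of "r n" n k n k k] by simp
    then show ?thesis using 1 by linarith
  qed
  have "\<exists>N. \<forall>m\<ge>N. \<forall>n\<ge>N. (\<integral>x. (\<phi> (r m) x - \<phi> (r n) x)\<^sup>2 \<partial>M) < e" if e: "e > 0" for e
  proof -
    \<comment> \<open>With both quantities below e/16, the bound \<open>E\<close> is below e/4, and
      splitting the squared distance of two members through \<open>l k\<close> gives twice the sum
      of two such bounds.\<close>
    have "(\<lambda>k. (d k)\<^sup>2 * K) \<longlonglongrightarrow> 0\<^sup>2 * K"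
      unfolding d_def by (intro tendsto_intros LIMSEQ_Suc[OF lim_1_over_n])
    then have "\<forall>\<^sub>F k in sequentially. (d k)\<^sup>2 * K < e / 16"
      using e by (intro order_tendstoD(2)) auto
    then obtain k where k: "(d k)\<^sup>2 * K < e / 16" unfolding eventually_sequentially by blast
    have "\<forall>\<^sub>F n in sequentially. (\<integral>x. (a n k x - l k x)\<^sup>2 \<partial>M) < e / 16"
      using e dct[of k] by (intro order_tendstoD(2)) auto
    then obtain N where N: "\<And>n. n \<ge> N \<Longrightarrow> (\<integral>x. (a n k x - l k x)\<^sup>2 \<partial>M) < e / 16"
      unfolding eventually_sequentially by blast
    have "(\<integral>x. (\<phi> (r m) x - \<phi> (r n) x)\<^sup>2 \<partial>M) < e" if "m \<ge> N" "n \<ge> N" for m n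
    proof -
      have "(\<integral>x. (l k x - \<phi> (r n) x)\<^sup>2 \<partial>M) = (\<integral>x. (\<phi> (r n) x - l k x)\<^sup>2 \<partial>M)" by (simp add: power2_commute)
      then have "(\<integral>x. (\<phi> (r m) x - \<phi> (r n) x)\<^sup>2 \<partial>M) \<le> 2 * (\<integral>x. (\<phi> (r m) x - l k x)\<^sup>2 \<partial>M) + 2 * (\<integral>x. (\<phi> (r n) x - l k x)\<^sup>2 \<partial>M)"
        using integral_square_add_le[OF sqint_diff[OF ps ls] sqint_diff[OF ls ps], of "r m" k k "r n"] by simp
      then show ?thesis using E[of m k] E[of n k] N[OF that(1)] N[OF that(2)] k by linarith
    qed
    then show ?thesis by blast
  qed
  then show ?thesis using r(1) by blast
qed

text \<open>Each member is replaced by a test function within 1/(n+1) in squared H1 norm: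
  boundedness survives, and the L2 error vanishes along the subsequence. The conclusion is a Cauchy
  property because the limit itself is only taken in H1.\<close>

theorem Rellich:
  assumes u: "\<And>n. u n \<in> H10 \<Omega>" and K: "\<And>n. nsq (u n) \<le> K"
  shows "\<exists>r. strict_mono (r :: nat \<Rightarrow> nat) \<and>
    (\<forall>e>0. \<exists>N. \<forall>m\<ge>N. \<forall>n\<ge>N. (\<integral>x. (u (r m) x - u (r n) x)\<^sup>2 \<partial>M) < e)"
proof -
  note hu = H10_H1[OF u]
  have "\<forall>n. \<exists>\<phi>. test_fun \<Omega> \<phi> \<and> nsq (\<lambda>x. \<phi> x - u n x) < 1 / real (Suc n)"
    using H10_approx[OF u] by simp
  from choice[OF this] obtain \<phi> where "\<forall>n. test_fun \<Omega> (\<phi> n) \<and> nsq (\<lambda>x. \<phi> n x - u n x) < 1 / real (Suc n)" ..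
  then have p: "\<And>n. test_fun \<Omega> (\<phi> n)" "\<And>n. nsq (\<lambda>x. \<phi> n x - u n x) < 1 / real (Suc n)" by simp_all
  note hp = H1_test[OF p(1)]
  have "nsq (\<phi> n) \<le> 2 * 1 + 2 * K" for n
  proof -
    have "nsq (\<phi> n) \<le> 2 * nsq (\<lambda>x. \<phi> n x - u n x) + 2 * nsq (u n)"
      using frm_add_square_le[OF weight_one, of "\<lambda>x. \<phi> n x - u n x" "u n"] H1_diff[OF hp hu] hu
      by (simp add: adm_one)
    moreover have "1 / real (Suc n) \<le> 1" by simp
    ultimately show ?thesis using p(2)[of n] K[of n] by linarith
  qed
  from Rellich_test[of \<phi>, OF p(1) this] obtain r where r: "strict_mono (r :: nat \<Rightarrow> nat)"
    "\<forall>e>0. \<exists>N. \<forall>m\<ge>N. \<forall>n\<ge>N. (\<integral>x. (\<phi> (r m) x - \<phi> (r n) x)\<^sup>2 \<partial>M) < e" by blast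
  have "\<exists>N. \<forall>m\<ge>N. \<forall>n\<ge>N. (\<integral>x. (u (r m) x - u (r n) x)\<^sup>2 \<partial>M) < e" if e: "e > 0" for e
  proof -
    have "e / 16 > 0" using e by simp
    then obtain N where N: "\<forall>m\<ge>N. \<forall>n\<ge>N. (\<integral>x. (\<phi> (r m) x - \<phi> (r n) x)\<^sup>2 \<partial>M) < e / 16" using r(2) by blast
    have "\<forall>\<^sub>F n in sequentially. 1 / real (Suc n) < e / 16"
      using e by (intro order_tendstoD(2)[OF LIMSEQ_Suc[OF lim_1_over_n]]) simp
    then obtain N' where N': "\<And>n. n \<ge> N' \<Longrightarrow> 1 / real (Suc n) < e / 16" unfolding eventually_sequentially by blast
    have small: "(\<integral>x. (\<phi> (r n) x - u (r n) x)\<^sup>2 \<partial>M) < e / 16" if "n \<ge> N'" for n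
      using L2_le_nsq[OF H1_diff[OF hp hu], of "r n" "r n"] p(2)[of "r n"] N'[of "r n"] seq_suble[OF r(1), of n] that
      by linarith
    have "(\<integral>x. (u (r m) x - u (r n) x)\<^sup>2 \<partial>M) < e" if mn: "m \<ge> max N N'" "n \<ge> max N N'" for m n
    proof -
      have "(\<integral>x. (u (r m) x - \<phi> (r m) x)\<^sup>2 \<partial>M) = (\<integral>x. (\<phi> (r m) x - u (r m) x)\<^sup>2 \<partial>M)" by (simp add: power2_commute)
      moreover have "(\<integral>x. (u (r m) x - \<phi> (r n) x)\<^sup>2 \<partial>M)
          \<le> 2 * (\<integral>x. (u (r m) x - \<phi> (r m) x)\<^sup>2 \<partial>M) + 2 * (\<integral>x. (\<phi> (r m) x - \<phi> (r n) x)\<^sup>2 \<partial>M)"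
        using integral_square_add_le[OF sqint_diff[OF H1_sqint[OF hu] H1_sqint[OF hp]] sqint_diff[OF H1_sqint[OF hp] H1_sqint[OF hp]], of "r m" "r m" "r m" "r n"] by simp
      moreover have "(\<integral>x. (u (r m) x - u (r n) x)\<^sup>2 \<partial>M)
          \<le> 2 * (\<integral>x. (u (r m) x - \<phi> (r n) x)\<^sup>2 \<partial>M) + 2 * (\<integral>x. (\<phi> (r n) x - u (r n) x)\<^sup>2 \<partial>M)"
        using integral_square_add_le[OF sqint_diff[OF H1_sqint[OF hu] H1_sqint[OF hp]] sqint_diff[OF H1_sqint[OF hp] H1_sqint[OF hu]], of "r m" "r n" "r n" "r n"] by simp
      ultimately show ?thesis
        using small[of m] small[of n] N[rule_format, of m n] mn e by simp
    qed
    then show ?thesis by blast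
  qed
  then show ?thesis using r(1) by blast
qed

end

section \<open>The form a_z, its continuity in z, and the solution operator\<close>

section \<open>The linearised operator\<close>

context low_dim
begin

lemma H10_qint: "u \<in> H10 \<Omega> \<Longrightarrow> qint M u"
  by (rule Gagliardo_Nirenberg(1))

lemma H10_sqint: "u \<in> H10 \<Omega> \<Longrightarrow> sqint M u"
  by (rule H1_sqint[OF H10_H1])

lemma nsq_tendsto_imp_L4_diff_tendsto:
  assumes "\<And>n. u n \<in> H10 \<Omega>" "u0 \<in> H10 \<Omega>" "(\<lambda>n. nsq (\<lambda>x. u n x - u0 x)) \<longlonglongrightarrow> 0"
  shows "(\<lambda>n. \<integral>x. (u n x - u0 x)^4 \<partial>M) \<longlonglongrightarrow> 0"
proof -
  obtain K where K: "\<forall>n. norm (nsq (\<lambda>x. u n x - u0 x)) \<le> K"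
    using convergent_imp_Bseq[OF convergentI[OF assms(3)]] by (rule BseqE)
  have "nsq (\<lambda>x. u n x - u0 x) \<le> K" for n
    using K[rule_format, of n] by simp
  then show ?thesis
    by (rule nsq_tendsto_imp_L4_tendsto[OF H10_diff[OF assms(1,2)]
        nsq_tendsto_imp_L2_tendsto[OF H10_H1[OF assms(1)] H10_H1[OF assms(2)] assms(3)]])
qed

end

locale GPE = low_dim \<Omega> for \<Omega> :: "'a::euclidean_space set" +
  fixes V :: "'a \<Rightarrow> real" and \<beta> :: real
  assumes beta_nonneg: "0 \<le> \<beta>"
    and V_measurable: "V \<in> borel_measurable M"
    and V_bounds: "\<exists>C. AE x in M. 1 \<le> V x \<and> V x \<le> C"
begin

definition wgt :: "('a \<Rightarrow> real) \<Rightarrow> 'a \<Rightarrow> real" where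
  "wgt z x = V x + \<beta> * (z x)\<^sup>2"

text \<open>The maximum with 1 yields \<open>1 \<le> Vmax\<close> without an argument that the
  domain has positive measure.\<close>

definition Vmax :: real where
  "Vmax = max 1 (SOME C. AE x in M. 1 \<le> V x \<and> V x \<le> C)"

lemma V_AE: "AE x in M. 1 \<le> V x \<and> V x \<le> Vmax" and Vmax_ge_1: "1 \<le> Vmax"
proof -
  have "AE x in M. 1 \<le> V x \<and> V x \<le> (SOME C. AE x in M. 1 \<le> V x \<and> V x \<le> C)"
    using someI_ex[OF V_bounds] .
  then show "AE x in M. 1 \<le> V x \<and> V x \<le> Vmax"
    unfolding Vmax_def by eventually_elim auto
  show "1 \<le> Vmax" by (simp add: Vmax_def)
qed

lemma wgt_weight:
  assumes "z \<in> H10 \<Omega>" shows "weight (wgt z)"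
  unfolding weight_def
proof
  show "wgt z \<in> borel_measurable M"
    using V_measurable sqint_meas[OF H10_sqint[OF assms]] unfolding wgt_def by simp
  show "AE x in M. 0 \<le> wgt z x"
    using V_AE by eventually_elim (simp add: wgt_def beta_nonneg)
qed

lemma V_mult_integrable:
  assumes "sqint M v" "sqint M w" shows "integrable M (\<lambda>x. V x * (v x * w x))"
proof (rule Bochner_Integration.integrable_bound)
  show "integrable M (\<lambda>x. Vmax * (v x * w x))"
    using sqint_mult_integrable[OF assms] by simp
  show "(\<lambda>x. V x * (v x * w x)) \<in> borel_measurable M"
    using V_measurable assms by (auto simp: sqint_def)
  show "AE x in M. norm (V x * (v x * w x)) \<le> norm (Vmax * (v x * w x))"
    using V_AE by eventually_elim (auto simp: abs_mult intro!: mult_right_mono)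
qed

lemma quartic_integrable:
  assumes "qint M a" "qint M b" "qint M c" "qint M d"
  shows "integrable M (\<lambda>x. (a x * b x) * (c x * d x))"
  by (intro sqint_mult_integrable qint_mult_sqint assms)

lemma wgt_adm:
  assumes "z \<in> H10 \<Omega>" "v \<in> H10 \<Omega>" shows "adm (wgt z) v"
proof (rule admI[OF wgt_weight[OF assms(1)] H10_H1[OF assms(2)]])
  have "integrable M (\<lambda>x. V x * (v x * v x) + \<beta> * ((z x * z x) * (v x * v x)))"
    using V_mult_integrable[of v v] quartic_integrable[of z z v v] assms H10_sqint H10_qint by simp
  then show "integrable M (\<lambda>x. wgt z x * (v x * v x))"
    by (simp add: wgt_def algebra_simps power2_eq_square)
qed

lemma aform_eq_frm: "aform \<Omega> V \<beta> z v w = frm (wgt z) v w"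
  unfolding aform_def frm_def wgt_def by (simp add: algebra_simps)

text \<open>Coercivity with constant 1, from V >= 1 and beta >= 0. It converts every smallness
  statement about a form into one about the H1 norm.\<close>

lemma nsq_le_frm:
  assumes z: "z \<in> H10 \<Omega>" and v: "v \<in> H10 \<Omega>"
  shows "nsq v \<le> frm (wgt z) v v"
  unfolding frm_def
proof (rule integral_mono_AE)
  show "integrable M (\<lambda>x. grad \<Omega> v x \<bullet> grad \<Omega> v x + 1 * (v x * v x))"
    using frm_integrable[OF weight_one, of v v] H10_H1[OF v] by (simp add: adm_one)
  show "integrable M (\<lambda>x. grad \<Omega> v x \<bullet> grad \<Omega> v x + wgt z x * (v x * v x))"
    by (rule frm_integrable[OF wgt_weight[OF z] wgt_adm[OF z v] wgt_adm[OF z v]])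
  show "AE x in M. grad \<Omega> v x \<bullet> grad \<Omega> v x + 1 * (v x * v x) \<le> grad \<Omega> v x \<bullet> grad \<Omega> v x + wgt z x * (v x * v x)"
    using V_AE
  proof eventually_elim
    case (elim x)
    have "1 \<le> wgt z x" using elim beta_nonneg by (simp add: wgt_def add_increasing2)
    then show ?case by (intro add_mono mult_right_mono) auto
  qed
qed

lemma zero_wgt: "wgt (\<lambda>x. 0) = V"
  by (simp add: wgt_def fun_eq_iff)

lemma V_weight: "weight V"
  using wgt_weight[OF H10_zero] by (simp add: zero_wgt)

lemma V_adm: "v \<in> H10 \<Omega> \<Longrightarrow> adm V v"
  using wgt_adm[OF H10_zero] by (simp add: zero_wgt)

text \<open>Separates a fixed form from the dependence on \<open>z\<close>, so that limits with a
  varying weight reduce to continuity of one form and of a four-linear integral.\<close>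

lemma frm_wgt_split:
  assumes z: "z \<in> H10 \<Omega>" and v: "v \<in> H10 \<Omega>" and w: "w \<in> H10 \<Omega>"
  shows "frm (wgt z) v w = frm V v w + \<beta> * (\<integral>x. (z x * z x) * (v x * w x) \<partial>M)"
proof -
  have "frm (wgt z) v w = (\<integral>x. (grad \<Omega> v x \<bullet> grad \<Omega> w x + V x * (v x * w x)) + \<beta> * ((z x * z x) * (v x * w x)) \<partial>M)"
    unfolding frm_def wgt_def by (simp add: algebra_simps power2_eq_square)
  also have "\<dots> = frm V v w + \<beta> * (\<integral>x. (z x * z x) * (v x * w x) \<partial>M)"
    unfolding frm_def
    using frm_integrable[OF V_weight V_adm[OF v] V_adm[OF w]]
      quartic_integrable[OF z[THEN H10_qint] z[THEN H10_qint] v[THEN H10_qint] w[THEN H10_qint]]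
    by simp
  finally show ?thesis .
qed

lemma frm_V_le_nsq:
  assumes v: "v \<in> H10 \<Omega>" shows "frm V v v \<le> Vmax * nsq v"
proof -
  have i1: "integrable M (\<lambda>x. grad \<Omega> v x \<bullet> grad \<Omega> v x + 1 * (v x * v x))"
    using frm_integrable[OF weight_one, of v v] H10_H1[OF v] by (simp add: adm_one)
  have "frm V v v \<le> (\<integral>x. Vmax * (grad \<Omega> v x \<bullet> grad \<Omega> v x + 1 * (v x * v x)) \<partial>M)"
    unfolding frm_def
  proof (rule integral_mono_AE)
    show "integrable M (\<lambda>x. grad \<Omega> v x \<bullet> grad \<Omega> v x + V x * (v x * v x))"
      by (rule frm_integrable[OF V_weight V_adm[OF v] V_adm[OF v]])
    show "integrable M (\<lambda>x. Vmax * (grad \<Omega> v x \<bullet> grad \<Omega> v x + 1 * (v x * v x)))"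
      by (intro integrable_mult_right i1)
    show "AE x in M. grad \<Omega> v x \<bullet> grad \<Omega> v x + V x * (v x * v x) \<le> Vmax * (grad \<Omega> v x \<bullet> grad \<Omega> v x + 1 * (v x * v x))"
      using V_AE
    proof eventually_elim
      case (elim x)
      have "1 * (grad \<Omega> v x \<bullet> grad \<Omega> v x) \<le> Vmax * (grad \<Omega> v x \<bullet> grad \<Omega> v x)"
        using Vmax_ge_1 by (intro mult_right_mono) auto
      moreover have "V x * (v x * v x) \<le> Vmax * (v x * v x)"
        using elim by (intro mult_right_mono) auto
      ultimately show ?case unfolding distrib_left by simp
    qed
  qed
  also have "\<dots> = Vmax * nsq v" unfolding frm_def by (rule integral_mult_right_zero)
  finally show ?thesis .
qed

lemma frm_V_tendsto_0:
  assumes "\<And>n. u n \<in> H10 \<Omega>" "(\<lambda>n. nsq (u n)) \<longlonglongrightarrow> 0"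
  shows "(\<lambda>n. frm V (u n) (u n)) \<longlonglongrightarrow> 0"
proof (rule tendsto_sandwich[OF _ _ tendsto_const])
  show "(\<lambda>n. Vmax * nsq (u n)) \<longlonglongrightarrow> 0"
    using tendsto_mult[OF tendsto_const assms(2), of Vmax] by simp
qed (auto intro!: always_eventually frm_V_le_nsq frm_nonneg[OF V_weight] assms(1))

lemma frm_V_tendsto:
  assumes "\<And>n. u n \<in> H10 \<Omega>" "u0 \<in> H10 \<Omega>" "(\<lambda>n. nsq (\<lambda>x. u n x - u0 x)) \<longlonglongrightarrow> 0"
    and "\<And>n. v n \<in> H10 \<Omega>" "v0 \<in> H10 \<Omega>" "(\<lambda>n. nsq (\<lambda>x. v n x - v0 x)) \<longlonglongrightarrow> 0"
  shows "(\<lambda>n. frm V (u n) (v n)) \<longlonglongrightarrow> frm V u0 v0"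
  using assms by (intro frm_tendsto[OF V_weight] V_adm frm_V_tendsto_0 H10_diff)

text \<open>Convergence in H1 gives convergence in L4, hence of the pairwise products in L2, hence
  of their L2 pairing.\<close>

lemma quartic_tendsto:
  assumes a: "\<And>n. a n \<in> H10 \<Omega>" "a0 \<in> H10 \<Omega>" "(\<lambda>n. nsq (\<lambda>x. a n x - a0 x)) \<longlonglongrightarrow> 0"
    and b: "\<And>n. b n \<in> H10 \<Omega>" "b0 \<in> H10 \<Omega>" "(\<lambda>n. nsq (\<lambda>x. b n x - b0 x)) \<longlonglongrightarrow> 0"
    and c: "\<And>n. c n \<in> H10 \<Omega>" "c0 \<in> H10 \<Omega>" "(\<lambda>n. nsq (\<lambda>x. c n x - c0 x)) \<longlonglongrightarrow> 0"
    and d: "\<And>n. d n \<in> H10 \<Omega>" "d0 \<in> H10 \<Omega>" "(\<lambda>n. nsq (\<lambda>x. d n x - d0 x)) \<longlonglongrightarrow> 0"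
  shows "(\<lambda>n. \<integral>x. (a n x * b n x) * (c n x * d n x) \<partial>M) \<longlonglongrightarrow> (\<integral>x. (a0 x * b0 x) * (c0 x * d0 x) \<partial>M)"
  by (intro integral_mult_tendsto qint_mult_sqint qint_product_tendsto H10_qint nsq_tendsto_imp_L4_diff_tendsto a b c d)

lemma frm_wgt_tendsto:
  assumes z: "\<And>n. z n \<in> H10 \<Omega>" "z0 \<in> H10 \<Omega>" "(\<lambda>n. nsq (\<lambda>x. z n x - z0 x)) \<longlonglongrightarrow> 0"
    and u: "\<And>n. u n \<in> H10 \<Omega>" "u0 \<in> H10 \<Omega>" "(\<lambda>n. nsq (\<lambda>x. u n x - u0 x)) \<longlonglongrightarrow> 0"
    and v: "\<And>n. v n \<in> H10 \<Omega>" "v0 \<in> H10 \<Omega>" "(\<lambda>n. nsq (\<lambda>x. v n x - v0 x)) \<longlonglongrightarrow> 0"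
  shows "(\<lambda>n. frm (wgt (z n)) (u n) (v n)) \<longlonglongrightarrow> frm (wgt z0) u0 v0"
  unfolding frm_wgt_split[OF z(1) u(1) v(1)] frm_wgt_split[OF z(2) u(2) v(2)]
  by (intro tendsto_add tendsto_mult tendsto_const frm_V_tendsto[OF u v] quartic_tendsto[OF z z u v])

lemma nsq_tendsto_const: "u \<in> H10 \<Omega> \<Longrightarrow> (\<lambda>n. nsq (\<lambda>x. u x - u x)) \<longlonglongrightarrow> 0"
  using frm_lincomb_left[OF weight_one, of u u "\<lambda>x. 0" 0 0] H10_H1[of u] H10_H1[OF H10_zero]
  by (simp add: adm_one)

text \<open>The solution is the limit of a minimising sequence of the quadratic functional \<open>J\<close>, which is Cauchy
  by the parallelogram identity.\<close>

lemma Gop_exists: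
  assumes z: "z \<in> H10 \<Omega>" and f: "sqint M f"
  shows "\<exists>u\<in>H10 \<Omega>. \<forall>v\<in>H10 \<Omega>. frm (wgt z) u v = (\<integral>x. f x * v x \<partial>M)"
proof -
  let ?a = "frm (wgt z)"
  note W = wgt_weight[OF z] and A = wgt_adm[OF z]
  define l where "l v = (\<integral>x. f x * v x \<partial>M)" for v
  define J where "J v = ?a v v - 2 * l v" for v
  have l_lin: "l (\<lambda>x. a * u x + b * v x) = a * l u + b * l v" if "u \<in> H10 \<Omega>" "v \<in> H10 \<Omega>" for a b u v
  proof -
    have "l (\<lambda>x. a * u x + b * v x) = (\<integral>x. a * (f x * u x) + b * (f x * v x) \<partial>M)"
      by (simp add: l_def algebra_simps)
    then show ?thesis
      using sqint_mult_integrable[OF f H10_sqint[OF that(1)]] sqint_mult_integrable[OF f H10_sqint[OF that(2)]]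
      by (simp add: l_def)
  qed
  \<comment> \<open>Twice the inner product of f and v is at most the sum of their squared L2 norms,
    and coercivity absorbs the norm of v.\<close>
  have lb: "- (\<integral>x. (f x)\<^sup>2 \<partial>M) \<le> J v" if v: "v \<in> H10 \<Omega>" for v
  proof -
    have "0 \<le> (\<integral>x. (1 * f x + (-1) * v x)\<^sup>2 \<partial>M)" by (intro Bochner_Integration.integral_nonneg) simp
    then have "2 * l v \<le> (\<integral>x. (f x)\<^sup>2 \<partial>M) + (\<integral>x. (v x)\<^sup>2 \<partial>M)"
      unfolding integral_square_lincomb[OF f H10_sqint[OF v]] by (simp add: l_def)
    moreover have "(\<integral>x. (v x)\<^sup>2 \<partial>M) \<le> ?a v v"
      using L2_le_nsq[OF H10_H1[OF v]] nsq_le_frm[OF z v] by linarith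
    ultimately show ?thesis unfolding J_def by linarith
  qed
  have bdd: "bdd_below (J ` H10 \<Omega>)" using lb by (intro bdd_belowI2)
  define m where "m = Inf (J ` H10 \<Omega>)"
  have m_le: "m \<le> J v" if "v \<in> H10 \<Omega>" for v
    unfolding m_def using that by (intro cInf_lower bdd) auto
  have "\<exists>v. v \<in> H10 \<Omega> \<and> J v < m + 1 / real (Suc n)" for n
  proof -
    have "m < m + 1 / real (Suc n)" by simp
    then show ?thesis
      unfolding m_def using cInf_lessD[of "J ` H10 \<Omega>"] H10_zero by blast
  qed
  then have "\<forall>n. \<exists>v. v \<in> H10 \<Omega> \<and> J v < m + 1 / real (Suc n)" ..
  from choice[OF this] obtain u where "\<forall>n. u n \<in> H10 \<Omega> \<and> J (u n) < m + 1 / real (Suc n)" ..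
  then have u: "\<And>n. u n \<in> H10 \<Omega>" "\<And>n. J (u n) < m + 1 / real (Suc n)" by simp_all
  have par: "nsq (\<lambda>x. u i x - u j x) \<le> 2 / real (Suc i) + 2 / real (Suc j)" for i j
  proof -
    define w where "w = (\<lambda>x. (1/2) * u i x + (1/2) * u j x)"
    have w: "w \<in> H10 \<Omega>" unfolding w_def by (intro H10_lincomb u)
    have "4 * ?a w w = ?a (u i) (u i) + 2 * ?a (u i) (u j) + ?a (u j) (u j)"
      unfolding w_def frm_lincomb_square[OF W A[OF u(1)] A[OF u(1)]] by (simp add: power2_eq_square)
    moreover have "?a (\<lambda>x. u i x - u j x) (\<lambda>x. u i x - u j x) = ?a (u i) (u i) - 2 * ?a (u i) (u j) + ?a (u j) (u j)"
      using frm_lincomb_square[OF W A[OF u(1)] A[OF u(1)], of 1 i "-1" j] by simp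
    moreover have "2 * l w = l (u i) + l (u j)"
      unfolding w_def using l_lin[OF u(1) u(1), of "1/2" i "1/2" j] by simp
    ultimately have "?a (\<lambda>x. u i x - u j x) (\<lambda>x. u i x - u j x) = 2 * J (u i) + 2 * J (u j) - 4 * J w"
      by (simp add: J_def)
    then show ?thesis
      using nsq_le_frm[OF z H10_diff[OF u(1)[of i] u(1)[of j]]] m_le[OF w] u(2)[of i] u(2)[of j] by simp
  qed
  have "\<exists>N. \<forall>i\<ge>N. \<forall>j\<ge>N. nsq (\<lambda>x. u i x - u j x) < e" if e: "e > 0" for e
  proof -
    have "\<forall>\<^sub>F n in sequentially. 1 / real (Suc n) < e / 4"
      using e by (intro order_tendstoD(2)[OF LIMSEQ_Suc[OF lim_1_over_n]]) simp
    then obtain N where N: "\<And>n. n \<ge> N \<Longrightarrow> 1 / real (Suc n) < e / 4" unfolding eventually_sequentially by blast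
    have "nsq (\<lambda>x. u i x - u j x) < e" if "i \<ge> N" "j \<ge> N" for i j
      using par[of i j] N[OF that(1)] N[OF that(2)] by simp
    then show ?thesis by blast
  qed
  from H10_complete[of u, OF u(1) this] obtain u0 where u0: "u0 \<in> H10 \<Omega>" "(\<lambda>n. nsq (\<lambda>x. u n x - u0 x)) \<longlonglongrightarrow> 0"
    by blast
  have "(\<lambda>n. l (u n)) \<longlonglongrightarrow> l u0"
    unfolding l_def
    by (rule integral_mult_tendsto[OF f f _ H10_sqint[OF u(1)] H10_sqint[OF u0(1)]
          nsq_tendsto_imp_L2_tendsto[OF H10_H1[OF u(1)] H10_H1[OF u0(1)] u0(2)]]) simp
  moreover have "(\<lambda>n. ?a (u n) (u n)) \<longlonglongrightarrow> ?a u0 u0"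
    by (rule frm_wgt_tendsto[OF z z nsq_tendsto_const[OF z] u(1) u0 u(1) u0])
  ultimately have "(\<lambda>n. J (u n)) \<longlonglongrightarrow> J u0" unfolding J_def by (intro tendsto_intros)
  moreover have "(\<lambda>n. m + 1 / real (Suc n)) \<longlonglongrightarrow> m + 0"
    by (intro tendsto_intros LIMSEQ_Suc[OF lim_1_over_n])
  ultimately have Jm: "J u0 \<le> m"
    using u(2) by (intro LIMSEQ_le[of "\<lambda>n. J (u n)" "J u0" "\<lambda>n. m + 1 / real (Suc n)" m]) (auto intro: less_imp_le)
  have "?a u0 v = l v" if v: "v \<in> H10 \<Omega>" for v
  proof -
    define B where "B = ?a u0 v - l v"
    have q: "0 \<le> 2 * t * B + t\<^sup>2 * ?a v v" for t
    proof -
      have "J (\<lambda>x. 1 * u0 x + t * v x) = J u0 + (2 * t * B + t\<^sup>2 * ?a v v)"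
        unfolding J_def B_def frm_lincomb_square[OF W A[OF u0(1)] A[OF v]] l_lin[OF u0(1) v]
        by (simp add: algebra_simps)
      moreover have "m \<le> J (\<lambda>x. 1 * u0 x + t * v x)" by (rule m_le[OF H10_lincomb[OF u0(1) v]])
      ultimately show ?thesis using Jm by linarith
    qed
    \<comment> \<open>Minimality at \<open>u0\<close> gives \<open>q\<close> for all t. Homogenised
      in (s, t) this is the hypothesis of the discriminant lemma with A = 0, so the first variation
      \<open>B\<close> vanishes.\<close>
    have "B\<^sup>2 \<le> 0 * ?a v v"
    proof (rule nonneg_quadratic_discriminant)
      fix s t :: real
      show "0 \<le> s\<^sup>2 * 0 + 2 * s * t * B + t\<^sup>2 * ?a v v"
      proof (cases "s = 0")
        case True
        then show ?thesis using frm_nonneg[OF W, of v] by simp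
      next
        case False
        have "0 \<le> s\<^sup>2 * (2 * (t / s) * B + (t / s)\<^sup>2 * ?a v v)" by (intro mult_nonneg_nonneg q) simp
        also have "\<dots> = 2 * s * t * B + t\<^sup>2 * ?a v v"
          using False by (simp add: field_simps power2_eq_square)
        finally show ?thesis by simp
      qed
    qed
    then show ?thesis by (simp add: B_def)
  qed
  then show ?thesis using u0(1) unfolding l_def by blast
qed

lemma Gop_spec:
  assumes z: "z \<in> H10 \<Omega>" and f: "sqint M f"
  shows "Gop \<Omega> V \<beta> z f \<in> H10 \<Omega>"
    and "v \<in> H10 \<Omega> \<Longrightarrow> frm (wgt z) (Gop \<Omega> V \<beta> z f) v = (\<integral>x. f x * v x \<partial>M)"
proof -
  have "\<exists>u. u \<in> H10 \<Omega> \<and> (\<forall>v\<in>H10 \<Omega>. aform \<Omega> V \<beta> z u v = L2inner \<Omega> f v)"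
    using Gop_exists[OF assms] by (auto simp: aform_eq_frm L2inner_def)
  from someI_ex[OF this]
  have "Gop \<Omega> V \<beta> z f \<in> H10 \<Omega> \<and> (\<forall>v\<in>H10 \<Omega>. aform \<Omega> V \<beta> z (Gop \<Omega> V \<beta> z f) v = L2inner \<Omega> f v)"
    unfolding Gop_def .
  then show "Gop \<Omega> V \<beta> z f \<in> H10 \<Omega>"
    and "v \<in> H10 \<Omega> \<Longrightarrow> frm (wgt z) (Gop \<Omega> V \<beta> z f) v = (\<integral>x. f x * v x \<partial>M)"
    by (auto simp: aform_eq_frm L2inner_def)
qed

text \<open>Uniqueness in the variational problem: the difference has vanishing form, and coercivity
  applies. Only equality almost everywhere can be expected, as \<open>Gop\<close> is a
  choice.\<close>

lemma H10_eq_AE: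
  assumes z: "z \<in> H10 \<Omega>" and u: "u \<in> H10 \<Omega>" "w \<in> H10 \<Omega>" and e: "\<And>v. v \<in> H10 \<Omega> \<Longrightarrow> frm (wgt z) u v = frm (wgt z) w v"
  shows "AE x in M. u x = w x"
proof -
  note d = H10_diff[OF u]
  have "frm (wgt z) (\<lambda>x. u x - w x) (\<lambda>x. u x - w x) = 0"
    using frm_lincomb_left[OF wgt_weight[OF z] wgt_adm[OF z u(1)] wgt_adm[OF z u(2)] wgt_adm[OF z d], of 1 "-1"] e[OF d] by simp
  then have "(\<integral>x. (u x - w x)\<^sup>2 \<partial>M) \<le> 0"
    using L2_le_nsq[OF H10_H1[OF d]] nsq_le_frm[OF z d] by linarith
  moreover have "0 \<le> (\<integral>x. (u x - w x)\<^sup>2 \<partial>M)" by simp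
  ultimately have "(\<integral>x. (u x - w x)\<^sup>2 \<partial>M) = 0" by linarith
  then have "AE x in M. (u x - w x)\<^sup>2 = 0"
    using sqint_int[OF H10_sqint[OF d]] by (subst (asm) integral_nonneg_eq_0_iff_AE) auto
  then show ?thesis by eventually_elim simp
qed

end

section \<open>Identities and energy gain for a single step\<close>

section \<open>One step of the iteration\<close>

context bounded_open
begin

lemma L2norm_eq_1_iff: "L2norm \<Omega> u = 1 \<longleftrightarrow> (\<integral>x. (u x)\<^sup>2 \<partial>M) = 1"
  by (simp add: L2norm_def)

end

text \<open>The coefficient 6 of z^2 d^2 is split as 2 + 4. The part with 2 completes the quadratic
  term of a_z(d, d) in the energy, and the part with 4 completes the higher terms to a product of
  squares.\<close>

lemma quartic_expand:
  fixes z d t :: real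
  shows "(z + t * d)^4 = z^4 + 4 * t * ((z * z) * (z * d)) + 2 * t\<^sup>2 * ((z * z) * (d * d))
    + 4 * t\<^sup>2 * ((d * d) * ((z + t / 2 * d) * (z + t / 2 * d)))"
proof -
  define s where "s = t / 2"
  have t: "t = 2 * s" by (simp add: s_def)
  show ?thesis unfolding t by (simp, algebra)
qed

context GPE
begin

lemma quartic_eq:
  fixes u :: "'a \<Rightarrow> real"
  shows "(\<integral>x. (u x * u x) * (u x * u x) \<partial>M) = (\<integral>x. (u x)^4 \<partial>M)"
  by (simp add: power4_eq_xxxx mult.assoc)

lemma energy_eq:
  assumes v: "v \<in> H10 \<Omega>"
  shows "energy \<Omega> V \<beta> v = frm V v v / 2 + \<beta> / 4 * (\<integral>x. (v x)^4 \<partial>M)"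
proof -
  have "energy \<Omega> V \<beta> v = (1/2) * (\<integral>x. (grad \<Omega> v x \<bullet> grad \<Omega> v x + V x * (v x * v x)) + (\<beta>/2) * (v x)^4 \<partial>M)"
    unfolding energy_def power2_norm_eq_inner by (simp add: power2_eq_square mult.assoc)
  also have "(\<integral>x. (grad \<Omega> v x \<bullet> grad \<Omega> v x + V x * (v x * v x)) + (\<beta>/2) * (v x)^4 \<partial>M)
      = frm V v v + (\<beta>/2) * (\<integral>x. (v x)^4 \<partial>M)"
    unfolding frm_def using frm_integrable[OF V_weight V_adm[OF v] V_adm[OF v]] qint_int[OF H10_qint[OF v]] by simp
  finally show ?thesis by simp
qed

lemma energy_nonneg: "v \<in> H10 \<Omega> \<Longrightarrow> 0 \<le> energy \<Omega> V \<beta> v"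
  using frm_nonneg[OF V_weight, of v] beta_nonneg by (simp add: energy_eq)

text \<open>In 4 E the quartic part is exactly that of a_z(z, z), while the quadratic part occurs
  twice.\<close>

lemma frm_le_energy:
  assumes z: "z \<in> H10 \<Omega>" shows "frm (wgt z) z z \<le> 4 * energy \<Omega> V \<beta> z"
  using frm_nonneg[OF V_weight, of z] unfolding frm_wgt_split[OF z z z] energy_eq[OF z] quartic_eq by simp

lemma L4_le_nsq:
  assumes u: "u \<in> H10 \<Omega>" shows "(\<integral>x. (u x)^4 \<partial>M) \<le> 8 * (nsq u)\<^sup>2"
proof -
  have n: "0 \<le> nsq u" by (rule frm_nonneg[OF weight_one])
  have "64 * (\<integral>x. (u x)\<^sup>2 \<partial>M) * (nsq u)^3 \<le> 64 * nsq u * (nsq u)^3"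
    using L2_le_nsq[OF H10_H1[OF u]] n by (intro mult_right_mono) auto
  also have "\<dots> = (8 * (nsq u)\<^sup>2)\<^sup>2" by (simp add: power2_eq_square power3_eq_cube)
  finally have "sqrt (64 * (\<integral>x. (u x)\<^sup>2 \<partial>M) * (nsq u)^3) \<le> 8 * (nsq u)\<^sup>2"
    by (intro real_le_lsqrt) auto
  then show ?thesis using Gagliardo_Nirenberg(2)[OF u] by linarith
qed

definition dir :: "('a \<Rightarrow> real) \<Rightarrow> 'a \<Rightarrow> real" where
  "dir z x = gf_gamma \<Omega> V \<beta> z * Gop \<Omega> V \<beta> z z x - z x"

lemma gf_hat_eq: "gf_hat \<Omega> V \<beta> t z = (\<lambda>x. z x + t * dir z x)"
  by (simp add: gf_hat_def dir_def fun_eq_iff algebra_simps)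

context
  fixes z assumes z: "z \<in> H10 \<Omega>" and n: "(\<integral>x. (z x)\<^sup>2 \<partial>M) = 1"
begin

abbreviation "Gz \<equiv> Gop \<Omega> V \<beta> z z"
abbreviation "gz \<equiv> gf_gamma \<Omega> V \<beta> z"
abbreviation "az \<equiv> frm (wgt z)"

lemma Gz: "Gz \<in> H10 \<Omega>" and Gz_eq: "v \<in> H10 \<Omega> \<Longrightarrow> az Gz v = (\<integral>x. z x * v x \<partial>M)"
  using Gop_spec[OF z H10_sqint[OF z]] by blast+

lemma zz: "(\<integral>x. z x * z x \<partial>M) = 1"
  using n by (simp add: power2_eq_square)

text \<open>Since a_z(G z, z) = (z, z) = 1, Cauchy-Schwarz excludes a_z(G z, G z) = 0. The second
  identity is what makes the direction orthogonal to z.\<close>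

lemma gz_props: "0 < gz" "gz * (\<integral>x. z x * Gz x \<partial>M) = 1"
proof -
  note W = wgt_weight[OF z] and A = wgt_adm[OF z]
  have "(az Gz z)\<^sup>2 \<le> az Gz Gz * az z z" by (rule frm_Cauchy_Schwarz[OF W A[OF Gz] A[OF z]])
  then have "az Gz Gz \<noteq> 0" by (auto simp: Gz_eq[OF z] zz)
  then have p: "0 < az Gz Gz" using frm_nonneg[OF W, of Gz] by linarith
  have g: "gz = 1 / az Gz Gz" unfolding gf_gamma_def aform_eq_frm L2inner_def zz ..
  show "0 < gz" "gz * (\<integral>x. z x * Gz x \<partial>M) = 1"
    unfolding g using p by (simp_all add: Gz_eq[OF Gz])
qed

lemma dir_H10: "dir z \<in> H10 \<Omega>"
  using H10_lincomb[OF Gz z, of gz "-1"] by (simp add: dir_def[abs_def])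

lemma dir_orth: "(\<integral>x. z x * dir z x \<partial>M) = 0"
proof -
  have "(\<integral>x. z x * dir z x \<partial>M) = (\<integral>x. gz * (z x * Gz x) - z x * z x \<partial>M)"
    by (simp add: dir_def algebra_simps)
  also have "\<dots> = gz * (\<integral>x. z x * Gz x \<partial>M) - (\<integral>x. z x * z x \<partial>M)"
    using sqint_mult_integrable[OF H10_sqint[OF z] H10_sqint[OF Gz]] sqint_mult_integrable[OF H10_sqint[OF z] H10_sqint[OF z]]
    by simp
  finally show ?thesis by (simp add: gz_props zz)
qed

text \<open>The direction represents the residual of the eigenvalue equation in the inner product
  \<open>az\<close>, so smallness of \<open>az (dir z) (dir z)\<close> means that z almost solves
  the equation.\<close>

lemma az_dir: "v \<in> H10 \<Omega> \<Longrightarrow> az (dir z) v = gz * (\<integral>x. z x * v x \<partial>M) - az z v"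
  using frm_lincomb_left[OF wgt_weight[OF z] wgt_adm[OF z Gz] wgt_adm[OF z z] wgt_adm[OF z], of v gz "-1"] Gz_eq[of v]
  by (simp add: dir_def[abs_def])

text \<open>The residual identity tested with the direction itself; orthogonality removes the term
  with \<open>gz\<close>. The left-hand side is the slope of the energy at z along the
  direction.\<close>

lemma az_z_dir: "az z (dir z) = - az (dir z) (dir z)"
  using az_dir[OF dir_H10] by (simp add: dir_orth)

text \<open>Links the residual to \<open>gz\<close>: it bounds \<open>gz\<close> by the form at z,
  and it identifies the limit of \<open>gz\<close> once the residual vanishes.\<close>

lemma az_dir_dir: "az (dir z) (dir z) = az z z - gz"
  using az_dir[OF z] az_z_dir frm_sym[of "wgt z" z "dir z"] by (simp add: zz)

lemma gf_hat_H10: "gf_hat \<Omega> V \<beta> t z \<in> H10 \<Omega>"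
  unfolding gf_hat_eq using H10_lincomb[OF z dir_H10, of 1 t] by simp

lemma gf_hat_square: "(\<integral>x. (gf_hat \<Omega> V \<beta> t z x)\<^sup>2 \<partial>M) = 1 + t\<^sup>2 * (\<integral>x. (dir z x)\<^sup>2 \<partial>M)"
  unfolding gf_hat_eq
  using integral_square_lincomb[OF H10_sqint[OF z] H10_sqint[OF dir_H10], of 1 t] by (simp add: n dir_orth)

lemma energy_gf_hat:
  "energy \<Omega> V \<beta> (gf_hat \<Omega> V \<beta> t z) = energy \<Omega> V \<beta> z - t * (1 - t / 2) * az (dir z) (dir z)
    + \<beta> * t\<^sup>2 * (\<integral>x. (dir z x * dir z x) * ((z x + t / 2 * dir z x) * (z x + t / 2 * dir z x)) \<partial>M)"
proof -
  define d where "d = dir z"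
  have d: "d \<in> H10 \<Omega>" unfolding d_def by (rule dir_H10)
  define y where "y x = z x + t / 2 * d x" for x
  have y: "y \<in> H10 \<Omega>" using H10_lincomb[OF z d, of 1 "t / 2"] by (simp add: y_def[abs_def])
  note q = z[THEN H10_qint] d[THEN H10_qint] y[THEN H10_qint]
  have "(\<integral>x. (z x + t * d x)^4 \<partial>M) = (\<integral>x. (z x)^4 + 4 * t * ((z x * z x) * (z x * d x))
      + 2 * t\<^sup>2 * ((z x * z x) * (d x * d x)) + 4 * t\<^sup>2 * ((d x * d x) * (y x * y x)) \<partial>M)"
    unfolding y_def by (intro Bochner_Integration.integral_cong refl quartic_expand)
  also have "\<dots> = (\<integral>x. (z x)^4 \<partial>M) + 4 * t * (\<integral>x. (z x * z x) * (z x * d x) \<partial>M)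
      + 2 * t\<^sup>2 * (\<integral>x. (z x * z x) * (d x * d x) \<partial>M) + 4 * t\<^sup>2 * (\<integral>x. (d x * d x) * (y x * y x) \<partial>M)"
    using qint_int[OF q(1)] quartic_integrable[OF q(1) q(1) q(1) q(2)] quartic_integrable[OF q(1) q(1) q(2) q(2)]
      quartic_integrable[OF q(2) q(2) q(3) q(3)] by simp
  finally have Q: "(\<integral>x. (z x + t * d x)^4 \<partial>M) = (\<integral>x. (z x)^4 \<partial>M) + 4 * t * (\<integral>x. (z x * z x) * (z x * d x) \<partial>M)
      + 2 * t\<^sup>2 * (\<integral>x. (z x * z x) * (d x * d x) \<partial>M) + 4 * t\<^sup>2 * (\<integral>x. (d x * d x) * (y x * y x) \<partial>M)" .
  have F: "frm V (\<lambda>x. z x + t * d x) (\<lambda>x. z x + t * d x) = frm V z z + 2 * t * frm V z d + t\<^sup>2 * frm V d d"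
    using frm_lincomb_square[OF V_weight V_adm[OF z] V_adm[OF d], of 1 t] by simp
  have h: "(\<lambda>x. z x + t * d x) \<in> H10 \<Omega>" using gf_hat_H10[of t] by (simp add: gf_hat_eq d_def)
  \<comment> \<open>The terms linear in t assemble to a_z(z, d) and part of those quadratic in t to
    a_z(d, d), so both are multiples of the residual.\<close>
  have a: "frm V z d + \<beta> * (\<integral>x. (z x * z x) * (z x * d x) \<partial>M) = - az d d"
    "frm V d d + \<beta> * (\<integral>x. (z x * z x) * (d x * d x) \<partial>M) = az d d"
    using frm_wgt_split[OF z z d] frm_wgt_split[OF z d d] az_z_dir by (simp_all add: d_def)
  have "energy \<Omega> V \<beta> (\<lambda>x. z x + t * d x) = energy \<Omega> V \<beta> z
      + t * (frm V z d + \<beta> * (\<integral>x. (z x * z x) * (z x * d x) \<partial>M))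
      + t\<^sup>2 / 2 * (frm V d d + \<beta> * (\<integral>x. (z x * z x) * (d x * d x) \<partial>M))
      + \<beta> * t\<^sup>2 * (\<integral>x. (d x * d x) * (y x * y x) \<partial>M)"
    unfolding energy_eq[OF h] energy_eq[OF z] F Q by (simp add: algebra_simps)
  also have "\<dots> = energy \<Omega> V \<beta> z - t * (1 - t / 2) * az d d + \<beta> * t\<^sup>2 * (\<integral>x. (d x * d x) * (y x * y x) \<partial>M)"
    unfolding a by (simp add: algebra_simps power2_eq_square)
  finally show ?thesis by (simp add: gf_hat_eq d_def y_def)
qed

lemma gf_step_props:
  shows "gf_step \<Omega> V \<beta> t z \<in> H10 \<Omega>" and "(\<integral>x. (gf_step \<Omega> V \<beta> t z x)\<^sup>2 \<partial>M) = 1"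
    and "energy \<Omega> V \<beta> (gf_step \<Omega> V \<beta> t z) + t\<^sup>2 / 2 * (\<integral>x. (dir z x)\<^sup>2 \<partial>M) \<le> energy \<Omega> V \<beta> (gf_hat \<Omega> V \<beta> t z)"
proof -
  define h where "h = gf_hat \<Omega> V \<beta> t z"
  have h: "h \<in> H10 \<Omega>" unfolding h_def by (rule gf_hat_H10)
  define N where "N = (\<integral>x. (h x)\<^sup>2 \<partial>M)"
  have N: "N = 1 + t\<^sup>2 * (\<integral>x. (dir z x)\<^sup>2 \<partial>M)" unfolding N_def h_def by (rule gf_hat_square)
  have N1: "1 \<le> N" unfolding N by simp
  define c where "c = 1 / sqrt N"
  have c2: "c\<^sup>2 = 1 / N" using N1 by (simp add: c_def power_divide)
  have s: "gf_step \<Omega> V \<beta> t z = (\<lambda>x. c * h x)"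
    by (simp add: gf_step_def c_def N_def h_def L2norm_def)
  show sh: "gf_step \<Omega> V \<beta> t z \<in> H10 \<Omega>" unfolding s by (rule H10_cmult[OF h])
  have "(\<integral>x. (c * h x)\<^sup>2 \<partial>M) = c\<^sup>2 * N" by (simp add: N_def power_mult_distrib)
  also have "\<dots> = 1" using N1 by (simp add: c2)
  finally show "(\<integral>x. (gf_step \<Omega> V \<beta> t z x)\<^sup>2 \<partial>M) = 1" unfolding s .
  have F: "frm V (\<lambda>x. c * h x) (\<lambda>x. c * h x) = c\<^sup>2 * frm V h h"
    using frm_lincomb_square[OF V_weight V_adm[OF h] V_adm[OF h], of c 0] by simp
  have Q: "(\<integral>x. (c * h x)^4 \<partial>M) = c^4 * (\<integral>x. (h x)^4 \<partial>M)" by (simp add: power_mult_distrib)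
  have c1: "c\<^sup>2 \<le> 1" unfolding c2 using N1 by simp
  then have c4: "c^4 \<le> 1" using power_mono[of "c\<^sup>2" 1 2] by simp
  have V: "N \<le> frm V h h"
    using L2_le_nsq[OF H10_H1[OF h]] nsq_le_frm[OF H10_zero h] by (simp add: N_def zero_wgt)
  have "energy \<Omega> V \<beta> (\<lambda>x. c * h x) = c\<^sup>2 * frm V h h / 2 + \<beta> / 4 * (c^4 * (\<integral>x. (h x)^4 \<partial>M))"
    using energy_eq[OF sh] unfolding s F Q .
  \<comment> \<open>For the quartic term only the sign of the change is used. The quantitative gain
    comes from the quadratic part, where the form is at least \<open>N\<close> by V >= 1.\<close>
  also have "\<beta> / 4 * (c^4 * (\<integral>x. (h x)^4 \<partial>M)) \<le> \<beta> / 4 * (\<integral>x. (h x)^4 \<partial>M)"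
    using beta_nonneg c4 by (intro mult_left_mono mult_left_le_one_le) auto
  also have "c\<^sup>2 * frm V h h / 2 + \<beta> / 4 * (\<integral>x. (h x)^4 \<partial>M) = energy \<Omega> V \<beta> h - (1 - c\<^sup>2) * frm V h h / 2"
    unfolding energy_eq[OF h] by (simp add: algebra_simps diff_divide_distrib)
  also have "\<dots> \<le> energy \<Omega> V \<beta> h - (1 - c\<^sup>2) * N / 2"
    using c1 V by (intro diff_left_mono divide_right_mono mult_left_mono) auto
  also have "(1 - c\<^sup>2) * N = N - 1"
    using N1 unfolding c2 by (simp add: left_diff_distrib)
  also have "N - 1 = t\<^sup>2 * (\<integral>x. (dir z x)\<^sup>2 \<partial>M)" by (simp add: N)
  finally show "energy \<Omega> V \<beta> (gf_step \<Omega> V \<beta> t z) + t\<^sup>2 / 2 * (\<integral>x. (dir z x)\<^sup>2 \<partial>M) \<le> energy \<Omega> V \<beta> (gf_hat \<Omega> V \<beta> t z)"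
    unfolding s h_def by simp
qed

end

end

section \<open>Vanishing residual, compactness and passage to the limit\<close>

section \<open>Convergence of the iteration\<close>

locale GPE_iteration = GPE \<Omega> V \<beta> for \<Omega> :: "'a::euclidean_space set" and V \<beta> +
  fixes z0 :: "'a \<Rightarrow> real" and \<tau> :: "nat \<Rightarrow> real" and \<tau>min \<tau>max :: real
  assumes z0: "z0 \<in> H10 \<Omega>" "L2norm \<Omega> z0 = 1"
    and tau_bounds: "0 < \<tau>min" "\<tau>max < 2" "\<And>n. \<tau>min \<le> \<tau> n" "\<And>n. \<tau> n \<le> \<tau>max"
    and hat_decrease: "\<And>n. energy \<Omega> V \<beta> (gf_hat \<Omega> V \<beta> (\<tau> n) (gf_seq \<Omega> V \<beta> \<tau> z0 n))
      \<le> energy \<Omega> V \<beta> (gf_seq \<Omega> V \<beta> \<tau> z0 n)"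
begin

abbreviation z :: "nat \<Rightarrow> 'a \<Rightarrow> real" where "z \<equiv> gf_seq \<Omega> V \<beta> \<tau> z0"
abbreviation E :: "nat \<Rightarrow> real" where "E n \<equiv> energy \<Omega> V \<beta> (z n)"
abbreviation hat :: "nat \<Rightarrow> 'a \<Rightarrow> real" where "hat n \<equiv> gf_hat \<Omega> V \<beta> (\<tau> n) (z n)"
abbreviation \<gamma> :: "nat \<Rightarrow> real" where "\<gamma> n \<equiv> gf_gamma \<Omega> V \<beta> (z n)"
abbreviation res :: "nat \<Rightarrow> real" where "res n \<equiv> frm (wgt (z n)) (dir (z n)) (dir (z n))"

text \<open>By \<open>frm_le_energy\<close> and decreasing energies this bounds a_z(z, z) at every
  iterate, and with it the squared H1 norm, the residual and \<open>\<gamma>\<close>.\<close>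

definition K :: real where "K = 4 * E 0"
definition Estar :: real where "Estar = lim E"

lemma z_props: "z n \<in> H10 \<Omega> \<and> (\<integral>x. (z n x)\<^sup>2 \<partial>M) = 1"
proof (induction n)
  case 0
  then show ?case using z0 by (simp add: L2norm_eq_1_iff)
next
  case (Suc n)
  then show ?case using gf_step_props(1,2)[of "z n" "\<tau> n"] by simp
qed

lemma z_H10: "z n \<in> H10 \<Omega>" and z_unit: "(\<integral>x. (z n x)\<^sup>2 \<partial>M) = 1"
  using z_props by auto

lemma step_decrease:
  "E (Suc n) + (\<tau> n)\<^sup>2 / 2 * (\<integral>x. (dir (z n) x)\<^sup>2 \<partial>M) \<le> energy \<Omega> V \<beta> (hat n)"
  using gf_step_props(3)[OF z_H10 z_unit, of "\<tau> n" n] by simp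

lemma E_Suc_le_hat: "E (Suc n) \<le> energy \<Omega> V \<beta> (hat n)"
  using step_decrease[of n] by (smt (verit) Bochner_Integration.integral_nonneg mult_nonneg_nonneg zero_le_divide_iff zero_le_power2)

lemma E_decseq: "decseq E"
  by (rule decseq_SucI) (rule order_trans[OF E_Suc_le_hat hat_decrease])

lemma E_tendsto: "E \<longlonglongrightarrow> Estar"
proof -
  obtain L where "E \<longlonglongrightarrow> L"
    using decseq_convergent[OF E_decseq, of 0] energy_nonneg[OF z_H10] by blast
  then show ?thesis unfolding Estar_def by (simp add: limI)
qed

lemma E_diff_tendsto_0: "(\<lambda>n. E n - E (Suc n)) \<longlonglongrightarrow> 0"
  using tendsto_diff[OF E_tendsto LIMSEQ_Suc[OF E_tendsto]] by simp

lemma form_le_K: "frm (wgt (z n)) (z n) (z n) \<le> K"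
  using frm_le_energy[OF z_H10[of n]] decseqD[OF E_decseq, of 0 n] by (simp add: K_def)

lemma nsq_z_le: "nsq (z n) \<le> K"
  using nsq_le_frm[OF z_H10 z_H10, of n n] form_le_K[of n] by linarith

lemma d_H10: "dir (z n) \<in> H10 \<Omega>"
  by (rule dir_H10[OF z_H10 z_unit])

lemma res_eq: "res n = frm (wgt (z n)) (z n) (z n) - \<gamma> n"
  by (rule az_dir_dir[OF z_H10 z_unit])

lemma gamma_pos: "0 < \<gamma> n"
  by (rule gz_props(1)[OF z_H10 z_unit])

lemma res_nonneg: "0 \<le> res n"
  by (rule frm_nonneg[OF wgt_weight[OF z_H10]])

lemma res_le_K: "res n \<le> K" and gamma_le_K: "\<gamma> n \<le> K"
  using res_eq[of n] gamma_pos[of n] form_le_K[of n] res_nonneg[of n] by linarith+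

lemma nsq_d_le_res: "nsq (dir (z n)) \<le> res n"
  by (rule nsq_le_frm[OF z_H10 d_H10])

lemma tau_pos: "0 < \<tau> n" "\<tau> n < 2"
  using tau_bounds(1,2) tau_bounds(3,4)[of n] by linarith+

lemma L2_d_tendsto_0: "(\<lambda>n. \<integral>x. (dir (z n) x)\<^sup>2 \<partial>M) \<longlonglongrightarrow> 0"
proof (rule tendsto_sandwich[OF _ _ tendsto_const])
  show "(\<lambda>n. 2 / \<tau>min\<^sup>2 * (E n - E (Suc n))) \<longlonglongrightarrow> 0"
    using tendsto_mult[OF tendsto_const E_diff_tendsto_0, of "2 / \<tau>min\<^sup>2"] by (simp only: mult_zero_right)
  have "(\<integral>x. (dir (z n) x)\<^sup>2 \<partial>M) \<le> 2 / \<tau>min\<^sup>2 * (E n - E (Suc n))" for n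
  proof -
    have "\<tau>min\<^sup>2 / 2 * (\<integral>x. (dir (z n) x)\<^sup>2 \<partial>M) \<le> (\<tau> n)\<^sup>2 / 2 * (\<integral>x. (dir (z n) x)\<^sup>2 \<partial>M)"
      using tau_bounds(1) tau_bounds(3)[of n] by (intro mult_right_mono divide_right_mono power_mono) auto
    also have "\<dots> \<le> E n - E (Suc n)"
      using step_decrease[of n] hat_decrease[of n] by linarith
    finally show ?thesis using tau_bounds(1) by (simp add: field_simps)
  qed
  then show "\<forall>\<^sub>F n in sequentially. (\<integral>x. (dir (z n) x)\<^sup>2 \<partial>M) \<le> 2 / \<tau>min\<^sup>2 * (E n - E (Suc n))" by simp
qed (auto intro!: always_eventually)

lemma L4_d_tendsto_0: "(\<lambda>n. \<integral>x. (dir (z n) x)^4 \<partial>M) \<longlonglongrightarrow> 0"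
  by (rule nsq_tendsto_imp_L4_tendsto[OF d_H10 L2_d_tendsto_0, of K])
     (rule order_trans[OF nsq_d_le_res res_le_K])

lemma L4_le_K:
  assumes "u \<in> H10 \<Omega>" "nsq u \<le> K" shows "(\<integral>x. (u x)^4 \<partial>M) \<le> 8 * K\<^sup>2"
proof -
  have "(nsq u)\<^sup>2 \<le> K\<^sup>2" by (intro power_mono assms frm_nonneg[OF weight_one])
  then show ?thesis using L4_le_nsq[OF assms(1)] by linarith
qed

lemma res_tendsto_0: "res \<longlonglongrightarrow> 0"
proof -
  define y where "y n x = z n x + \<tau> n / 2 * dir (z n) x" for n x
  define q where "q n = (\<integral>x. (dir (z n) x * dir (z n) x) * (y n x * y n x) \<partial>M)" for n
  have y: "y n \<in> H10 \<Omega>" for n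
    using H10_lincomb[OF z_H10[of n] d_H10[of n], of 1 "\<tau> n / 2"] by (simp add: y_def[abs_def])
  \<comment> \<open>128 is 8 times 8 plus 8 times 8: the factor 8 for the fourth power of a sum,
    times the L4 bound 8 K^2 of the iterate and of the direction, with half the step below
    1.\<close>
  have y4: "(\<integral>x. (y n x)^4 \<partial>M) \<le> 128 * K\<^sup>2" for n
  proof -
    note d4 = qint_cmult[OF H10_qint[OF d_H10[of n]], of "\<tau> n / 2"]
    have "(\<integral>x. (y n x)^4 \<partial>M) \<le> 8 * (\<integral>x. (z n x)^4 \<partial>M) + 8 * (\<integral>x. (\<tau> n / 2 * dir (z n) x)^4 \<partial>M)"
      unfolding y_def by (rule qint_add(2)[OF H10_qint[OF z_H10] d4])
    also have "(\<integral>x. (\<tau> n / 2 * dir (z n) x)^4 \<partial>M) = (\<tau> n / 2)^4 * (\<integral>x. (dir (z n) x)^4 \<partial>M)"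
      unfolding power_mult_distrib by (rule integral_mult_right_zero)
    also have "\<dots> \<le> 1 * (\<integral>x. (dir (z n) x)^4 \<partial>M)"
      using tau_pos[of n] by (intro mult_right_mono power_le_one Bochner_Integration.integral_nonneg) auto
    finally show ?thesis
      using L4_le_K[OF z_H10 nsq_z_le, of n] L4_le_K[OF d_H10 order_trans[OF nsq_d_le_res res_le_K], of n]
      by linarith
  qed
  have q0: "q \<longlonglongrightarrow> 0"
    unfolding q_def
  proof (rule integral_mult_tendsto_0)
    show "sqint M (\<lambda>x. dir (z n) x * dir (z n) x)" "sqint M (\<lambda>x. y n x * y n x)" for n
      by (intro qint_mult_sqint H10_qint d_H10 y)+
    show "(\<lambda>n. \<integral>x. (dir (z n) x * dir (z n) x)\<^sup>2 \<partial>M) \<longlonglongrightarrow> 0"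
      using L4_d_tendsto_0 by (simp add: power4_eq_xxxx power2_eq_square mult.assoc)
    show "(\<integral>x. (y n x * y n x)\<^sup>2 \<partial>M) \<le> 128 * K\<^sup>2" for n
      using y4[of n] by (simp add: power4_eq_xxxx power2_eq_square mult.assoc)
  qed
  \<comment> \<open>A positive lower bound of t (1 - t/2) over all admissible steps.\<close>
  define c where "c = \<tau>min * (1 - \<tau>max / 2)"
  have c: "0 < c" using tau_bounds by (simp add: c_def)
  have "res n \<le> (1 / c) * ((E n - E (Suc n)) + \<beta> * 4 * \<bar>q n\<bar>)" for n
  proof -
    have "energy \<Omega> V \<beta> (hat n) = E n - \<tau> n * (1 - \<tau> n / 2) * res n + \<beta> * (\<tau> n)\<^sup>2 * q n"
      unfolding q_def y_def by (rule energy_gf_hat[OF z_H10 z_unit])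
    moreover have "c * res n \<le> \<tau> n * (1 - \<tau> n / 2) * res n"
      unfolding c_def using tau_bounds(1,2) tau_bounds(3,4)[of n]
      by (intro mult_right_mono mult_mono res_nonneg) auto
    moreover have "\<beta> * (\<tau> n)\<^sup>2 * q n \<le> \<beta> * 4 * \<bar>q n\<bar>"
    proof -
      have "\<beta> * (\<tau> n)\<^sup>2 * q n \<le> \<beta> * (\<tau> n)\<^sup>2 * \<bar>q n\<bar>"
        using beta_nonneg by (intro mult_left_mono) auto
      also have "\<dots> \<le> \<beta> * 4 * \<bar>q n\<bar>"
        using power_mono[of "\<tau> n" 2 2] tau_pos[of n] beta_nonneg
        by (intro mult_right_mono mult_left_mono) auto
      finally show ?thesis .
    qed
    ultimately have "c * res n \<le> (E n - E (Suc n)) + \<beta> * 4 * \<bar>q n\<bar>"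
      using E_Suc_le_hat[of n] by linarith
    then show ?thesis using c by (simp add: field_simps)
  qed
  note le = this
  have "(\<lambda>n. (1 / c) * ((E n - E (Suc n)) + \<beta> * 4 * \<bar>q n\<bar>)) \<longlonglongrightarrow> (1 / c) * (0 + \<beta> * 4 * \<bar>0\<bar>)"
    by (intro tendsto_mult tendsto_add tendsto_const tendsto_rabs E_diff_tendsto_0 q0)
  then have up: "(\<lambda>n. (1 / c) * ((E n - E (Suc n)) + \<beta> * 4 * \<bar>q n\<bar>)) \<longlonglongrightarrow> 0"
    by (simp only: abs_zero mult_zero_right add_0_right)
  show ?thesis
    by (rule tendsto_sandwich[OF _ _ tendsto_const up]) (intro always_eventually allI res_nonneg le)+
qed

lemma nsq_d_tendsto_0: "(\<lambda>n. nsq (dir (z n))) \<longlonglongrightarrow> 0"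
  by (rule tendsto_sandwich[OF _ _ tendsto_const res_tendsto_0])
     (auto intro!: always_eventually nsq_d_le_res frm_nonneg[OF weight_one])

text \<open>The approximate eigenvalue equation with the density term on the right. The form on the
  left is the same for all iterates, so two such equations can be subtracted.\<close>

lemma frm_V_z:
  assumes v: "v \<in> H10 \<Omega>"
  shows "frm V (z n) v = \<gamma> n * (\<integral>x. z n x * v x \<partial>M) - \<beta> * (\<integral>x. (z n x * z n x) * (z n x * v x) \<partial>M)
    - frm (wgt (z n)) (dir (z n)) v"
  using az_dir[OF z_H10 z_unit v, of n] frm_wgt_split[OF z_H10 z_H10 v, of n n] by linarith

text \<open>Each term of \<open>frm_V_z\<close> pairs something bounded with something vanishing:
  the test function in L2 against the bounded multiple of z, the test function in L4 against the
  cubic term, and the vanishing direction against the test function, which only has to be bounded in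
  the form.\<close>

lemma frm_V_z_tendsto_0:
  assumes p: "filterlim p at_top sequentially" and e: "\<And>i. e i \<in> H10 \<Omega>"
    and e2: "(\<lambda>i. \<integral>x. (e i x)\<^sup>2 \<partial>M) \<longlonglongrightarrow> 0" and K': "\<And>i. nsq (e i) \<le> K'"
  shows "(\<lambda>i. frm V (z (p i)) (e i)) \<longlonglongrightarrow> 0"
proof -
  have e4: "(\<lambda>i. \<integral>x. (e i x)^4 \<partial>M) \<longlonglongrightarrow> 0" by (rule nsq_tendsto_imp_L4_tendsto[OF e e2 K'])
  have z4: "(\<integral>x. (z n x)^4 \<partial>M) \<le> 8 * K\<^sup>2" for n by (rule L4_le_K[OF z_H10 nsq_z_le])
  have t1: "(\<lambda>i. \<gamma> (p i) * (\<integral>x. z (p i) x * e i x \<partial>M)) \<longlonglongrightarrow> 0"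
  proof (rule Lim_null_comparison)
    have "(\<lambda>i. \<integral>x. e i x * z (p i) x \<partial>M) \<longlonglongrightarrow> 0"
      by (rule integral_mult_tendsto_0[OF H10_sqint[OF e] H10_sqint[OF z_H10] e2, where K=1]) (simp add: z_unit)
    then have "(\<lambda>i. \<integral>x. z (p i) x * e i x \<partial>M) \<longlonglongrightarrow> 0" by (simp add: mult.commute)
    then have "(\<lambda>i. K * \<bar>\<integral>x. z (p i) x * e i x \<partial>M\<bar>) \<longlonglongrightarrow> K * \<bar>0\<bar>"
      by (intro tendsto_mult tendsto_const tendsto_rabs)
    then show "(\<lambda>i. K * \<bar>\<integral>x. z (p i) x * e i x \<partial>M\<bar>) \<longlonglongrightarrow> 0" by simp
    have "norm (\<gamma> (p i) * (\<integral>x. z (p i) x * e i x \<partial>M)) \<le> K * \<bar>\<integral>x. z (p i) x * e i x \<partial>M\<bar>" for i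
      using gamma_le_K[of "p i"] gamma_pos[of "p i"] by (simp add: abs_mult mult_right_mono)
    then show "\<forall>\<^sub>F i in sequentially. norm (\<gamma> (p i) * (\<integral>x. z (p i) x * e i x \<partial>M)) \<le> K * \<bar>\<integral>x. z (p i) x * e i x \<partial>M\<bar>"
      by (intro always_eventually allI)
  qed
  have t2: "(\<lambda>i. \<integral>x. (z (p i) x * z (p i) x) * (z (p i) x * e i x) \<partial>M) \<longlonglongrightarrow> 0"
  proof -
    have "(\<lambda>i. \<integral>x. (z (p i) x * e i x)\<^sup>2 \<partial>M) \<longlonglongrightarrow> 0"
    proof (rule tendsto_sandwich[OF _ _ tendsto_const])
      have "(\<lambda>i. sqrt (8 * K\<^sup>2) * sqrt (\<integral>x. (e i x)^4 \<partial>M)) \<longlonglongrightarrow> sqrt (8 * K\<^sup>2) * sqrt 0"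
        by (intro tendsto_mult tendsto_const tendsto_real_sqrt e4)
      then show "(\<lambda>i. sqrt (8 * K\<^sup>2) * sqrt (\<integral>x. (e i x)^4 \<partial>M)) \<longlonglongrightarrow> 0" by simp
      have "(\<integral>x. (z (p i) x * e i x)\<^sup>2 \<partial>M) \<le> sqrt (8 * K\<^sup>2) * sqrt (\<integral>x. (e i x)^4 \<partial>M)" for i
        by (rule order_trans[OF qint_mult_bound[OF H10_qint[OF z_H10] H10_qint[OF e]]])
           (intro mult_right_mono real_sqrt_le_mono z4 real_sqrt_ge_zero Bochner_Integration.integral_nonneg, simp)
      then show "\<forall>\<^sub>F i in sequentially. (\<integral>x. (z (p i) x * e i x)\<^sup>2 \<partial>M) \<le> sqrt (8 * K\<^sup>2) * sqrt (\<integral>x. (e i x)^4 \<partial>M)"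
        by (intro always_eventually allI)
    qed (auto intro!: always_eventually)
    moreover have "(\<integral>x. (z (p i) x * z (p i) x)\<^sup>2 \<partial>M) \<le> 8 * K\<^sup>2" for i
      using z4[of "p i"] by (simp add: power4_eq_xxxx power2_eq_square mult.assoc)
    ultimately have "(\<lambda>i. \<integral>x. (z (p i) x * e i x) * (z (p i) x * z (p i) x) \<partial>M) \<longlonglongrightarrow> 0"
      by (intro integral_mult_tendsto_0 qint_mult_sqint H10_qint z_H10 e)
    then show ?thesis by (simp add: mult.commute)
  qed
  have t3: "(\<lambda>i. frm (wgt (z (p i))) (dir (z (p i))) (e i)) \<longlonglongrightarrow> 0"
  proof (rule Lim_null_comparison)
    \<comment> \<open>The part with \<open>V\<close> is bounded through the H1 norm; in the density
      part the product of squares is at most the sum of fourth powers, with L4 bounds 8 K^2 and 8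
      K'^2.\<close>
    define L where "L = Vmax * K' + \<beta> * (8 * K\<^sup>2 + 8 * K'\<^sup>2)"
    have L: "frm (wgt (z (p i))) (e i) (e i) \<le> L" for i
    proof -
      have "frm V (e i) (e i) \<le> Vmax * K'"
        using frm_V_le_nsq[OF e[of i]] K'[of i] Vmax_ge_1
        by (meson order_trans mult_left_mono zero_le_one)
      moreover have "(\<integral>x. (z (p i) x * z (p i) x) * (e i x * e i x) \<partial>M) \<le> 8 * K\<^sup>2 + 8 * K'\<^sup>2"
      proof -
        have "(\<integral>x. (z (p i) x * z (p i) x) * (e i x * e i x) \<partial>M) \<le> (\<integral>x. (z (p i) x)^4 + (e i x)^4 \<partial>M)"
        proof (rule integral_mono)
          show "integrable M (\<lambda>x. (z (p i) x * z (p i) x) * (e i x * e i x))"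
            by (intro quartic_integrable H10_qint z_H10 e)
          show "integrable M (\<lambda>x. (z (p i) x)^4 + (e i x)^4)"
            by (intro Bochner_Integration.integrable_add qint_int H10_qint z_H10 e)
          show "(z (p i) x * z (p i) x) * (e i x * e i x) \<le> (z (p i) x)^4 + (e i x)^4" for x
            using two_mult_le_squares[of "z (p i) x * z (p i) x" "e i x * e i x"]
              abs_ge_self[of "(z (p i) x * z (p i) x) * (e i x * e i x)"]
              abs_ge_zero[of "(z (p i) x * z (p i) x) * (e i x * e i x)"]
            by (simp add: power4_eq_xxxx power2_eq_square mult.assoc)
        qed
        also have "\<dots> = (\<integral>x. (z (p i) x)^4 \<partial>M) + (\<integral>x. (e i x)^4 \<partial>M)"
          by (intro Bochner_Integration.integral_add qint_int H10_qint z_H10 e)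
        also have "\<dots> \<le> 8 * K\<^sup>2 + 8 * K'\<^sup>2"
        proof -
          have "(nsq (e i))\<^sup>2 \<le> K'\<^sup>2" by (intro power_mono K' frm_nonneg[OF weight_one])
          then show ?thesis using z4[of "p i"] L4_le_nsq[OF e[of i]] by linarith
        qed
        finally show ?thesis .
      qed
      ultimately show ?thesis
        unfolding L_def frm_wgt_split[OF z_H10 e e] using beta_nonneg by (intro add_mono mult_left_mono)
    qed
    have "(\<lambda>i. sqrt (res (p i)) * sqrt L) \<longlonglongrightarrow> sqrt 0 * sqrt L"
      by (intro tendsto_mult tendsto_const tendsto_real_sqrt filterlim_compose[OF res_tendsto_0 p])
    then show "(\<lambda>i. sqrt (res (p i)) * sqrt L) \<longlonglongrightarrow> 0" by simp
    have "norm (frm (wgt (z (p i))) (dir (z (p i))) (e i)) \<le> sqrt (res (p i)) * sqrt L" for i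
      unfolding real_norm_def
      by (rule order_trans[OF frm_Cauchy_Schwarz_sqrt[OF wgt_weight[OF z_H10] wgt_adm[OF z_H10 d_H10] wgt_adm[OF z_H10 e]]])
         (intro mult_left_mono real_sqrt_le_mono L real_sqrt_ge_zero res_nonneg)
    then show "\<forall>\<^sub>F i in sequentially. norm (frm (wgt (z (p i))) (dir (z (p i))) (e i)) \<le> sqrt (res (p i)) * sqrt L"
      by (intro always_eventually allI)
  qed
  have "(\<lambda>i. \<gamma> (p i) * (\<integral>x. z (p i) x * e i x \<partial>M) - \<beta> * (\<integral>x. (z (p i) x * z (p i) x) * (z (p i) x * e i x) \<partial>M)
    - frm (wgt (z (p i))) (dir (z (p i))) (e i)) \<longlonglongrightarrow> 0 - \<beta> * 0 - 0"
    by (intro tendsto_diff tendsto_mult tendsto_const t1 t2 t3)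
  then show ?thesis unfolding frm_V_z[OF e] by simp
qed

lemma nsq_diff_le: "nsq (\<lambda>x. z m x - z n x) \<le> 4 * K"
proof -
  have "0 \<le> nsq (\<lambda>x. 1 * z m x + 1 * z n x)" by (rule frm_nonneg[OF weight_one])
  then show ?thesis
    using frm_lincomb_square[OF weight_one, of "z m" "z n" 1 "-1"] frm_lincomb_square[OF weight_one, of "z m" "z n" 1 1]
      H10_H1[OF z_H10] nsq_z_le[of m] nsq_z_le[of n]
    by (simp add: adm_one)
qed

text \<open>By contradiction one may argue along two index sequences \<open>p\<close> and \<open>q\<close>; the equation solved by each
  iterate is then tested with the difference of the two iterates.\<close>

lemma H1_Cauchy:
  fixes r :: "nat \<Rightarrow> nat"
  assumes r: "strict_mono r"
    and c: "\<And>e. e > 0 \<Longrightarrow> \<exists>N. \<forall>m\<ge>N. \<forall>n\<ge>N. (\<integral>x. (z (r m) x - z (r n) x)\<^sup>2 \<partial>M) < e"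
    and e: "0 < e"
  shows "\<exists>N. \<forall>m\<ge>N. \<forall>n\<ge>N. nsq (\<lambda>x. z (r m) x - z (r n) x) < e"
proof (rule ccontr)
  assume "\<not> (\<exists>N. \<forall>m\<ge>N. \<forall>n\<ge>N. nsq (\<lambda>x. z (r m) x - z (r n) x) < e)"
  then have "\<forall>N. \<exists>m n. m \<ge> N \<and> n \<ge> N \<and> e \<le> nsq (\<lambda>x. z (r m) x - z (r n) x)"
    by (meson not_less)
  then obtain p where "\<forall>N. \<exists>n. p N \<ge> N \<and> n \<ge> N \<and> e \<le> nsq (\<lambda>x. z (r (p N)) x - z (r n) x)"
    using choice[of "\<lambda>N m. \<exists>n. m \<ge> N \<and> n \<ge> N \<and> e \<le> nsq (\<lambda>x. z (r m) x - z (r n) x)"] by blast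
  from choice[OF this] obtain q where
    pq: "\<forall>N. p N \<ge> N \<and> q N \<ge> N \<and> e \<le> nsq (\<lambda>x. z (r (p N)) x - z (r (q N)) x)" ..
  define w where "w i x = z (r (p i)) x - z (r (q i)) x" for i x
  have w: "w i \<in> H10 \<Omega>" for i
    using H10_diff[OF z_H10 z_H10] by (simp add: w_def[abs_def])
  \<comment> \<open>The index sequences \<open>p\<close> and \<open>q\<close> need not be monotone;
    dominating the identity already sends them to infinity.\<close>
  have lim: "filterlim (\<lambda>i. r (f i)) at_top sequentially" if "\<And>i. f i \<ge> i" for f :: "nat \<Rightarrow> nat"
  proof (rule filterlim_at_top_mono[OF filterlim_ident])
    show "\<forall>\<^sub>F i in sequentially. i \<le> r (f i)"
      using seq_suble[OF r] that by (intro always_eventually allI) (meson order_trans)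
  qed
  have w2: "(\<lambda>i. \<integral>x. (w i x)\<^sup>2 \<partial>M) \<longlonglongrightarrow> 0"
  proof (rule LIMSEQ_I)
    fix \<epsilon> :: real assume "0 < \<epsilon>"
    from c[OF this] obtain N where N: "\<forall>m\<ge>N. \<forall>n\<ge>N. (\<integral>x. (z (r m) x - z (r n) x)\<^sup>2 \<partial>M) < \<epsilon>" by blast
    have "norm ((\<integral>x. (w i x)\<^sup>2 \<partial>M) - 0) < \<epsilon>" if "i \<ge> N" for i
      using N[rule_format, of "p i" "q i"] pq[rule_format, of i] that by (simp add: w_def)
    then show "\<exists>N. \<forall>i\<ge>N. norm ((\<integral>x. (w i x)\<^sup>2 \<partial>M) - 0) < \<epsilon>" by blast
  qed
  have wK: "nsq (w i) \<le> 4 * K" for i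
    unfolding w_def by (rule nsq_diff_le)
  have "(\<lambda>i. frm V (z (r (p i))) (w i)) \<longlonglongrightarrow> 0"
    by (rule frm_V_z_tendsto_0[OF lim w w2 wK]) (use pq in auto)
  moreover have "(\<lambda>i. frm V (z (r (q i))) (w i)) \<longlonglongrightarrow> 0"
    by (rule frm_V_z_tendsto_0[OF lim w w2 wK]) (use pq in auto)
  ultimately have "(\<lambda>i. frm V (z (r (p i))) (w i) - frm V (z (r (q i))) (w i)) \<longlonglongrightarrow> 0 - 0"
    by (rule tendsto_diff)
  moreover have "frm V (z (r (p i))) (w i) - frm V (z (r (q i))) (w i) = frm V (w i) (w i)" for i
    using frm_lincomb_left[OF V_weight V_adm[OF z_H10] V_adm[OF z_H10] V_adm[OF w], of 1 "r (p i)" "-1" "r (q i)" i]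
    by (simp add: w_def[abs_def])
  ultimately have "(\<lambda>i. frm V (w i) (w i)) \<longlonglongrightarrow> 0" by simp
  then have "\<forall>\<^sub>F i in sequentially. frm V (w i) (w i) < e"
    using e by (rule order_tendstoD(2))
  then obtain i where "frm V (w i) (w i) < e" unfolding eventually_sequentially by blast
  moreover have "nsq (w i) \<le> frm V (w i) (w i)" using nsq_le_frm[OF H10_zero w] by (simp add: zero_wgt)
  moreover have "e \<le> nsq (w i)" using pq by (simp add: w_def[abs_def])
  ultimately show False by linarith
qed

text \<open>\<open>\<gamma>\<close> is a_z(z, z) minus the residual, so it converges to the form at
  the limit. The equation is the limit of \<open>az_dir\<close>, whose residual term tends to the
  form of the zero function. The bound \<open>1 \<le> lam\<close> records the positivity needed in
  \<open>Gop_eigenfunction\<close>.\<close>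

lemma limit_is_eigenfunction:
  fixes r :: "nat \<Rightarrow> nat"
  assumes r: "strict_mono r" and w: "w \<in> H10 \<Omega>" and lim: "(\<lambda>i. nsq (\<lambda>x. z (r i) x - w x)) \<longlonglongrightarrow> 0"
  defines "lam \<equiv> frm (wgt w) w w"
  shows "L2norm \<Omega> w = 1" and "energy \<Omega> V \<beta> w = Estar" and "(\<lambda>i. \<gamma> (r i)) \<longlonglongrightarrow> lam"
    and "\<And>v. v \<in> H10 \<Omega> \<Longrightarrow> frm (wgt w) w v = lam * (\<integral>x. w x * v x \<partial>M)" and "1 \<le> lam"
proof -
  note zr = z_H10[of "r _"]
  note l2 = nsq_tendsto_imp_L2_tendsto[OF H10_H1[OF z_H10] H10_H1[OF w] lim]
  have rt: "filterlim r at_top sequentially" using r by (rule filterlim_subseq)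
  have "(\<lambda>i. \<integral>x. z (r i) x * z (r i) x \<partial>M) \<longlonglongrightarrow> (\<integral>x. w x * w x \<partial>M)"
    by (rule integral_mult_tendsto[OF H10_sqint[OF z_H10] H10_sqint[OF w] l2 H10_sqint[OF z_H10] H10_sqint[OF w] l2])
  then have unit: "(\<integral>x. (w x)\<^sup>2 \<partial>M) = 1"
    using z_unit by (simp add: power2_eq_square LIMSEQ_const_iff)
  then show "L2norm \<Omega> w = 1" by (simp add: L2norm_eq_1_iff)
  have "(\<lambda>i. E (r i)) \<longlonglongrightarrow> energy \<Omega> V \<beta> w"
    unfolding energy_eq[OF z_H10] energy_eq[OF w] quartic_eq[symmetric]
    by (intro tendsto_add tendsto_divide tendsto_mult tendsto_const frm_V_tendsto quartic_tendsto z_H10 w lim) simp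
  moreover have "(\<lambda>i. E (r i)) \<longlonglongrightarrow> Estar" by (rule filterlim_compose[OF E_tendsto rt])
  ultimately show "energy \<Omega> V \<beta> w = Estar" by (rule LIMSEQ_unique)
  have "(\<lambda>i. frm (wgt (z (r i))) (z (r i)) (z (r i)) - res (r i)) \<longlonglongrightarrow> lam - 0"
    unfolding lam_def
    by (intro tendsto_diff frm_wgt_tendsto z_H10 w lim filterlim_compose[OF res_tendsto_0 rt])
  then show g: "(\<lambda>i. \<gamma> (r i)) \<longlonglongrightarrow> lam" by (simp add: res_eq)
  have "1 \<le> nsq w" using L2_le_nsq[OF H10_H1[OF w]] unit by simp
  then show "1 \<le> lam" using nsq_le_frm[OF w w] unfolding lam_def by linarith
  fix v assume v: "v \<in> H10 \<Omega>"
  have "(\<lambda>i. nsq (\<lambda>x. dir (z (r i)) x - 0)) \<longlonglongrightarrow> 0"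
    using filterlim_compose[OF nsq_d_tendsto_0 rt] by simp
  then have "(\<lambda>i. frm (wgt (z (r i))) (dir (z (r i))) v) \<longlonglongrightarrow> frm (wgt w) (\<lambda>x. 0) v"
    by (rule frm_wgt_tendsto[OF z_H10 w lim d_H10 H10_zero _ v v nsq_tendsto_const[OF v]])
  moreover have "frm (wgt w) (\<lambda>x. 0) v = 0"
    using frm_lincomb_left[OF wgt_weight[OF w] wgt_adm[OF w w] wgt_adm[OF w w] wgt_adm[OF w v], of 0 0] by simp
  moreover have "(\<lambda>i. \<gamma> (r i) * (\<integral>x. z (r i) x * v x \<partial>M)) \<longlonglongrightarrow> lam * (\<integral>x. w x * v x \<partial>M)"
    by (rule tendsto_mult[OF g], rule integral_mult_tendsto[OF H10_sqint[OF z_H10] H10_sqint[OF w] l2 H10_sqint[OF v] H10_sqint[OF v]]) simp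
  ultimately have "(\<lambda>i. \<gamma> (r i) * (\<integral>x. z (r i) x * v x \<partial>M) - frm (wgt (z (r i))) (dir (z (r i))) v) \<longlonglongrightarrow> lam * (\<integral>x. w x * v x \<partial>M) - 0"
    using tendsto_diff by fastforce
  moreover have "\<gamma> (r i) * (\<integral>x. z (r i) x * v x \<partial>M) - frm (wgt (z (r i))) (dir (z (r i))) v = frm (wgt (z (r i))) (z (r i)) v" for i
    using az_dir[OF z_H10 z_unit v, of "r i"] by linarith
  ultimately have "(\<lambda>i. frm (wgt (z (r i))) (z (r i)) v) \<longlonglongrightarrow> lam * (\<integral>x. w x * v x \<partial>M)" by simp
  moreover have "(\<lambda>i. frm (wgt (z (r i))) (z (r i)) v) \<longlonglongrightarrow> frm (wgt w) w v"
    by (intro frm_wgt_tendsto z_H10 w lim v nsq_tendsto_const)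
  ultimately show "frm (wgt w) w v = lam * (\<integral>x. w x * v x \<partial>M)"
    using LIMSEQ_unique by blast
qed

text \<open>The subsequence is Cauchy in L2, hence in H1. Its H1 limit \<open>u\<close> agrees with
  \<open>w\<close> almost everywhere, which carries both membership and H1 convergence over to the
  prescribed function \<open>w\<close>.\<close>

lemma L2_convergent_subsequence:
  fixes r :: "nat \<Rightarrow> nat"
  assumes r: "strict_mono r" and w: "L2 \<Omega> w" and lim: "(\<lambda>i. L2norm \<Omega> (\<lambda>x. z (r i) x - w x)) \<longlonglongrightarrow> 0"
  shows "w \<in> H10 \<Omega>" and "(\<lambda>i. nsq (\<lambda>x. z (r i) x - w x)) \<longlonglongrightarrow> 0"
proof -
  have ws: "sqint M w" using w by (simp add: L2_iff_sqint)
  note zs = H10_sqint[OF z_H10]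
  have l2: "(\<lambda>i. \<integral>x. (z (r i) x - w x)\<^sup>2 \<partial>M) \<longlonglongrightarrow> 0"
    using lim unfolding L2norm_def by (subst (asm) sqrt_tendsto_0_iff) auto
  have c: "\<exists>N. \<forall>m\<ge>N. \<forall>n\<ge>N. (\<integral>x. (z (r m) x - z (r n) x)\<^sup>2 \<partial>M) < e" if e: "e > 0" for e
  proof -
    have "\<forall>\<^sub>F i in sequentially. (\<integral>x. (z (r i) x - w x)\<^sup>2 \<partial>M) < e / 4"
      using e by (intro order_tendstoD(2)[OF l2]) simp
    then obtain N where N: "\<And>i. i \<ge> N \<Longrightarrow> (\<integral>x. (z (r i) x - w x)\<^sup>2 \<partial>M) < e / 4"
      unfolding eventually_sequentially by blast
    have "(\<integral>x. (z (r m) x - z (r n) x)\<^sup>2 \<partial>M) < e" if "m \<ge> N" "n \<ge> N" for m n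
    proof -
      have "(\<integral>x. (w x - z (r n) x)\<^sup>2 \<partial>M) = (\<integral>x. (z (r n) x - w x)\<^sup>2 \<partial>M)" by (simp add: power2_commute)
      then show ?thesis
        using integral_square_add_le[OF sqint_diff[OF zs ws] sqint_diff[OF ws zs], of "r m" "r n"]
          N[OF that(1)] N[OF that(2)] by simp
    qed
    then show ?thesis by blast
  qed
  obtain u where u: "u \<in> H10 \<Omega>" "(\<lambda>i. nsq (\<lambda>x. z (r i) x - u x)) \<longlonglongrightarrow> 0"
    using H10_complete[of "\<lambda>i. z (r i)", OF z_H10 H1_Cauchy[OF r c]] by blast
  note us = H10_sqint[OF u(1)]
  note lu = nsq_tendsto_imp_L2_tendsto[OF H10_H1[OF z_H10] H10_H1[OF u(1)] u(2)]
  have "(\<integral>x. (u x - w x)\<^sup>2 \<partial>M) \<le> 2 * (\<integral>x. (z (r i) x - u x)\<^sup>2 \<partial>M) + 2 * (\<integral>x. (z (r i) x - w x)\<^sup>2 \<partial>M)" for i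
  proof -
    have "(\<integral>x. (u x - z (r i) x)\<^sup>2 \<partial>M) = (\<integral>x. (z (r i) x - u x)\<^sup>2 \<partial>M)" by (simp add: power2_commute)
    then show ?thesis
      using integral_square_add_le[OF sqint_diff[OF us zs] sqint_diff[OF zs ws], of "r i" "r i"] by simp
  qed
  moreover have "(\<lambda>i. 2 * (\<integral>x. (z (r i) x - u x)\<^sup>2 \<partial>M) + 2 * (\<integral>x. (z (r i) x - w x)\<^sup>2 \<partial>M)) \<longlonglongrightarrow> 2 * 0 + 2 * 0"
    by (intro tendsto_add tendsto_mult tendsto_const l2 lu)
  ultimately have "(\<integral>x. (u x - w x)\<^sup>2 \<partial>M) \<le> 0"
    using LIMSEQ_le_const[of "\<lambda>i. 2 * (\<integral>x. (z (r i) x - u x)\<^sup>2 \<partial>M) + 2 * (\<integral>x. (z (r i) x - w x)\<^sup>2 \<partial>M)" 0] by simp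
  moreover have "0 \<le> (\<integral>x. (u x - w x)\<^sup>2 \<partial>M)" by simp
  ultimately have "(\<integral>x. (u x - w x)\<^sup>2 \<partial>M) = 0" by linarith
  then have "AE x in M. (u x - w x)\<^sup>2 = 0"
    using sqint_int[OF sqint_diff[OF us ws]] by (subst (asm) integral_nonneg_eq_0_iff_AE) auto
  then have ae: "AE x in M. u x = w x" by eventually_elim simp
  show wH: "w \<in> H10 \<Omega>" by (rule H10_cong_AE[OF u(1) ws ae])
  have z: "nsq (\<lambda>x. u x - w x) = 0" by (rule nsq_diff_AE_eq_0[OF H10_H1[OF u(1)] H10_H1[OF wH] ae])
  have "nsq (\<lambda>x. z (r i) x - w x) \<le> 2 * nsq (\<lambda>x. z (r i) x - u x)" for i
    using nsq_diff_triangle[OF H10_H1[OF z_H10] H10_H1[OF u(1)] H10_H1[OF wH], of "r i"] z by simp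
  note le = this
  have up: "(\<lambda>i. 2 * nsq (\<lambda>x. z (r i) x - u x)) \<longlonglongrightarrow> 0"
    using tendsto_mult[OF tendsto_const u(2), of 2] by simp
  show "(\<lambda>i. nsq (\<lambda>x. z (r i) x - w x)) \<longlonglongrightarrow> 0"
    by (rule tendsto_sandwich[OF _ _ tendsto_const up])
       (intro always_eventually allI le frm_nonneg[OF weight_one])+
qed

text \<open>The multiple of G w by \<open>lam\<close> solves the same variational problem as w, so
  they agree almost everywhere and have equal L2 norms. Testing each of the two equations with the
  solution of the other gives the formula with the inner product.\<close>

lemma Gop_eigenfunction:
  assumes w: "w \<in> H10 \<Omega>" and n: "L2norm \<Omega> w = 1" and l: "0 < lam"
    and e: "\<And>v. v \<in> H10 \<Omega> \<Longrightarrow> frm (wgt w) w v = lam * (\<integral>x. w x * v x \<partial>M)"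
  shows "lam = 1 / L2inner \<Omega> w (Gop \<Omega> V \<beta> w w)" and "lam = 1 / L2norm \<Omega> (Gop \<Omega> V \<beta> w w)"
proof -
  let ?G = "Gop \<Omega> V \<beta> w w"
  have u: "(\<integral>x. (w x)\<^sup>2 \<partial>M) = 1" using n by (simp add: L2norm_eq_1_iff)
  note G = Gop_spec[OF w H10_sqint[OF w]]
  have "lam * (\<integral>x. w x * ?G x \<partial>M) = 1"
    using e[OF G(1)] G(2)[OF w] u frm_sym[of "wgt w" w ?G] by (simp add: power2_eq_square)
  then show "lam = 1 / L2inner \<Omega> w ?G"
    unfolding L2inner_def by (metis div_by_1 divide_divide_eq_right mult.commute mult_cancel_left1 nonzero_eq_divide_eq mult_zero_right zero_neq_one)
  have lG: "(\<lambda>x. lam * ?G x) \<in> H10 \<Omega>" by (rule H10_cmult[OF G(1)])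
  have "AE x in M. lam * ?G x = w x"
  proof (rule H10_eq_AE[OF w lG w])
    fix v assume v: "v \<in> H10 \<Omega>"
    show "frm (wgt w) (\<lambda>x. lam * ?G x) v = frm (wgt w) w v"
      using frm_lincomb_left[OF wgt_weight[OF w] wgt_adm[OF w G(1)] wgt_adm[OF w G(1)] wgt_adm[OF w v], of lam 0]
      by (simp add: G(2)[OF v] e[OF v])
  qed
  then have "(\<integral>x. (lam * ?G x)\<^sup>2 \<partial>M) = (\<integral>x. (w x)\<^sup>2 \<partial>M)"
    using sqint_meas[OF H10_sqint[OF G(1)]] sqint_meas[OF H10_sqint[OF w]]
    by (intro integral_cong_AE) (auto elim!: eventually_mono)
  then have "lam\<^sup>2 * (\<integral>x. (?G x)\<^sup>2 \<partial>M) = 1" using u by (simp add: power_mult_distrib)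
  then have "sqrt (lam\<^sup>2 * (\<integral>x. (?G x)\<^sup>2 \<partial>M)) = 1" by simp
  then have "lam * L2norm \<Omega> ?G = 1" using l by (simp add: real_sqrt_mult L2norm_def)
  then show "lam = 1 / L2norm \<Omega> ?G" by (metis nonzero_eq_divide_eq mult_zero_right zero_neq_one)
qed

end

text \<open>The last clause starts from L2 convergence, so it also covers subsequences converging in
  H1. The energy hypothesis is applied to the given step sizes themselves.\<close>

theorem mainTheorem10:
  fixes \<Omega> :: "'a::euclidean_space set" and V :: "'a \<Rightarrow> real" and \<beta> :: real
    and z0 :: "'a \<Rightarrow> real" and \<tau> :: "nat \<Rightarrow> real" and \<tau>min \<tau>max :: real
  assumes dim: "DIM('a) \<in> {1, 2, 3}"
    and dom: "bounded_domain \<Omega>"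
    and shape: "(convex \<Omega> \<and> lipschitz_boundary \<Omega>) \<or> smooth_boundary \<Omega>"
    and beta: "\<beta> \<ge> 0"
    and Vmeas: "V \<in> borel_measurable (lebesgue_on \<Omega>)"
    and Vbnd: "\<exists>C. AE x in lebesgue_on \<Omega>. 1 \<le> V x \<and> V x \<le> C"
    and z0: "z0 \<in> H10 \<Omega>" "L2norm \<Omega> z0 = 1"
    and taumax: "0 < \<tau>max" "\<tau>max < 2"
    and energy_red: "\<And>\<sigma>. (\<forall>n. 0 < \<sigma> n \<and> \<sigma> n \<le> \<tau>max) \<Longrightarrow>
        (\<forall>n. energy \<Omega> V \<beta> (gf_seq \<Omega> V \<beta> \<sigma> z0 (Suc n))
                 \<le> energy \<Omega> V \<beta> (gf_hat \<Omega> V \<beta> (\<sigma> n) (gf_seq \<Omega> V \<beta> \<sigma> z0 n))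
             \<and> energy \<Omega> V \<beta> (gf_hat \<Omega> V \<beta> (\<sigma> n) (gf_seq \<Omega> V \<beta> \<sigma> z0 n))
                 \<le> energy \<Omega> V \<beta> (gf_seq \<Omega> V \<beta> \<sigma> z0 n))"
    and taumin: "0 < \<tau>min"
    and tau: "\<And>n. \<tau>min \<le> \<tau> n \<and> \<tau> n \<le> \<tau>max"
  shows "\<exists>Estar.
     (\<lambda>n. energy \<Omega> V \<beta> (gf_seq \<Omega> V \<beta> \<tau> z0 n)) \<longlonglongrightarrow> Estar \<and>
     (\<exists>r zstar lstar. strict_mono r \<and> zstar \<in> H10 \<Omega> \<and> L2norm \<Omega> zstar = 1 \<and>
        energy \<Omega> V \<beta> zstar = Estar \<and>
        (\<lambda>i. H1norm \<Omega> (\<lambda>x. gf_seq \<Omega> V \<beta> \<tau> z0 (r i) x - zstar x)) \<longlonglongrightarrow> 0 \<and>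
        (\<lambda>i. gf_gamma \<Omega> V \<beta> (gf_seq \<Omega> V \<beta> \<tau> z0 (r i))) \<longlonglongrightarrow> lstar \<and>
        lstar = 1 / L2inner \<Omega> zstar (Gop \<Omega> V \<beta> zstar zstar) \<and>
        lstar = 1 / L2norm \<Omega> (Gop \<Omega> V \<beta> zstar zstar) \<and>
        (\<forall>v\<in>H10 \<Omega>. aform \<Omega> V \<beta> zstar zstar v = lstar * L2inner \<Omega> zstar v) \<and>
        is_GPE_eigenfunction \<Omega> V \<beta> zstar lstar) \<and>
     (\<forall>r w. strict_mono r \<and> L2 \<Omega> w \<and>
        (\<lambda>i. L2norm \<Omega> (\<lambda>x. gf_seq \<Omega> V \<beta> \<tau> z0 (r i) x - w x)) \<longlonglongrightarrow> 0 \<longrightarrow>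
        w \<in> H10 \<Omega> \<and> L2norm \<Omega> w = 1 \<and> energy \<Omega> V \<beta> w = Estar \<and>
        (\<lambda>i. H1norm \<Omega> (\<lambda>x. gf_seq \<Omega> V \<beta> \<tau> z0 (r i) x - w x)) \<longlonglongrightarrow> 0 \<and>
        (\<exists>lam. is_GPE_eigenfunction \<Omega> V \<beta> w lam))"
proof -
  interpret GPE_iteration \<Omega> V \<beta> z0 \<tau> \<tau>min \<tau>max
  proof unfold_locales
    show "open \<Omega>" "bounded \<Omega>" using dom by (simp_all add: bounded_domain_def)
    have t: "\<forall>n. 0 < \<tau> n \<and> \<tau> n \<le> \<tau>max"
    proof
      show "0 < \<tau> n \<and> \<tau> n \<le> \<tau>max" for n using tau[of n] taumin by linarith
    qed
    show "energy \<Omega> V \<beta> (gf_hat \<Omega> V \<beta> (\<tau> n) (gf_seq \<Omega> V \<beta> \<tau> z0 n))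
      \<le> energy \<Omega> V \<beta> (gf_seq \<Omega> V \<beta> \<tau> z0 n)" for n
      by (rule energy_red[of \<tau>, OF t, THEN spec, THEN conjunct2])
  qed (rule dim beta Vmeas Vbnd z0 taumin taumax(2) tau[THEN conjunct1] tau[THEN conjunct2])+
  \<comment> \<open>The eigenvalue of a limit w is a_w(w, w), that is, 2 \<open>Estar\<close> plus
    beta/2 times the integral of w^4. Limits of equal energy may therefore differ in their
    eigenvalues.\<close>
  have eig: "is_GPE_eigenfunction \<Omega> V \<beta> w (frm (wgt w) w w)"
    if "strict_mono r" "w \<in> H10 \<Omega>" "(\<lambda>i. nsq (\<lambda>x. z (r i) x - w x)) \<longlonglongrightarrow> 0" for r w
    unfolding is_GPE_eigenfunction_def aform_eq_frm L2inner_def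
    by (intro conjI ballI limit_is_eigenfunction(1,4)[OF that] that(2))
  have H1: "(\<lambda>i. H1norm \<Omega> (\<lambda>x. z (r i) x - w x)) \<longlonglongrightarrow> 0"
    if "w \<in> H10 \<Omega>" "(\<lambda>i. nsq (\<lambda>x. z (r i) x - w x)) \<longlonglongrightarrow> 0" for r w
    using that by (subst H1norm_tendsto_iff) (auto intro: H1_diff H10_H1 z_H10)
  obtain r where r: "strict_mono (r :: nat \<Rightarrow> nat)"
    "\<forall>e>0. \<exists>N. \<forall>m\<ge>N. \<forall>n\<ge>N. (\<integral>x. (z (r m) x - z (r n) x)\<^sup>2 \<partial>M) < e"
    using Rellich[of z, OF z_H10 nsq_z_le] by blast
  obtain w where w: "w \<in> H10 \<Omega>" "(\<lambda>i. nsq (\<lambda>x. z (r i) x - w x)) \<longlonglongrightarrow> 0"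
    using H10_complete[of "\<lambda>i. z (r i)", OF z_H10 H1_Cauchy[OF r(1)]] r(2) by blast
  note lim = limit_is_eigenfunction[OF r(1) w]
  have lam: "0 < frm (wgt w) w w" using lim(5) by simp
  note G = Gop_eigenfunction[OF w(1) lim(1) lam lim(4)]
  note e = eig[OF r(1) w]
  then have ev: "\<forall>v\<in>H10 \<Omega>. aform \<Omega> V \<beta> w w v = frm (wgt w) w w * L2inner \<Omega> w v"
    unfolding is_GPE_eigenfunction_def by blast
  show ?thesis
  proof (rule exI[of _ Estar], intro conjI)
    show "E \<longlonglongrightarrow> Estar" by (rule E_tendsto)
    show "\<exists>r zstar lstar. strict_mono r \<and> zstar \<in> H10 \<Omega> \<and> L2norm \<Omega> zstar = 1 \<and>
        energy \<Omega> V \<beta> zstar = Estar \<and>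
        (\<lambda>i. H1norm \<Omega> (\<lambda>x. z (r i) x - zstar x)) \<longlonglongrightarrow> 0 \<and>
        (\<lambda>i. gf_gamma \<Omega> V \<beta> (z (r i))) \<longlonglongrightarrow> lstar \<and>
        lstar = 1 / L2inner \<Omega> zstar (Gop \<Omega> V \<beta> zstar zstar) \<and>
        lstar = 1 / L2norm \<Omega> (Gop \<Omega> V \<beta> zstar zstar) \<and>
        (\<forall>v\<in>H10 \<Omega>. aform \<Omega> V \<beta> zstar zstar v = lstar * L2inner \<Omega> zstar v) \<and>
        is_GPE_eigenfunction \<Omega> V \<beta> zstar lstar"
      by (rule exI[of _ r], rule exI[of _ w], rule exI[of _ "frm (wgt w) w w"], intro conjI r w lim(1-3) H1 G ev e)
    show "\<forall>r w. strict_mono r \<and> L2 \<Omega> w \<and> (\<lambda>i. L2norm \<Omega> (\<lambda>x. z (r i) x - w x)) \<longlonglongrightarrow> 0 \<longrightarrow>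
        w \<in> H10 \<Omega> \<and> L2norm \<Omega> w = 1 \<and> energy \<Omega> V \<beta> w = Estar \<and>
        (\<lambda>i. H1norm \<Omega> (\<lambda>x. z (r i) x - w x)) \<longlonglongrightarrow> 0 \<and>
        (\<exists>lam. is_GPE_eigenfunction \<Omega> V \<beta> w lam)"
    proof (intro allI impI, elim conjE)
      fix r :: "nat \<Rightarrow> nat" and w
      assume r: "strict_mono r" and w: "L2 \<Omega> w" "(\<lambda>i. L2norm \<Omega> (\<lambda>x. z (r i) x - w x)) \<longlonglongrightarrow> 0"
      note c = L2_convergent_subsequence[OF r w]
      show "w \<in> H10 \<Omega> \<and> L2norm \<Omega> w = 1 \<and> energy \<Omega> V \<beta> w = Estar \<and>
        (\<lambda>i. H1norm \<Omega> (\<lambda>x. z (r i) x - w x)) \<longlonglongrightarrow> 0 \<and>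
        (\<exists>lam. is_GPE_eigenfunction \<Omega> V \<beta> w lam)"
        using c(1) limit_is_eigenfunction(1,2)[OF r c] H1[OF c] eig[OF r c] by blast
    qed
  qed
qed

end
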